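(* Consider the CTMDP model described in the context, suppose Condition 1 holds, and let $\pi$ be a feasible policy with a finite value. Then the measure $\eta^\pi_\gamma(dx\times A)$ is $\sigma$-finite on $\zeta$, i.e. its restriction to $\mathcal B(\zeta)$ is $\sigma$-finite.
   Context: CTMDP model. $S$ and $A$ are nonempty Borel spaces, $\gamma$ is a probability measure on $\mathcal B(S)$, and $q(dy|x,a)$ is a signed kernel on $\mathcal B(S)$ given $(x,a)\in S\times A$ such that $\tilde q(\Gamma|x,a):=q(\Gamma\setminus\{x\}|x,a)\ge0$ for all $\Gamma\in\mathcal B(S)$, $q(S|x,a)=0$, and, with $q_x(a):=-q(\{x\}|x,a)\ge0$, $\sup_{a\in A}q_x(a)<\infty$ for each $x\in S$. Conventions: $0/0:=0$, $0\cdot\infty:=0$, $c/0:=+\infty$ for $c>0$. Let $x_\infty\notin S$ be an isolated point. The sample space $\Omega$ consists of sequences $\omega=(x_0,\theta_1,x_1,\theta_2,\dots)$ with $x_n\in S$, $\theta_n\in(0,\infty)$, together with sequences $(x_0,\theta_1,\dots,\theta_n,x_n,\infty,x_\infty,\infty,x_\infty,\dots)$; $t_0:=0$, $t_n:=t_{n-1}+\theta_n$, $t_\infty:=\lim_n t_n$, $\xi_t:=\sum_{n\ge0}I\{t_n\le t<t_{n+1}\}x_n+I\{t_\infty\le t\}x_\infty$. A policy $\pi=(\pi_n)_{n\ge1}$ is a sequence of stochastic kernels $\pi_n(da|x_0,\theta_1,\dots,x_{n-1},s)$ on $A$ ($s>0$ is the time since the last jump), and $\pi(da|\omega,t):=\sum_{n\ge0}I\{t_n<t\le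 t_{n+1}\}\pi_{n+1}(da|x_0,\theta_1,\dots,x_n,t-t_n)$ for $t<t_\infty$ (after $t_\infty$ a dummy action at which all rates and costs vanish is used). A policy is deterministic Markov if $\pi_n(\cdot|x_0,\dots,x_{n-1},s)$ is a Dirac measure depending only on $(x_{n-1},s)$; $\Pi_{DM}$ is the set of such policies. Under $\pi$, $P^\pi_\gamma$ is the unique probability on $\Omega$ with $x_0\sim\gamma$, $P^\pi_\gamma(\theta_{n+1}\ge t|x_0,\theta_1,\dots,x_n)=\exp(-\int_0^t\int_A q_{x_n}(a)\pi_{n+1}(da|x_0,\dots,x_n,s)ds)$, and $P^\pi_\gamma(x_{n+1}\in\Gamma|x_0,\dots,x_n,\theta_{n+1})=\frac{\int_A\tilde q(\Gamma|x_n,a)\pi_{n+1}(da|x_0,\dots,x_n,\theta_{n+1})}{\int_A q_{x_n}(a)\pi_{n+1}(da|x_0,\dots,x_n,\theta_{n+1})}$ for $\Gamma\in\mathcal B(S)$, the remaining probability going to $x_\infty$; $E^\pi_\gamma$ is its expectation, $E^\pi_x$ when $\gamma=\delta_x$. Costs: measurable $c_0,\dots,c_N:S\times A\to[0,\infty)$, $c_i(x_\infty,\cdot):=0$; constants $d_1,\dots,d_N\in[0,\infty)$. $\pi$ is feasible if $E^\pi_\gamma[\int_0^\infty\int_A c_j(\xi_t,a)\pi(da|\omega,t)dt]\le d_j$ for $j=1,\dots,N$, and feasible with a finite value if moreover the same expression with $c_0$ is finite. Occupation measure: $\eta^\pi_\gamma(\Gamma_S\times\Gamma_A):=E^\pi_\gamma[\int_0^\infty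 I\{\xi_t\in\Gamma_S\}\pi(\Gamma_A|\omega,t)dt]$. $\zeta:=\{x\in S:\inf_{\pi\in\Pi_{DM}}E^\pi_x[\int_0^\infty\int_A\sum_{i=0}^Nc_i(\xi_t,a)\pi(da|\omega,t)dt]>0\}$ (a measurable set under Condition 1). Condition 1: (a) $A$ is compact; (b) for each bounded continuous $f$ on $S$, $(x,a)\mapsto\int_S f(y)\tilde q(dy|x,a)/q_x(a)$ is continuous; (c) $(x,a)\mapsto q_x(a)$ is continuous; (d) each $c_i$ is lower semicontinuous on $S\times A$. *)

theory Defs
  imports "HOL-Probability.Probability"
begin

text \<open>A trajectory omega = (x0, theta1, x1, theta2, x2, ...) is encoded as a function
  nat => ennreal * state option: component 0 is (0, Some x0) (dummy sojourn time 0),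
  component n >= 1 is (theta_n, x_n). The isolated point x_infinity is None, and
  theta_n = top encodes theta_n = infinity.\<close>

type_synonym 's traj = "nat \<Rightarrow> ennreal \<times> 's option"

definition optM :: "'s::topological_space option measure" where
  "optM = sigma UNIV (insert {None} ((\<lambda>B. Some ` B) ` sets borel))"

definition stepM :: "(ennreal \<times> 's::topological_space option) measure" where
  "stepM = borel \<Otimes>\<^sub>M optM"

definition trajM :: "('s::topological_space) traj measure" where
  "trajM = PiM UNIV (\<lambda>_. stepM)"

definition histM :: "nat \<Rightarrow> ('s::topological_space) traj measure" where
  "histM n = PiM {..n} (\<lambda>_. stepM)"

definition Omega :: "'s set \<Rightarrow> 's traj set" where
  "Omega S = {\<omega>. fst (\<omega> 0) = 0 \<and> snd (\<omega> 0) \<in> Some ` S \<and>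
     (\<forall>n\<ge>1. fst (\<omega> n) > 0 \<and>
        (fst (\<omega> n) < \<top> \<longrightarrow> snd (\<omega> n) \<in> Some ` S) \<and>
        (fst (\<omega> n) = \<top> \<longrightarrow> snd (\<omega> n) = None \<and> fst (\<omega> (Suc n)) = \<top>))}"

definition qx :: "('s \<Rightarrow> 'a \<Rightarrow> 's set \<Rightarrow> real) \<Rightarrow> 's \<Rightarrow> 'a \<Rightarrow> real" where
  "qx q x a = - q x a {x}"

definition qt :: "('s \<Rightarrow> 'a \<Rightarrow> 's set \<Rightarrow> real) \<Rightarrow> 's \<Rightarrow> 'a \<Rightarrow> 's set \<Rightarrow> real" where
  "qt q x a \<Gamma> = q x a (\<Gamma> - {x})"

definition qxO :: "('s \<Rightarrow> 'a \<Rightarrow> 's set \<Rightarrow> real) \<Rightarrow> 's option \<Rightarrow> 'a \<Rightarrow> real" where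
  "qxO q xo a = (case xo of None \<Rightarrow> 0 | Some x \<Rightarrow> qx q x a)"

definition qtO :: "('s \<Rightarrow> 'a \<Rightarrow> 's set \<Rightarrow> real) \<Rightarrow> 's option \<Rightarrow> 'a \<Rightarrow> 's set \<Rightarrow> real" where
  "qtO q xo a \<Gamma> = (case xo of None \<Rightarrow> 0 | Some x \<Rightarrow> qt q x a \<Gamma>)"

definition qtM :: "'s::topological_space set \<Rightarrow> ('s \<Rightarrow> 'a \<Rightarrow> 's set \<Rightarrow> real) \<Rightarrow> 's \<Rightarrow> 'a \<Rightarrow> 's measure" where
  "qtM S q x a = measure_of S (sets (restrict_space borel S)) (\<lambda>\<Gamma>. ennreal (qt q x a \<Gamma>))"

definition ctmdp_model :: "'s::polish_space set \<Rightarrow> 'a::polish_space set \<Rightarrow> ('s \<Rightarrow> 'a \<Rightarrow> 's set \<Rightarrow> real) \<Rightarrow> bool" where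
  "ctmdp_model S A q \<longleftrightarrow>
     S \<in> sets borel \<and> S \<noteq> {} \<and> A \<in> sets borel \<and> A \<noteq> {} \<and>
     (\<forall>x\<in>S. \<forall>a\<in>A. \<forall>F::nat \<Rightarrow> 's set.
        range F \<subseteq> sets borel \<and> (\<forall>i. F i \<subseteq> S) \<and> disjoint_family F \<longrightarrow>
        (\<lambda>i. q x a (F i)) sums q x a (\<Union>i. F i)) \<and>
     (\<forall>\<Gamma>\<in>sets borel. \<Gamma> \<subseteq> S \<longrightarrow>
        (\<lambda>(x, a). q x a \<Gamma>) \<in> borel_measurable (restrict_space borel (S \<times> A))) \<and>
     (\<forall>x\<in>S. \<forall>a\<in>A. \<forall>\<Gamma>\<in>sets borel. \<Gamma> \<subseteq> S \<longrightarrow> qt q x a \<Gamma> \<ge> 0) \<and>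
     (\<forall>x\<in>S. \<forall>a\<in>A. q x a S = 0) \<and>
     (\<forall>x\<in>S. \<forall>a\<in>A. qx q x a \<ge> 0) \<and>
     (\<forall>x\<in>S. (\<Squnion>a\<in>A. ennreal (qx q x a)) < \<top>)"

definition costs_ok :: "'s::polish_space set \<Rightarrow> 'a::polish_space set \<Rightarrow> (nat \<Rightarrow> 's \<Rightarrow> 'a \<Rightarrow> real) \<Rightarrow> nat \<Rightarrow> (nat \<Rightarrow> real) \<Rightarrow> bool" where
  "costs_ok S A c N d \<longleftrightarrow>
     (\<forall>i\<le>N. (\<lambda>(x, a). c i x a) \<in> borel_measurable (restrict_space borel (S \<times> A)) \<and>
            (\<forall>x\<in>S. \<forall>a\<in>A. c i x a \<ge> 0)) \<and>
     (\<forall>j\<in>{1..N}. d j \<ge> 0)"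

text \<open>pol n omega s = pi_n(da | x0, theta1, ..., x_{n-1}, s) for n >= 1; it may only depend on
  the components 0..n-1 of omega, and must be a stochastic kernel (for s > 0).\<close>
definition is_policy :: "'s::polish_space set \<Rightarrow> 'a::polish_space set \<Rightarrow> (nat \<Rightarrow> 's traj \<Rightarrow> real \<Rightarrow> 'a measure) \<Rightarrow> bool" where
  "is_policy S A pol \<longleftrightarrow>
     (\<forall>n\<ge>1. (\<forall>\<omega> \<omega>' s. (\<forall>k<n. \<omega> k = \<omega>' k) \<longrightarrow> pol n \<omega> s = pol n \<omega>' s) \<and>
        (\<lambda>(\<omega>, s). pol n \<omega> s) \<in> measurable (trajM \<Otimes>\<^sub>M restrict_space borel {0<..})
                                     (prob_algebra (restrict_space borel A)))"

definition is_DM :: "'s::polish_space set \<Rightarrow> 'a::polish_space set \<Rightarrow> (nat \<Rightarrow> 's traj \<Rightarrow> real \<Rightarrow> 'a measure) \<Rightarrow> bool" where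
  "is_DM S A pol \<longleftrightarrow> is_policy S A pol \<and>
     (\<forall>n\<ge>1. \<forall>\<omega> s. s > 0 \<longrightarrow> (\<exists>a\<in>A. pol n \<omega> s = return (restrict_space borel A) a)) \<and>
     (\<forall>n\<ge>1. \<forall>\<omega> \<omega>' s. s > 0 \<longrightarrow> snd (\<omega> (n - 1)) = snd (\<omega>' (n - 1)) \<longrightarrow> pol n \<omega> s = pol n \<omega>' s)"

definition hazard :: "('s \<Rightarrow> 'a \<Rightarrow> 's set \<Rightarrow> real) \<Rightarrow> (nat \<Rightarrow> 's traj \<Rightarrow> real \<Rightarrow> 'a measure) \<Rightarrow> nat \<Rightarrow> 's traj \<Rightarrow> real \<Rightarrow> ennreal" where
  "hazard q pol n \<omega> t =
     (\<integral>\<^sup>+ s. indicator {0<..t} s * (\<integral>\<^sup>+ a. ennreal (qxO q (snd (\<omega> n)) a) \<partial>(pol (Suc n) \<omega> s)) \<partial>lborel)"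

text \<open>jump distribution of x_{n+1} given the history h_n and theta_{n+1} = s (0/0 = 0)\<close>
definition jprob :: "('s \<Rightarrow> 'a \<Rightarrow> 's set \<Rightarrow> real) \<Rightarrow> (nat \<Rightarrow> 's traj \<Rightarrow> real \<Rightarrow> 'a measure) \<Rightarrow> nat \<Rightarrow> 's traj \<Rightarrow> real \<Rightarrow> 's set \<Rightarrow> real" where
  "jprob q pol n \<omega> s \<Gamma> =
     enn2real (\<integral>\<^sup>+ a. ennreal (qtO q (snd (\<omega> n)) a \<Gamma>) \<partial>(pol (Suc n) \<omega> s)) /
     enn2real (\<integral>\<^sup>+ a. ennreal (qxO q (snd (\<omega> n)) a) \<partial>(pol (Suc n) \<omega> s))"

definition is_strategic ::
  "'s::polish_space set \<Rightarrow> ('s \<Rightarrow> 'a \<Rightarrow> 's set \<Rightarrow> real) \<Rightarrow> 's measure \<Rightarrow> (nat \<Rightarrow> 's traj \<Rightarrow> real \<Rightarrow> 'a measure) \<Rightarrow> 's traj measure \<Rightarrow> bool" where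
  "is_strategic S q \<gamma> pol P \<longleftrightarrow>
     prob_space P \<and> sets P = sets trajM \<and> emeasure P (Omega S) = 1 \<and>
     (\<forall>\<Gamma>\<in>sets borel. \<Gamma> \<subseteq> S \<longrightarrow>
        emeasure P {\<omega>\<in>space P. snd (\<omega> 0) \<in> Some ` \<Gamma>} = emeasure \<gamma> \<Gamma>) \<and>
     (\<forall>n. \<forall>B\<in>sets (histM n). \<forall>t::real. t \<ge> 0 \<longrightarrow>
        emeasure P {\<omega>\<in>space P. restrict \<omega> {..n} \<in> B \<and> ennreal t \<le> fst (\<omega> (Suc n))} =
        (\<integral>\<^sup>+ \<omega>. indicator B (restrict \<omega> {..n}) * ennreal (exp (- enn2real (hazard q pol n \<omega> t))) \<partial>P)) \<and>
     (\<forall>n. \<forall>B\<in>sets (histM n \<Otimes>\<^sub>M (borel :: ennreal measure)). \<forall>\<Gamma>\<in>sets borel. \<Gamma> \<subseteq> S \<longrightarrow>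
        emeasure P {\<omega>\<in>space P. (restrict \<omega> {..n}, fst (\<omega> (Suc n))) \<in> B \<and> fst (\<omega> (Suc n)) < \<top> \<and>
                                 snd (\<omega> (Suc n)) \<in> Some ` \<Gamma>} =
        (\<integral>\<^sup>+ \<omega>. indicator B (restrict \<omega> {..n}, fst (\<omega> (Suc n))) * indicator {..<\<top>} (fst (\<omega> (Suc n))) *
                  ennreal (jprob q pol n \<omega> (enn2real (fst (\<omega> (Suc n)))) \<Gamma>) \<partial>P))"

definition law ::
  "'s::polish_space set \<Rightarrow> ('s \<Rightarrow> 'a \<Rightarrow> 's set \<Rightarrow> real) \<Rightarrow> 's measure \<Rightarrow> (nat \<Rightarrow> 's traj \<Rightarrow> real \<Rightarrow> 'a measure) \<Rightarrow> 's traj measure" where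
  "law S q \<gamma> pol = (THE P. is_strategic S q \<gamma> pol P)"

definition tn :: "'s traj \<Rightarrow> nat \<Rightarrow> ennreal" where
  "tn \<omega> n = (\<Sum>k\<in>{1..n}. fst (\<omega> k))"

text \<open>xi_t (None = x_infinity, taken when t >= t_infinity)\<close>
definition xi :: "'s traj \<Rightarrow> real \<Rightarrow> 's option" where
  "xi \<omega> t = (if \<exists>n. tn \<omega> n \<le> ennreal t \<and> ennreal t < tn \<omega> (Suc n)
             then snd (\<omega> (SOME n. tn \<omega> n \<le> ennreal t \<and> ennreal t < tn \<omega> (Suc n))) else None)"

definition pact :: "(nat \<Rightarrow> 's traj \<Rightarrow> real \<Rightarrow> 'a measure) \<Rightarrow> 's traj \<Rightarrow> real \<Rightarrow> 'a set \<Rightarrow> ennreal" where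
  "pact pol \<omega> t \<Gamma> = (\<Sum>n. (if tn \<omega> n < ennreal t \<and> ennreal t \<le> tn \<omega> (Suc n)
        then emeasure (pol (Suc n) \<omega> (t - enn2real (tn \<omega> n))) \<Gamma> else 0))"

definition crate :: "('s \<Rightarrow> 'a \<Rightarrow> real) \<Rightarrow> (nat \<Rightarrow> 's traj \<Rightarrow> real \<Rightarrow> 'a measure) \<Rightarrow> 's traj \<Rightarrow> real \<Rightarrow> ennreal" where
  "crate f pol \<omega> t = (\<Sum>n. (if tn \<omega> n < ennreal t \<and> ennreal t \<le> tn \<omega> (Suc n)
        then (\<integral>\<^sup>+ a. ennreal (case xi \<omega> t of None \<Rightarrow> 0 | Some x \<Rightarrow> f x a)
                  \<partial>(pol (Suc n) \<omega> (t - enn2real (tn \<omega> n)))) else 0))"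

definition exp_cost ::
  "'s::polish_space set \<Rightarrow> ('s \<Rightarrow> 'a \<Rightarrow> 's set \<Rightarrow> real) \<Rightarrow> 's measure \<Rightarrow> (nat \<Rightarrow> 's traj \<Rightarrow> real \<Rightarrow> 'a measure)
    \<Rightarrow> ('s \<Rightarrow> 'a \<Rightarrow> real) \<Rightarrow> ennreal" where
  "exp_cost S q \<gamma> pol f =
     (\<integral>\<^sup>+ \<omega>. (\<integral>\<^sup>+ t. indicator {0..} t * crate f pol \<omega> t \<partial>lborel) \<partial>(law S q \<gamma> pol))"

definition occ ::
  "'s::polish_space set \<Rightarrow> ('s \<Rightarrow> 'a \<Rightarrow> 's set \<Rightarrow> real) \<Rightarrow> 's measure \<Rightarrow> (nat \<Rightarrow> 's traj \<Rightarrow> real \<Rightarrow> 'a measure)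
    \<Rightarrow> 's set \<Rightarrow> 'a set \<Rightarrow> ennreal" where
  "occ S q \<gamma> pol \<Gamma>S \<Gamma>A =
     (\<integral>\<^sup>+ \<omega>. (\<integral>\<^sup>+ t. indicator {0..} t * indicator (Some ` \<Gamma>S) (xi \<omega> t) * pact pol \<omega> t \<Gamma>A \<partial>lborel)
        \<partial>(law S q \<gamma> pol))"

definition feasible_finite ::
  "'s::polish_space set \<Rightarrow> 'a::polish_space set \<Rightarrow> ('s \<Rightarrow> 'a \<Rightarrow> 's set \<Rightarrow> real) \<Rightarrow> 's measure
    \<Rightarrow> (nat \<Rightarrow> 's \<Rightarrow> 'a \<Rightarrow> real) \<Rightarrow> nat \<Rightarrow> (nat \<Rightarrow> real) \<Rightarrow> (nat \<Rightarrow> 's traj \<Rightarrow> real \<Rightarrow> 'a measure) \<Rightarrow> bool" where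
  "feasible_finite S A q \<gamma> c N d pol \<longleftrightarrow> is_policy S A pol \<and>
     (\<forall>j\<in>{1..N}. exp_cost S q \<gamma> pol (c j) \<le> ennreal (d j)) \<and>
     exp_cost S q \<gamma> pol (c 0) < \<top>"

definition zeta ::
  "'s::polish_space set \<Rightarrow> 'a::polish_space set \<Rightarrow> ('s \<Rightarrow> 'a \<Rightarrow> 's set \<Rightarrow> real) \<Rightarrow> (nat \<Rightarrow> 's \<Rightarrow> 'a \<Rightarrow> real) \<Rightarrow> nat \<Rightarrow> 's set" where
  "zeta S A q c N = {x\<in>S. (\<Sqinter>pol\<in>{pol. is_DM S A pol}.
       exp_cost S q (return (restrict_space borel S) x) pol (\<lambda>y a. \<Sum>i\<le>N. c i y a)) > 0}"

definition condition1 ::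
  "'s::polish_space set \<Rightarrow> 'a::polish_space set \<Rightarrow> ('s \<Rightarrow> 'a \<Rightarrow> 's set \<Rightarrow> real) \<Rightarrow> (nat \<Rightarrow> 's \<Rightarrow> 'a \<Rightarrow> real) \<Rightarrow> nat \<Rightarrow> bool" where
  "condition1 S A q c N \<longleftrightarrow>
     compact A \<and>
     (\<forall>f::'s \<Rightarrow> real. continuous_on S f \<and> bounded (f ` S) \<longrightarrow>
        continuous_on (S \<times> A) (\<lambda>(x, a). (\<integral>y. f y \<partial>(qtM S q x a)) / qx q x a)) \<and>
     continuous_on (S \<times> A) (\<lambda>(x, a). qx q x a) \<and>
     (\<forall>i\<le>N. \<forall>y::real. openin (top_of_set (S \<times> A)) {p\<in>S \<times> A. y < (\<lambda>(x, a). c i x a) p})"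

end

theory Submission
  imports Defs
begin

text \<open>
  Write c for the sum of the costs and set V 0 = 0 and
  V (k+1) x = min 1 (inf over a of (c(x,a) + integral of V k against q~(.|x,a)) / (1 + q_x(a))).
  Compactness of A and the Feller condition make every V k lower semicontinuous; let Vinf be their
  increasing limit. The iterates satisfy V (k+1) x * (1 + q_x(a)) <= c(x,a) + q~(V k | x,a).
  Averaged over one sojourn, this says that the expected time spent in x_n weighted with V (k+1),
  plus the expectation of V (k+1) at x_n, is at most the expected cost of the sojourn plus the
  expectation of V k at x_(n+1).
  Summing over sojourns gives three things: every policy started in x costs at least V k x; the
  integral of Vinf against the occupation measure telescopes to at most the total cost plus one;
  and if Vinf x = 0, a measurable selector of actions that attain zero in the Bellman equation is a
  stationary policy of cost zero. Hence zeta = {Vinf > 0}, and the sets {Vinf > 1/(m+1)} exhaust zeta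
  and have finite occupation measure.

  The law of the process is specified by a definite description, so its existence (Ionescu-Tulcea)
  and uniqueness have to be established as well.
\<close>

section \<open>Measurability on the state space with cemetery\<close>

text \<open>The undiscounted value may be infinite, and its Bellman equation does not control
  occupation times. Only its positivity matters for \<open>zeta\<close>, so it is replaced by
  iterates of the problem discounted at rate 1, cut off at 1; the 1 in 1 + q_x(a) is the discount
  rate. Discounting has three effects. It supplies the isolated V in V + q_x(a) V - q~(V) <= c, and
  summing this V is what bounds the occupation measure. It keeps the denominator away from 0 at
  absorbing states. It leaves the set of states with positive value unchanged. The cut-off keeps the
  iterates in [0,1], where a Feller condition for bounded functions applies, and it bounds the
  boundary term of the telescoping sum by 1 whether or not the process explodes. The obstacles sit
  in the single sojourns: policies are only measurable in time, rates need not be bounded over S,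
  and a sojourn may be infinite with positive probability. Hence every expectation is computed
  sojourn by sojourn, with a rate bound that depends on the current state; no generator or Dynkin
  formula enters.\<close>

lemma space_optM [simp]: "space optM = UNIV"
  by (simp add: optM_def space_measure_of_conv)

text \<open>Since \<open>{None}\<close> is a generator, membership of the cemetery never matters: a
  set splits into the image of its trace on the proper states and possibly
  \<open>{None}\<close>.\<close>

lemma sets_optM: "sets (optM :: 's::topological_space option measure) = {B. Some -` B \<in> sets borel}"
proof
  have "sigma_algebra UNIV {B :: 's option set. Some -` B \<in> sets borel}"
  proof (rule sigma_algebra_iff2[THEN iffD2], intro conjI ballI allI impI)
    show "{B :: 's option set. Some -` B \<in> sets borel} \<subseteq> Pow UNIV" by simp
    show "{} \<in> {B :: 's option set. Some -` B \<in> sets borel}" by simp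
  next
    fix B :: "'s option set" assume "B \<in> {B. Some -` B \<in> sets borel}"
    then have "- (Some -` B) \<in> sets borel" by simp
    moreover have "Some -` (UNIV - B) = - (Some -` B)" by auto
    ultimately show "UNIV - B \<in> {B. Some -` B \<in> sets borel}" by simp
  next
    fix B :: "nat \<Rightarrow> 's option set" assume "range B \<subseteq> {B. Some -` B \<in> sets borel}"
    then have "(\<Union>i. Some -` B i) \<in> sets borel" by auto
    then show "\<Union> (range B) \<in> {B. Some -` B \<in> sets borel}" by (simp add: vimage_Union)
  qed
  moreover have "insert {None} ((\<lambda>B. Some ` B) ` sets borel) \<subseteq> {B :: 's option set. Some -` B \<in> sets borel}"
    by (auto simp: inj_vimage_image_eq) (simp add: vimage_def)
  ultimately show "sets optM \<subseteq> {B :: 's option set. Some -` B \<in> sets borel}"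
    unfolding optM_def by (simp add: sigma_algebra.sigma_sets_subset)
next
  show "{B :: 's option set. Some -` B \<in> sets borel} \<subseteq> sets optM"
  proof
    fix B :: "'s option set" assume "B \<in> {B. Some -` B \<in> sets borel}"
    then have B: "Some -` B \<in> sets borel" by simp
    have [measurable]: "{None} \<in> sets (optM :: 's option measure)" "Some ` (Some -` B) \<in> sets optM"
      using B by (simp_all add: optM_def del: image_vimage_eq)
    have "B = Some ` (Some -` B) \<union> (if None \<in> B then {None} else {})"
      by (auto simp: image_iff) (metis not_Some_eq)
    also have "\<dots> \<in> sets optM" by (intro sets.Un) (simp_all del: image_vimage_eq)
    finally show "B \<in> sets optM" .
  qed
qed

lemma measurable_Some [measurable]: "Some \<in> measurable borel optM"
  by (rule measurableI) (auto simp: sets_optM)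

lemma measurable_optM_iff:
  "f \<in> measurable optM M \<longleftrightarrow> f None \<in> space M \<and> (\<lambda>x. f (Some x)) \<in> measurable borel M"
proof safe
  assume f: "f \<in> measurable optM M"
  show "f None \<in> space M" using measurable_space[OF f] by simp
  show "(\<lambda>x. f (Some x)) \<in> measurable borel M"
    using measurable_compose[OF measurable_Some f] .
next
  assume None: "f None \<in> space M" and f: "(\<lambda>x. f (Some x)) \<in> measurable borel M"
  show "f \<in> measurable optM M"
  proof (rule measurableI)
    fix x assume "x \<in> space (optM :: 'a option measure)"
    then show "f x \<in> space M" using None measurable_space[OF f] by (cases x) auto
  next
    fix B assume "B \<in> sets M"
    from measurable_sets[OF f this] show "f -` B \<inter> space optM \<in> sets optM"
      by (simp add: sets_optM vimage_def)
  qed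
qed

lemma sets_optM_Some_image [measurable]: "B \<in> sets borel \<Longrightarrow> Some ` B \<in> sets optM"
  by (simp add: sets_optM inj_vimage_image_eq)

lemma sets_optM_None [measurable]: "{None} \<in> sets optM"
  by (simp add: sets_optM vimage_def)

lemma measurable_the [measurable]: "the \<in> measurable optM borel"
  by (simp add: measurable_optM_iff)

lemma space_stepM [simp]: "space stepM = UNIV"
  by (simp add: stepM_def space_pair_measure)

lemma space_trajM [simp]: "space trajM = UNIV"
  by (simp add: trajM_def space_PiM)

lemma space_histM: "space (histM n) = extensional {..n}"
  by (simp add: histM_def space_PiM PiE_def)

lemma restrict_in_space_histM [simp]: "restrict \<omega> {..n} \<in> space (histM n)"
  by (simp add: space_histM)

lemma measurable_fst_stepM [measurable]: "fst \<in> measurable stepM borel"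
  by (simp add: stepM_def)

lemma measurable_snd_stepM [measurable]: "snd \<in> measurable stepM optM"
  by (simp add: stepM_def)

lemma measurable_component_trajM [measurable]: "(\<lambda>\<omega>. \<omega> n) \<in> measurable trajM stepM"
  unfolding trajM_def by (rule measurable_component_singleton) simp

lemma measurable_component_histM: "k \<le> n \<Longrightarrow> (\<lambda>\<omega>. \<omega> k) \<in> measurable (histM n) stepM"
  unfolding histM_def by (rule measurable_component_singleton) simp

lemma measurable_restrict_trajM [measurable]: "(\<lambda>\<omega>. restrict \<omega> {..n}) \<in> measurable trajM (histM n)"
  unfolding trajM_def histM_def by (rule measurable_restrict_subset) simp

text \<open>Policies are measurable on whole trajectories but read only a finite history. Padding
  with an arbitrary pair turns measurability on \<open>trajM\<close> into measurability on
  \<open>histM n\<close>.\<close>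

definition extend_hist :: "nat \<Rightarrow> 's traj \<Rightarrow> 's traj" where
  "extend_hist n h = (\<lambda>k. if k \<le> n then h k else (0, None))"

lemma measurable_extend_hist [measurable]: "extend_hist n \<in> measurable (histM n) trajM"
  unfolding trajM_def extend_hist_def
proof (rule measurable_PiM_single')
  fix i :: nat
  show "(\<lambda>h. if i \<le> n then h i else (0, None)) \<in> measurable (histM n) stepM"
    by (cases "i \<le> n") (auto intro: measurable_component_histM)
qed simp

section \<open>Survival function of a bounded hazard rate\<close>

text \<open>
  Hazard rates are only measurable in time, so the cumulative hazard need not be differentiable and the
  chain rule is not available for exp (- H); that exp (- H) and the integral of r exp (- H) add up to a
  constant is read off from the size of the increments instead.
\<close>

lemma constant_if_quadratic_increments:
  fixes \<phi> :: "real \<Rightarrow> real"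
  assumes "\<And>s t. s \<le> t \<Longrightarrow> \<bar>\<phi> t - \<phi> s\<bar> \<le> C * (t - s)\<^sup>2"
  shows "\<phi> s = \<phi> t"
proof -
  have sym: "\<bar>\<phi> t - \<phi> s\<bar> \<le> C * (t - s)\<^sup>2" for s t
    using assms[of s t] assms[of t s] by (cases "s \<le> t") (auto simp: power2_commute abs_minus_commute)
  have "(\<phi> has_real_derivative 0) (at x)" for x
  proof -
    have "(\<lambda>h. (\<phi> (x + h) - \<phi> x) / h) \<midarrow>0\<rightarrow> 0"
    proof (rule Lim_null_comparison)
      show "\<forall>\<^sub>F h in at 0. norm ((\<phi> (x + h) - \<phi> x) / h) \<le> C * \<bar>h\<bar>"
      proof (rule eventuallyI)
        fix h :: real
        show "norm ((\<phi> (x + h) - \<phi> x) / h) \<le> C * \<bar>h\<bar>"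
        proof (cases "h = 0")
          case False
          have "\<bar>\<phi> (x + h) - \<phi> x\<bar> \<le> (C * \<bar>h\<bar>) * \<bar>h\<bar>"
            using sym[of "x + h" x] by (simp add: power2_eq_square mult.assoc)
          with False show ?thesis by (simp add: abs_divide pos_divide_le_eq)
        qed simp
      qed
      show "(\<lambda>h. C * \<bar>h\<bar>) \<midarrow>0\<rightarrow> 0" by (auto intro!: tendsto_eq_intros)
    qed
    then show ?thesis by (simp add: DERIV_def)
  qed
  then show ?thesis using DERIV_isconst_all[of \<phi>] by blast
qed

definition cum_hazard :: "(real \<Rightarrow> ennreal) \<Rightarrow> real \<Rightarrow> ennreal" where
  "cum_hazard r t = (\<integral>\<^sup>+s. indicator {0<..t} s * r s \<partial>lborel)"

definition survival :: "(real \<Rightarrow> ennreal) \<Rightarrow> real \<Rightarrow> ennreal" where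
  "survival r t = ennreal (exp (- enn2real (cum_hazard r t)))"

text \<open>The atom of the sojourn law at infinity. It is taken as the mass missing from the
  density part, so total mass 1 follows once that part is known to be at most 1.\<close>

definition never :: "(real \<Rightarrow> ennreal) \<Rightarrow> ennreal" where
  "never r = 1 - (\<integral>\<^sup>+s. indicator {0<..} s * (survival r s * r s) \<partial>lborel)"

locale hazard_rate =
  fixes r :: "real \<Rightarrow> ennreal" and Q :: real
  assumes r_measurable [measurable]: "r \<in> borel_measurable borel"
    and r_le: "0 < s \<Longrightarrow> r s \<le> ennreal Q" and Q_nonneg: "0 \<le> Q"
begin

abbreviation "H \<equiv> cum_hazard r"
abbreviation "surv \<equiv> survival r"
abbreviation "atom \<equiv> never r"

text \<open>The criterion for constancy asks for increments on the whole real line; the factor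
  \<open>indicator {0<..}\<close> makes additivity hold for negative \<open>s\<close> as
  well.\<close>

lemma H_add:
  assumes "s \<le> t"
  shows "H t = H s + (\<integral>\<^sup>+u. indicator {s<..t} u * (indicator {0<..} u * r u) \<partial>lborel)"
  unfolding cum_hazard_def using assms
  by (subst nn_integral_add[symmetric]) (auto intro!: nn_integral_cong split: split_indicator)

lemma increment_le:
  assumes "s \<le> t" and f: "\<And>u. u > 0 \<Longrightarrow> s < u \<Longrightarrow> u \<le> t \<Longrightarrow> f u \<le> ennreal B" and "0 \<le> B"
  shows "(\<integral>\<^sup>+u. indicator {s<..t} u * (indicator {0<..} u * f u) \<partial>lborel) \<le> ennreal (B * (t - s))"
proof -
  have "(\<integral>\<^sup>+u. indicator {s<..t} u * (indicator {0<..} u * f u) \<partial>lborel) \<le> (\<integral>\<^sup>+u. ennreal B * indicator {s<..t} u \<partial>lborel)"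
    using f by (intro nn_integral_mono) (auto split: split_indicator)
  also have "\<dots> = ennreal (B * (t - s))"
    using assms by (simp add: nn_integral_cmult_indicator ennreal_mult)
  finally show ?thesis .
qed

lemma H_nonpos: "t \<le> 0 \<Longrightarrow> H t = 0"
  unfolding cum_hazard_def by (auto simp: indicator_def)

lemma H_finite: "H t < \<top>"
proof (cases "0 \<le> t")
  case True
  have "H t \<le> ennreal (Q * (t - 0))"
    using increment_le[of 0 t r Q] H_add[OF True] r_le Q_nonneg True by (simp add: H_nonpos)
  then show ?thesis by (meson ennreal_less_top le_less_trans)
qed (simp add: H_nonpos)

lemma H_mono: "s \<le> t \<Longrightarrow> H s \<le> H t"
  using H_add[of s t] by simp

lemma H_measurable [measurable]: "H \<in> borel_measurable borel"
proof -
  have "(\<lambda>t. enn2real (H t)) \<in> borel_measurable borel"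
    using H_mono H_finite by (intro borel_measurable_mono) (simp add: mono_def enn2real_mono)
  then have "(\<lambda>t. ennreal (enn2real (H t))) \<in> borel_measurable borel" by measurable
  then show ?thesis using H_finite by simp
qed

lemma surv_measurable [measurable]: "surv \<in> borel_measurable borel"
  unfolding survival_def by measurable

lemma surv_antimono: "s \<le> t \<Longrightarrow> surv t \<le> surv s"
  unfolding survival_def using H_mono[of s t] H_finite[of t]
  by (intro ennreal_leI) (simp add: enn2real_mono)

lemma surv_le_1: "surv t \<le> 1"
  unfolding survival_def by (simp add: ennreal_le_1)

definition G :: "real \<Rightarrow> ennreal" where
  "G t = (\<integral>\<^sup>+s. indicator {0<..t} s * (surv s * r s) \<partial>lborel)"

lemma G_le_H: "G t \<le> H t"
  unfolding G_def cum_hazard_def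
proof (intro nn_integral_mono mult_left_mono)
  show "surv s * r s \<le> r s" for s using mult_right_mono[OF surv_le_1, of "r s" s] by simp
qed simp

lemma G_add:
  assumes "s \<le> t"
  shows "G t = G s + (\<integral>\<^sup>+u. indicator {s<..t} u * (indicator {0<..} u * (surv u * r u)) \<partial>lborel)"
  unfolding G_def using assms
  by (subst nn_integral_add[symmetric]) (auto intro!: nn_integral_cong split: split_indicator)

text \<open>Over an interval from s to t, the growth of \<open>G\<close> and the loss of exp (- H)
  are both squeezed between the survival values at t and at s times the increment of
  \<open>H\<close>. Their difference is therefore of second order in t - s, so the sum is constant,
  and its value at 0 is 1.\<close>

lemma G_eq: "G t = 1 - surv t"
proof -
  define h where "h t = enn2real (H t)" for t
  define g where "g t = enn2real (G t)" for t
  have G_fin: "G t < \<top>" for t using G_le_H[of t] H_finite[of t] by (rule le_less_trans)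
  have H_h: "H t = ennreal (h t)" and G_g: "G t = ennreal (g t)" for t
    using H_finite[of t] G_fin[of t] by (simp_all add: h_def g_def)
  have h_nonneg: "0 \<le> h t" and g_nonneg: "0 \<le> g t" for t by (simp_all add: h_def g_def)
  have S: "surv t = ennreal (exp (- h t))" for t by (simp add: survival_def h_def)
  have "exp (- h s) + g s = exp (- h t) + g t" for s t
  proof (rule constant_if_quadratic_increments[where C = "Q\<^sup>2" and \<phi> = "\<lambda>t. exp (- h t) + g t"])
    fix s t :: real assume st: "s \<le> t"
    define dH where "dH = (\<integral>\<^sup>+u. indicator {s<..t} u * (indicator {0<..} u * r u) \<partial>lborel)"
    define dG where "dG = (\<integral>\<^sup>+u. indicator {s<..t} u * (indicator {0<..} u * (surv u * r u)) \<partial>lborel)"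
    have dH_le: "dH \<le> ennreal (Q * (t - s))"
      unfolding dH_def using increment_le[OF st, of r Q] r_le Q_nonneg by blast
    then obtain x where x: "dH = ennreal x" "0 \<le> x" "x \<le> Q * (t - s)"
      using st Q_nonneg by (cases dH) (auto simp: top_unique)
    have lo: "surv t * dH \<le> dG" unfolding dH_def dG_def
      by (subst nn_integral_cmult[symmetric])
         (auto intro!: nn_integral_mono mult_right_mono surv_antimono split: split_indicator)
    have hi: "dG \<le> surv s * dH" unfolding dH_def dG_def
      by (subst nn_integral_cmult[symmetric])
         (auto intro!: nn_integral_mono mult_right_mono surv_antimono split: split_indicator)
    have "surv s * dH < \<top>" using x by (simp add: S ennreal_mult_less_top)
    with hi obtain y where y: "dG = ennreal y" "0 \<le> y"
      by (cases dG) (auto simp: top_unique)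
    have h: "h t = h s + x" using H_add[OF st] x h_nonneg by (simp add: dH_def[symmetric] H_h flip: ennreal_plus)
    have g: "g t = g s + y" using G_add[OF st] y g_nonneg by (simp add: dG_def[symmetric] G_g flip: ennreal_plus)
    have y_lo: "exp (- h t) * x \<le> y" and y_hi: "y \<le> exp (- h s) * x"
      using lo hi x y by (simp_all add: S flip: ennreal_mult)
    have e: "exp (- h t) = exp (- h s) * exp (- x)" by (simp add: h flip: exp_add)
    have ex: "1 - exp (- x) \<le> x" using exp_ge_add_one_self[of "- x"] by simp
    have ex2: "exp (- x) * x \<le> 1 - exp (- x)"
      using exp_ge_add_one_self[of x] by (simp add: exp_minus field_simps)
    have es: "0 < exp (- h s)" "exp (- h s) \<le> 1" using h_nonneg by auto
    \<comment> \<open>The length of the interval from \<open>exp (- h t) * x\<close> to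
      \<open>exp (- h s) * x\<close>, which contains both the increment \<open>y\<close> of
      \<open>g\<close> and the decrease of exp (- h).\<close>
    define \<delta> where "\<delta> = exp (- h s) * (1 - exp (- x)) * x"
    have "exp (- h s) * (exp (- x) * x) \<le> exp (- h s) * (1 - exp (- x))" "exp (- h s) * (1 - exp (- x)) \<le> exp (- h s) * x"
      using ex ex2 es by (simp_all add: mult_left_mono)
    then have "\<bar>exp (- h t) + g t - (exp (- h s) + g s)\<bar> \<le> \<delta>"
      using y_lo y_hi unfolding g e \<delta>_def by (simp add: abs_le_iff algebra_simps)
    also have "\<delta> \<le> 1 * x * x" unfolding \<delta>_def using ex es x(2)
      by (intro mult_mono) auto
    also have "\<dots> \<le> (Q * (t - s)) * (Q * (t - s))" using x by (simp add: mult_mono)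
    finally show "\<bar>exp (- h t) + g t - (exp (- h s) + g s)\<bar> \<le> Q\<^sup>2 * (t - s)\<^sup>2"
      by (simp add: power2_eq_square algebra_simps)
  qed
  from this[of 0 t] have "g t = 1 - exp (- h t)" by (simp add: h_def g_def H_nonpos G_def indicator_def)
  then show ?thesis using h_nonneg by (simp add: G_g S ennreal_minus flip: ennreal_1)
qed

lemma density_integral: "(\<integral>\<^sup>+s. indicator {0<..} s * (surv s * r s) \<partial>lborel) = (SUP n::nat. G (real n))"
proof -
  have "(\<integral>\<^sup>+s. indicator {0<..} s * (surv s * r s) \<partial>lborel) =
     (\<integral>\<^sup>+s. (SUP n::nat. indicator {0<..real n} s * (surv s * r s)) \<partial>lborel)"
  proof (rule nn_integral_cong)
    fix s :: real
    obtain n :: nat where n: "s \<le> real n" using real_arch_simple by blast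
    show "indicator {0<..} s * (surv s * r s) = (SUP n::nat. indicator {0<..real n} s * (surv s * r s))"
      by (rule antisym, rule SUP_upper2[of n]) (use n in \<open>auto intro!: SUP_least split: split_indicator\<close>)
  qed
  also have "\<dots> = (SUP n::nat. G (real n))" unfolding G_def
    by (rule nn_integral_monotone_convergence_SUP) (auto simp: incseq_def le_fun_def split: split_indicator)
  finally show ?thesis .
qed

lemma density_integral_le_1: "(\<integral>\<^sup>+s. indicator {0<..} s * (surv s * r s) \<partial>lborel) \<le> 1"
  unfolding density_integral by (auto intro!: SUP_least simp: G_eq)

lemma density_integral_plus_atom: "(\<integral>\<^sup>+s. indicator {0<..} s * (surv s * r s) \<partial>lborel) + atom = 1"
  unfolding never_def using density_integral_le_1 by (simp add: add_diff_inverse_ennreal)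

text \<open>Total mass 1 is split at t; the part of the density up to t is
  \<open>G t = 1 - surv t\<close>, which is finite and cancels.\<close>

lemma tail_plus_atom: "(\<integral>\<^sup>+s. indicator {0<..} s * (surv s * (r s * indicator {t<..} s)) \<partial>lborel) + atom = surv t" (is "?T + _ = _")
proof -
  have "G t + ?T = (\<integral>\<^sup>+s. indicator {0<..} s * (surv s * r s) \<partial>lborel)" unfolding G_def
    by (subst nn_integral_add[symmetric]) (auto intro!: nn_integral_cong split: split_indicator)
  then have "G t + (?T + atom) = 1" using density_integral_plus_atom by (simp add: add.assoc[symmetric])
  moreover have "G t + surv t = 1" using surv_le_1[of t] by (simp add: G_eq diff_add_cancel_ennreal)
  moreover have "G t \<noteq> \<top>" by (simp add: G_eq)
  ultimately show ?thesis using ennreal_add_left_cancel[of "G t" "?T + atom" "surv t"] by simp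
qed

lemma atom_le_surv: "atom \<le> surv t"
  by (subst tail_plus_atom[of t, symmetric]) simp

text \<open>The survival function never falls below the atom, so a positive atom makes its integral
  over the half-line infinite.\<close>

lemma atom_zero_or_sojourn_infinite: "atom = 0 \<or> (\<integral>\<^sup>+s. indicator {0<..} s * surv s \<partial>lborel) = \<top>"
proof (rule disjCI)
  assume "(\<integral>\<^sup>+s. indicator {0<..} s * surv s \<partial>lborel) \<noteq> \<top>"
  moreover have "atom * emeasure lborel {0::real<..} \<le> (\<integral>\<^sup>+s. indicator {0<..} s * surv s \<partial>lborel)"
    by (subst nn_integral_cmult_indicator[symmetric])
       (auto intro!: nn_integral_mono simp: atom_le_surv split: split_indicator)
  moreover have "emeasure lborel {0::real<..} = \<top>"
  proof -
    have "ennreal (real n) \<le> emeasure lborel {0::real<..}" for n :: nat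
      using emeasure_mono[of "{0<..real n}" "{0<..}" lborel] by (simp add: Ioc_subset_iff subset_eq)
    then have "(SUP n::nat. of_nat n) \<le> emeasure lborel {0::real<..}"
      by (auto intro!: SUP_least simp: ennreal_of_nat_eq_real_of_nat)
    then show ?thesis by (simp add: ennreal_SUP_of_nat_eq_top top_unique)
  qed
  ultimately show "atom = 0" by (auto simp: ennreal_mult_top top_unique split: if_splits)
qed

end

section \<open>Lower semicontinuity and measurable selection\<close>

text \<open>Openness is relative to X, in the form used for the costs in \<open>condition1\<close>;
  the values of u outside X are unconstrained.\<close>

definition lsc_on :: "'b::topological_space set \<Rightarrow> ('b \<Rightarrow> real) \<Rightarrow> bool" where
  "lsc_on X u \<longleftrightarrow> (\<forall>y. openin (top_of_set X) {p\<in>X. y < u p})"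

lemma lsc_on_cong: "(\<And>x. x \<in> X \<Longrightarrow> u x = v x) \<Longrightarrow> lsc_on X u \<longleftrightarrow> lsc_on X v"
  by (simp add: lsc_on_def cong: conj_cong)

lemma lsc_on_continuous: "continuous_on X u \<Longrightarrow> lsc_on X u"
  unfolding lsc_on_def
proof
  fix y assume "continuous_on X u"
  then have "openin (top_of_set X) (X \<inter> u -` {y<..})" by (rule continuous_openin_preimage_gen) simp
  also have "X \<inter> u -` {y<..} = {p\<in>X. y < u p}" by auto
  finally show "openin (top_of_set X) {p\<in>X. y < u p}" .
qed

lemma lsc_on_add:
  assumes "lsc_on X u" "lsc_on X v"
  shows "lsc_on X (\<lambda>x. u x + v x)"
  unfolding lsc_on_def
proof
  fix y
  have "{p\<in>X. y < u p + v p} = (\<Union>r. {p\<in>X. r < u p} \<inter> {p\<in>X. y - r < v p})"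
  proof safe
    fix p assume p: "p \<in> X" "y < u p + v p"
    then obtain r where "y - v p < r" "r < u p" by (metis add.commute dense less_diff_eq diff_less_eq)
    with p show "p \<in> (\<Union>r. {p\<in>X. r < u p} \<inter> {p\<in>X. y - r < v p})" by force
  qed auto
  also have "openin (top_of_set X) \<dots>" using assms by (auto simp: lsc_on_def)
  finally show "openin (top_of_set X) {p\<in>X. y < u p + v p}" .
qed

lemma lsc_on_sum: "(\<And>i. i \<in> I \<Longrightarrow> lsc_on X (u i)) \<Longrightarrow> lsc_on X (\<lambda>x. \<Sum>i\<in>I. u i x)"
  by (induction I rule: infinite_finite_induct) (auto intro: lsc_on_continuous lsc_on_add)

text \<open>Clearing the positive denominator turns y < u / v into 0 < u - y v, where u is lower
  semicontinuous and - y v is continuous.\<close>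

lemma lsc_on_divide:
  assumes "lsc_on X u" "continuous_on X v" "\<And>x. x \<in> X \<Longrightarrow> 0 < v x"
  shows "lsc_on X (\<lambda>x. u x / v x)"
  unfolding lsc_on_def
proof
  fix y
  have "lsc_on X (\<lambda>x. u x + (- y * v x))"
    using assms(1,2) by (intro lsc_on_add lsc_on_continuous[of X "\<lambda>x. - y * v x"] continuous_intros)
  then have "openin (top_of_set X) {p\<in>X. 0 < u p + (- y * v p)}" unfolding lsc_on_def by (rule spec)
  also have "{p\<in>X. 0 < u p + (- y * v p)} = {p\<in>X. y < u p / v p}"
    using assms(3) by (auto simp: field_simps)
  finally show "openin (top_of_set X) {p\<in>X. y < u p / v p}" .
qed

lemma lsc_on_SUP:
  assumes "\<And>i. i \<in> I \<Longrightarrow> lsc_on X (u i)" "I \<noteq> {}" "\<And>x. x \<in> X \<Longrightarrow> bdd_above ((\<lambda>i. u i x) ` I)"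
  shows "lsc_on X (\<lambda>x. SUP i\<in>I. u i x)"
  unfolding lsc_on_def
proof
  fix y
  have "{p\<in>X. y < (SUP i\<in>I. u i p)} = (\<Union>i\<in>I. {p\<in>X. y < u i p})"
    using less_cSUP_iff[OF assms(2,3)] by auto
  also have "openin (top_of_set X) \<dots>" using assms(1) by (auto simp: lsc_on_def)
  finally show "openin (top_of_set X) {p\<in>X. y < (SUP i\<in>I. u i p)}" .
qed

lemma lsc_on_min_const: "lsc_on X u \<Longrightarrow> lsc_on X (\<lambda>x. min b (u x))"
  unfolding lsc_on_def
proof
  fix y assume *: "\<forall>y. openin (top_of_set X) {p\<in>X. y < u p}"
  show "openin (top_of_set X) {p\<in>X. y < min b (u p)}"
    using * by (cases "y < b") auto
qed

text \<open>Projection along a compact factor is a closed map, applied here to the relatively closed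
  sublevel set of u. A compact subset K is allowed because the selection argument cuts A into small
  compact pieces.\<close>

lemma closedin_projection_compact:
  fixes S :: "'s::topological_space set" and K :: "'a::topological_space set"
  assumes u: "lsc_on (S \<times> A) u" and K: "compact K" "K \<subseteq> A"
  shows "closedin (top_of_set S) {x\<in>S. \<exists>a\<in>K. u (x, a) \<le> y}"
proof -
  let ?C = "{p\<in>S \<times> K. u p \<le> y}"
  have "openin (top_of_set (S \<times> A)) {p\<in>S \<times> A. y < u p}" using u by (simp add: lsc_on_def)
  then obtain T where T: "open T" "{p\<in>S \<times> A. y < u p} = S \<times> A \<inter> T" by (auto simp: openin_open)
  have "closedin (top_of_set (S \<times> K)) (S \<times> K \<inter> - T)" using T(1) by (intro closedin_closed_Int) (rule closed_Compl)
  also have "S \<times> K \<inter> - T = ?C" using K(2) T(2) by (auto simp: set_eq_iff not_le) (meson linorder_not_le subsetD)+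
  finally have C: "closedin (prod_topology (top_of_set S) (top_of_set K)) ?C" by simp
  have "compact_space (top_of_set K)" using K(1) by (simp add: compact_space_subtopology)
  from Abstract_Topological_Spaces.closed_map_fst[OF this, of "top_of_set S"] C
  have "closedin (top_of_set S) (fst ` ?C)" by (simp add: closed_map_def)
  also have "fst ` ?C = {x\<in>S. \<exists>a\<in>K. u (x, a) \<le> y}" by force
  finally show ?thesis .
qed

text \<open>The infimum exceeds y exactly if, for some z > y, no action has value at most z. For
  each such z the excluded states form a projected sublevel set, which is relatively closed.\<close>

lemma lsc_on_INF_compact:
  fixes S :: "'s::topological_space set" and A :: "'a::topological_space set"
  assumes u: "lsc_on (S \<times> A) u" and A: "compact A" "A \<noteq> {}" and nonneg: "\<And>x a. x \<in> S \<Longrightarrow> a \<in> A \<Longrightarrow> 0 \<le> u (x, a)"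
  shows "lsc_on S (\<lambda>x. INF a\<in>A. u (x, a))"
  unfolding lsc_on_def
proof
  fix y
  have bdd: "bdd_below ((\<lambda>a. u (x, a)) ` A)" if "x \<in> S" for x using nonneg[OF that] by (auto intro: bdd_belowI[of _ 0])
  have "{x\<in>S. y < (INF a\<in>A. u (x, a))} = (\<Union>z\<in>{y<..}. S - {x\<in>S. \<exists>a\<in>A. u (x, a) \<le> z})"
  proof (intro set_eqI iffI)
    fix x assume "x \<in> {x\<in>S. y < (INF a\<in>A. u (x, a))}"
    then have x: "x \<in> S" "y < (INF a\<in>A. u (x, a))" by auto
    then obtain z where z: "y < z" "z < (INF a\<in>A. u (x, a))" using dense by blast
    then have "z < u (x, a)" if "a \<in> A" for a using cINF_lower[OF bdd[OF x(1)] that] by simp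
    with z x show "x \<in> (\<Union>z\<in>{y<..}. S - {x\<in>S. \<exists>a\<in>A. u (x, a) \<le> z})" by force
  next
    fix x assume "x \<in> (\<Union>z\<in>{y<..}. S - {x\<in>S. \<exists>a\<in>A. u (x, a) \<le> z})"
    then obtain z where z: "y < z" "x \<in> S" "\<not> (\<exists>a\<in>A. u (x, a) \<le> z)" by blast
    then have "z \<le> (INF a\<in>A. u (x, a))" using A(2) by (intro cINF_greatest) auto
    with z show "x \<in> {x\<in>S. y < (INF a\<in>A. u (x, a))}" by simp
  qed
  also have "openin (top_of_set S) \<dots>"
    using closedin_projection_compact[OF u A(1) order_refl] by (intro openin_Union) (auto simp: closedin_def)
  finally show "openin (top_of_set S) {x\<in>S. y < (INF a\<in>A. u (x, a))}" .
qed

lemma lsc_on_borel_sets: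
  assumes "lsc_on S u" "S \<in> sets borel"
  shows "{x\<in>S. y < u x} \<in> sets borel"
proof -
  obtain T where "open T" "{x\<in>S. y < u x} = S \<inter> T"
    using assms(1) by (auto simp: lsc_on_def openin_open)
  with assms(2) show ?thesis by auto
qed

lemma lsc_on_borel_measurable:
  assumes "lsc_on S u" "S \<in> sets borel"
  shows "u \<in> borel_measurable (restrict_space borel S)"
  using lsc_on_borel_sets[OF assms] assms(2)
  by (auto intro!: borel_measurableI_greater simp: space_restrict_space sets_restrict_space_iff)

text \<open>The approximants are the Pasch-Hausdorff envelopes of the function.\<close>

lemma lsc_on_approx_continuous:
  fixes S :: "'s::metric_space set" and u :: "'s \<Rightarrow> real"
  assumes u: "lsc_on S u" and bd: "\<And>x. x \<in> S \<Longrightarrow> 0 \<le> u x" "\<And>x. x \<in> S \<Longrightarrow> u x \<le> 1"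
  obtains f :: "nat \<Rightarrow> 's \<Rightarrow> real" where "\<And>n. continuous_on S (f n)"
    "\<And>n x. x \<in> S \<Longrightarrow> 0 \<le> f n x" "\<And>n x. x \<in> S \<Longrightarrow> f n x \<le> u x"
    "\<And>x. x \<in> S \<Longrightarrow> incseq (\<lambda>n. f n x)" "\<And>x. x \<in> S \<Longrightarrow> (\<lambda>n. f n x) \<longlonglongrightarrow> u x"
proof -
  define f where "f n x = (INF z\<in>S. u z + real n * dist x z)" for n :: nat and x
  have nn: "0 \<le> u z + real n * dist x z" if "z \<in> S" for n x z using bd(1)[OF that] by simp
  have bdd: "bdd_below ((\<lambda>z. u z + real n * dist x z) ` S)" for n x using nn by (auto intro: bdd_belowI[of _ 0])
  have low: "f n x \<le> u z + real n * dist x z" if "z \<in> S" for n x z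
    unfolding f_def by (rule cINF_lower[OF bdd that])
  show thesis
  proof (rule that[of f])
    fix n
    show "continuous_on S (f n)"
    proof (cases "S = {}")
      case False
      have lip: "f n x \<le> f n y + real n * dist x y" for x y
      proof -
        have "f n x - real n * dist x y \<le> u z + real n * dist y z" if "z \<in> S" for z
        proof -
          have "dist x z \<le> dist x y + dist y z" by (rule dist_triangle)
          then have "real n * dist x z \<le> real n * dist x y + real n * dist y z"
            by (metis distrib_left mult_left_mono of_nat_0_le_iff)
          then show ?thesis using low[OF that, of n x] by simp
        qed
        then have "f n x - real n * dist x y \<le> f n y" unfolding f_def[of n y] using False by (intro cINF_greatest)
        then show ?thesis by simp
      qed
      have "dist (f n x) (f n y) \<le> real n * dist x y" for x y
        using lip[of x y] lip[of y x] by (auto simp: dist_real_def dist_commute abs_le_iff)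
      then have "n-lipschitz_on S (f n)" by (intro lipschitz_onI) auto
      then show ?thesis by (rule lipschitz_on_continuous_on)
    qed simp
  next
    fix n x assume x: "x \<in> S"
    show "0 \<le> f n x" unfolding f_def using x nn by (intro cINF_greatest) auto
    show "f n x \<le> u x" using low[OF x, of n x] by simp
  next
    fix x assume x: "x \<in> S"
    show inc: "incseq (\<lambda>n. f n x)"
    proof (rule incseq_SucI)
      fix n
      show "f n x \<le> f (Suc n) x" unfolding f_def[of "Suc n"]
      proof (rule cINF_greatest)
        show "S \<noteq> {}" using x by auto
        fix z assume "z \<in> S"
        from low[OF this, of n x] show "f n x \<le> u z + real (Suc n) * dist x z"
          by (simp add: algebra_simps) (smt (verit) zero_le_dist)
      qed
    qed
    show "(\<lambda>n. f n x) \<longlonglongrightarrow> u x"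
    proof (rule order_tendstoI)
      fix a assume "u x < a"
      then show "\<forall>\<^sub>F n in sequentially. f n x < a" using low[OF x, of _ x] by (intro always_eventually) (auto intro: le_less_trans)
    next
      fix a assume "a < u x"
      then obtain b where b: "a < b" "b < u x" using dense by blast
      have "openin (top_of_set S) {p\<in>S. b < u p}" using u by (simp add: lsc_on_def)
      then obtain e where e: "0 < e" "\<And>z. z \<in> S \<Longrightarrow> dist z x < e \<Longrightarrow> b < u z"
        unfolding openin_euclidean_subtopology_iff using x b by auto
      \<comment> \<open>Outside the ball of radius e the penalty is at least m e >= 1, which
        dominates u because u <= 1; inside the ball u itself exceeds b.\<close>
      obtain m :: nat where m: "1 / e < real m" using reals_Archimedean2 by blast
      have "b \<le> f n x" if "m \<le> n" for n unfolding f_def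
      proof (rule cINF_greatest)
        show "S \<noteq> {}" using x by auto
        fix z assume z: "z \<in> S"
        show "b \<le> u z + real n * dist x z"
        proof (cases "dist z x < e")
          case True
          then have "b < u z" by (rule e(2)[OF z])
          then show ?thesis by (smt (verit) mult_nonneg_nonneg of_nat_0_le_iff zero_le_dist)
        next
          case False
          have "1 \<le> real m * e" using m e(1) by (simp add: field_simps)
          also have "\<dots> \<le> real n * e" using that e(1) by (intro mult_right_mono) auto
          also have "real n * e \<le> real n * dist x z" using False by (intro mult_left_mono) (auto simp: dist_commute)
          finally show ?thesis using b(2) bd(2)[OF x] bd(1)[OF z] by simp
        qed
      qed
      then show "\<forall>\<^sub>F n in sequentially. a < f n x" using b(1)
        by (auto simp: eventually_sequentially intro: less_le_trans)
    qed
  qed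
qed

text \<open>Successive approximation by balls around a dense sequence of A. At stage m the least
  index is taken whose closed ball of radius (1/2)^m, cut with the previous balls, still contains an
  action satisfying the bound. Each such test is measurable in x because it is the projection of a
  sublevel set over a compact piece, so the centres depend measurably on x. They converge, and their
  limit is the selector.\<close>

lemma measurable_selection_compact:
  fixes S :: "'s::topological_space set" and A :: "'a::polish_space set"
  assumes u: "lsc_on (S \<times> A) u" and A: "compact A" "A \<noteq> {}"
    and F: "F \<in> sets borel" "F \<subseteq> S" and S: "S \<in> sets borel"
    and ex: "\<And>x. x \<in> F \<Longrightarrow> \<exists>a\<in>A. u (x, a) \<le> y"
  obtains f where "f \<in> borel_measurable borel" "range f \<subseteq> A" "\<And>x. x \<in> F \<Longrightarrow> u (x, f x) \<le> y"
proof -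
  obtain D where D: "countable D" "D \<subseteq> A" "A \<subseteq> closure D" using separable by metis
  have "D \<noteq> {}" using D(3) A(2) by auto
  define d where "d = from_nat_into D"
  have d: "range d = D" unfolding d_def by (rule range_from_nat_into[OF \<open>D \<noteq> {}\<close> D(1)])
  have cover: "\<exists>i. a \<in> cball (d i) e" if a: "a \<in> A" and e: "0 < e" for a e
  proof -
    have "a \<in> closure D" using a D(3) by auto
    then obtain z where z: "z \<in> D" "dist z a < e" using e by (auto simp: closure_approachable)
    then obtain i where "z = d i" using d by blast
    with z show ?thesis by (auto intro!: exI[of _ i])
  qed
  \<comment> \<open>A list of indices encodes balls of radii 1, 1/2, 1/4, and so on;
    \<open>KK\<close> is the compact part of A inside all of them, and \<open>ok\<close> says that
    the bound can still be met there.\<close>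
  define KK where "KK l = A \<inter> (\<Inter>j\<in>{..<length l}. cball (d (l ! j)) ((1/2) ^ j))" for l
  define ok where "ok l x \<longleftrightarrow> (\<exists>a\<in>KK l. u (x, a) \<le> y)" for l x
  define pre where "pre x m = rec_nat [] (\<lambda>_ l. l @ [LEAST i. ok (l @ [i]) x]) m" for x m
  have pre_0: "pre x 0 = []" and pre_Suc: "pre x (Suc m) = pre x m @ [LEAST i. ok (pre x m @ [i]) x]" for x m
    by (simp_all add: pre_def)
  have KK_compact: "compact (KK l)" "KK l \<subseteq> A" for l
    unfolding KK_def using A(1) by (auto intro!: compact_Int_closed closed_INT)
  have KK_snoc: "KK (l @ [i]) = KK l \<inter> cball (d i) ((1/2) ^ length l)" for l i
    unfolding KK_def by (auto simp: nth_append lessThan_Suc)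
  have [measurable]: "Measurable.pred (restrict_space borel F) (ok l)" for l
  proof -
    obtain T where T: "closed T" "{x\<in>S. \<exists>a\<in>KK l. u (x, a) \<le> y} = S \<inter> T"
      using closedin_projection_compact[OF u KK_compact, of l y] unfolding closedin_closed by blast
    have "{x \<in> F. ok l x} = F \<inter> (S \<inter> T)" unfolding T(2)[symmetric] ok_def using F(2) by auto
    also have "\<dots> \<in> sets borel" using F S T(1) by auto
    finally show ?thesis using F(1) by (simp add: pred_def space_restrict_space sets_restrict_space_iff)
  qed
  have [measurable]: "(\<lambda>x. pre x m) \<in> measurable (restrict_space borel F) (count_space UNIV)" for m
  proof (induction m)
    case (Suc m)
    have "(\<lambda>x. LEAST i. ok (l @ [i]) x) \<in> measurable (restrict_space borel F) (count_space UNIV)" for l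
      by measurable
    then have "(\<lambda>x. l @ [LEAST i. ok (l @ [i]) x]) \<in> measurable (restrict_space borel F) (count_space UNIV)" for l
      by (rule measurable_compose) simp
    from measurable_compose_countable[where f = "\<lambda>l x. l @ [LEAST i. ok (l @ [i]) x]", OF this Suc]
    show ?case by (simp add: pre_Suc)
  qed (simp add: pre_0)
  have ok: "ok (pre x m) x" if "x \<in> F" for x m
  proof (induction m)
    case 0 then show ?case using ex[OF that] by (simp add: pre_0 ok_def KK_def)
  next
    case (Suc m)
    then obtain a where a: "a \<in> KK (pre x m)" "u (x, a) \<le> y" by (auto simp: ok_def)
    then obtain i where "a \<in> cball (d i) ((1/2) ^ length (pre x m))"
      using cover[of a "(1/2) ^ length (pre x m)"] KK_compact(2) by auto
    then have "ok (pre x m @ [i]) x" using a unfolding ok_def KK_snoc by blast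
    then show ?case unfolding pre_Suc by (rule LeastI)
  qed
  have len: "length (pre x m) = m" for x m by (induction m) (simp_all add: pre_0 pre_Suc)
  have pre_nth: "m < k \<Longrightarrow> pre x k ! m = last (pre x (Suc m))" for x m k
    by (induction k) (auto simp: pre_Suc nth_append len less_Suc_eq)
  define p where "p x m = d (last (pre x (Suc m)))" for x m
  \<comment> \<open>The centres themselves need not satisfy the bound. The witnesses
    \<open>b x k\<close> do; they are chosen without measurability and serve only to identify the
    limit of the centres.\<close>
  have "\<exists>b. \<forall>k. b k \<in> KK (pre x k) \<and> u (x, b k) \<le> y" if "x \<in> F" for x
    using ok[OF that] unfolding ok_def by metis
  then obtain b where b: "\<And>x k. x \<in> F \<Longrightarrow> b x k \<in> KK (pre x k)" "\<And>x k. x \<in> F \<Longrightarrow> u (x, b x k) \<le> y"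
    by metis
  have near: "dist (p x m) (b x k) \<le> (1/2) ^ m" if "x \<in> F" "m < k" for x m k
    using b(1)[OF that(1), of k] that(2) by (auto simp: KK_def len p_def pre_nth simp del: power_divide)
  have bA: "b x k \<in> A" if "x \<in> F" for x k using b(1)[OF that] KK_compact(2) by blast
  have conv: "\<exists>l\<in>A. p x \<longlonglongrightarrow> l \<and> (\<exists>r. strict_mono r \<and> (b x \<circ> r) \<longlonglongrightarrow> l)" if x: "x \<in> F" for x
  proof -
    obtain l r where l: "l \<in> A" "strict_mono (r :: nat \<Rightarrow> nat)" "(b x \<circ> r) \<longlonglongrightarrow> l"
      using A(1) bA[OF x] unfolding compact_def by metis
    have near_l: "dist (p x m) l \<le> (1/2) ^ m" for m
    proof (rule Lim_bounded)
      show "(\<lambda>k. dist (p x m) ((b x \<circ> r) k)) \<longlonglongrightarrow> dist (p x m) l" using l(3) by (intro tendsto_intros)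
      show "\<forall>k\<ge>Suc m. dist (p x m) ((b x \<circ> r) k) \<le> (1/2) ^ m"
      proof (intro allI impI)
        fix k assume "Suc m \<le> k"
        then have "m < r k" using seq_suble[OF l(2), of k] by simp
        then show "dist (p x m) ((b x \<circ> r) k) \<le> (1/2) ^ m" using near[OF x] by simp
      qed
    qed
    have "(\<lambda>m. dist (p x m) l) \<longlonglongrightarrow> 0"
    proof (rule tendsto_sandwich[OF _ _ tendsto_const])
      show "(\<lambda>m. (1/2::real) ^ m) \<longlonglongrightarrow> 0" by (rule LIMSEQ_realpow_zero) auto
    qed (simp_all add: near_l)
    then have "p x \<longlonglongrightarrow> l" by (rule tendsto_dist_iff[THEN iffD2])
    with l show ?thesis by blast
  qed
  obtain a0 where a0: "a0 \<in> A" using A(2) by blast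
  define f where "f x = (if x \<in> F then lim (p x) else a0)" for x
  have f: "f x \<in> A" "p x \<longlonglongrightarrow> f x" "\<exists>r. strict_mono r \<and> (b x \<circ> r) \<longlonglongrightarrow> f x" if "x \<in> F" for x
    using conv[OF that] that by (auto simp: f_def dest: limI)
  have "(\<lambda>x. p x m) \<in> borel_measurable (restrict_space borel F)" for m
    unfolding p_def by (rule measurable_compose[of "\<lambda>x. pre x (Suc m)" _ "count_space UNIV"]) simp_all
  then have "f \<in> borel_measurable (restrict_space borel F)"
    by (rule borel_measurable_LIMSEQ_metric[where f = "\<lambda>m x. p x m"]) (auto simp: space_restrict_space f)
  moreover have "f = (\<lambda>x. if x \<in> F then f x else a0)" by (auto simp: f_def)
  ultimately have f_meas: "f \<in> borel_measurable borel"
    using F(1) a0 measurable_restrict_space_iff[of F borel a0 borel f] by simp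
  moreover have "range f \<subseteq> A" using f(1) a0 by (auto simp: f_def)
  \<comment> \<open>A subsequence of the witnesses converges to the same limit as the centres, and
    lower semicontinuity carries the bound from the witnesses to that limit.\<close>
  moreover have "u (x, f x) \<le> y" if x: "x \<in> F" for x
  proof (rule ccontr)
    assume "\<not> u (x, f x) \<le> y"
    obtain T where T: "open T" "{p\<in>S \<times> A. y < u p} = S \<times> A \<inter> T"
      using u by (auto simp: lsc_on_def openin_open)
    have T_iff: "(x, a) \<in> T \<longleftrightarrow> y < u (x, a)" if "a \<in> A" for a
    proof -
      have "(x, a) \<in> {p\<in>S \<times> A. y < u p} \<longleftrightarrow> (x, a) \<in> S \<times> A \<inter> T" by (simp only: T(2))
      then show ?thesis using that x F(2) by auto
    qed
    have "(x, f x) \<in> T" using T_iff[OF f(1)[OF x]] \<open>\<not> u (x, f x) \<le> y\<close> by simp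
    obtain r where "strict_mono (r :: nat \<Rightarrow> nat)" and r: "(b x \<circ> r) \<longlonglongrightarrow> f x" using f(3)[OF x] by blast
    have "(\<lambda>k. (x, (b x \<circ> r) k)) \<longlonglongrightarrow> (x, f x)" using r by (intro tendsto_intros)
    from topological_tendstoD[OF this T(1) \<open>(x, f x) \<in> T\<close>] obtain k where "(x, (b x \<circ> r) k) \<in> T"
      by (auto simp: eventually_sequentially)
    then have "y < u (x, b x (r k))" using T_iff[OF bA[OF x]] by simp
    then show False using b(2)[OF x, of "r k"] by simp
  qed
  ultimately show thesis by (rule that)
qed

section \<open>The transition mechanism\<close>

locale ctmdp =
  fixes S :: "'s::polish_space set" and A :: "'a::polish_space set"
    and q :: "'s \<Rightarrow> 'a \<Rightarrow> 's set \<Rightarrow> real"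
  assumes model: "ctmdp_model S A q"
    and qx_continuous: "continuous_on (S \<times> A) (\<lambda>(x, a). qx q x a)"
begin

lemma S_borel [measurable]: "S \<in> sets borel"
  and A_borel [measurable]: "A \<in> sets borel" and A_nonempty: "A \<noteq> {}"
  using model by (auto simp: ctmdp_model_def)

lemma q_sums:
  "x \<in> S \<Longrightarrow> a \<in> A \<Longrightarrow> range F \<subseteq> sets borel \<Longrightarrow> (\<And>i::nat. F i \<subseteq> S) \<Longrightarrow> disjoint_family F \<Longrightarrow>
    (\<lambda>i. q x a (F i)) sums q x a (\<Union>i. F i)"
  using model unfolding ctmdp_model_def by blast

lemma q_measurable:
  "\<Gamma> \<in> sets borel \<Longrightarrow> \<Gamma> \<subseteq> S \<Longrightarrow> (\<lambda>(x, a). q x a \<Gamma>) \<in> borel_measurable (restrict_space borel (S \<times> A))"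
  using model unfolding ctmdp_model_def by blast

lemma qt_nonneg: "x \<in> S \<Longrightarrow> a \<in> A \<Longrightarrow> \<Gamma> \<in> sets borel \<Longrightarrow> \<Gamma> \<subseteq> S \<Longrightarrow> 0 \<le> qt q x a \<Gamma>"
  using model unfolding ctmdp_model_def by blast

lemma q_S: "x \<in> S \<Longrightarrow> a \<in> A \<Longrightarrow> q x a S = 0"
  using model unfolding ctmdp_model_def by blast

lemma qx_nonneg: "x \<in> S \<Longrightarrow> a \<in> A \<Longrightarrow> 0 \<le> qx q x a"
  using model unfolding ctmdp_model_def by blast

lemma qx_bounded:
  assumes "x \<in> S"
  obtains Q where "0 \<le> Q" "\<And>a. a \<in> A \<Longrightarrow> qx q x a \<le> Q"
proof -
  have fin: "(\<Squnion>a\<in>A. ennreal (qx q x a)) < \<top>"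
    using model assms unfolding ctmdp_model_def by blast
  have "qx q x a \<le> enn2real (\<Squnion>a\<in>A. ennreal (qx q x a))" if "a \<in> A" for a
    using SUP_upper[OF that, of "\<lambda>a. ennreal (qx q x a)"] fin qx_nonneg[OF assms that]
    by (metis enn2real_ennreal enn2real_mono)
  then show thesis using that[of "enn2real (\<Squnion>a\<in>A. ennreal (qx q x a))"] by auto
qed

lemma q_empty: assumes "x \<in> S" "a \<in> A" shows "q x a {} = 0"
proof -
  have "(\<lambda>i::nat. q x a {}) sums q x a (\<Union>i::nat. {})"
    by (rule q_sums) (use assms in \<open>auto simp: disjoint_family_on_def\<close>)
  then show ?thesis using summable_const_iff by (auto dest: sums_summable)
qed

lemma q_Un:
  assumes "x \<in> S" "a \<in> A" "B \<in> sets borel" "C \<in> sets borel" "B \<subseteq> S" "C \<subseteq> S" "B \<inter> C = {}"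
  shows "q x a (B \<union> C) = q x a B + q x a C"
proof -
  have "(\<lambda>i. q x a (binaryset B C i)) sums q x a (\<Union>i. binaryset B C i)"
    using assms by (intro q_sums) (auto simp: binaryset_def disjoint_family_on_def)
  moreover have "(\<lambda>i. q x a (binaryset B C i)) sums (q x a B + q x a C)"
    by (rule binaryset_sums) (rule q_empty[OF assms(1,2)])
  ultimately show ?thesis by (simp add: UN_binaryset_eq sums_unique2)
qed

text \<open>The removed point moves with x. Writing its removal as a correction by \<open>qx\<close>
  reduces measurability of \<open>qt\<close> to that of q at a fixed set and of
  \<open>qx\<close>.\<close>

lemma qt_eq:
  assumes "x \<in> S" "a \<in> A" "\<Gamma> \<in> sets borel" "\<Gamma> \<subseteq> S"
  shows "qt q x a \<Gamma> = (if x \<in> \<Gamma> then q x a \<Gamma> + qx q x a else q x a \<Gamma>)"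
proof (cases "x \<in> \<Gamma>")
  case True
  have "q x a ((\<Gamma> - {x}) \<union> {x}) = q x a (\<Gamma> - {x}) + q x a {x}"
    using assms True by (intro q_Un) auto
  moreover have "(\<Gamma> - {x}) \<union> {x} = \<Gamma>" using True by auto
  ultimately show ?thesis using True by (simp add: qt_def qx_def)
qed (simp add: qt_def)

lemma qt_S: "x \<in> S \<Longrightarrow> a \<in> A \<Longrightarrow> qt q x a S = qx q x a"
  by (simp add: qt_eq q_S)

lemma space_qtM [simp]: "space (qtM S q x a) = S"
  unfolding qtM_def 
  by (rule space_measure_of) (use sets.sets_into_space[of _ "restrict_space borel S"] in \<open>auto simp: space_restrict_space\<close>)

lemma sets_qtM [simp, measurable_cong]: "sets (qtM S q x a) = sets (restrict_space borel S)"
  unfolding qtM_def using sets.sets_measure_of_eq[of "restrict_space borel S"] by (simp add: space_restrict_space)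

lemma emeasure_qtM:
  assumes x: "x \<in> S" "a \<in> A" and "\<Gamma> \<in> sets borel" "\<Gamma> \<subseteq> S"
  shows "emeasure (qtM S q x a) \<Gamma> = ennreal (qt q x a \<Gamma>)"
  unfolding qtM_def
proof (rule emeasure_measure_of_sigma)
  show "sigma_algebra S (sets (restrict_space borel S))"
    using sets.sigma_algebra_axioms[of "restrict_space borel S"] by (simp add: space_restrict_space)
  show "positive (sets (restrict_space borel S)) (\<lambda>\<Gamma>. ennreal (qt q x a \<Gamma>))"
    using q_empty[OF x] by (simp add: positive_def qt_def)
  show "\<Gamma> \<in> sets (restrict_space borel S)" using assms by (simp add: sets_restrict_space_iff)
  show "countably_additive (sets (restrict_space borel S)) (\<lambda>\<Gamma>. ennreal (qt q x a \<Gamma>))"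
    unfolding countably_additive_def
  proof safe
    fix F :: "nat \<Rightarrow> 's set"
    assume F: "range F \<subseteq> sets (restrict_space borel S)" "disjoint_family F"
    have F': "F i \<in> sets borel" "F i \<subseteq> S" for i using F(1) by (auto simp: sets_restrict_space_iff subset_eq)
    have "(\<lambda>i. q x a (F i - {x})) sums q x a (\<Union>i. F i - {x})"
      using F' F(2) by (intro q_sums[OF x]) (auto simp: disjoint_family_on_def disjoint_iff)
    then have sums: "(\<lambda>i. qt q x a (F i)) sums qt q x a (\<Union>i. F i)" by (simp add: qt_def UN_extend_simps del: UN_simps)
    then show "(\<Sum>i. ennreal (qt q x a (F i))) = ennreal (qt q x a (\<Union> (range F)))"
      using qt_nonneg[OF x F'] by (simp add: suminf_ennreal2 sums_summable sums_unique[symmetric])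
  qed
qed

text \<open>Outside of S and A the model data are arbitrary, hence the totalisation by zero.\<close>

definition lift :: "('s \<Rightarrow> 'a \<Rightarrow> ennreal) \<Rightarrow> 's option \<Rightarrow> 'a \<Rightarrow> ennreal" where
  "lift g xo a = (case xo of None \<Rightarrow> 0 | Some x \<Rightarrow> if x \<in> S \<and> a \<in> A then g x a else 0)"

lemma lift_simps [simp]: "lift g None a = 0" "x \<in> S \<Longrightarrow> a \<in> A \<Longrightarrow> lift g (Some x) a = g x a"
  "x \<notin> S \<Longrightarrow> lift g (Some x) a = 0"
  by (simp_all add: lift_def)

abbreviation "MA \<equiv> restrict_space borel A"

lemma space_MA [simp]: "space MA = A"
  by (simp add: space_restrict_space)

lemma lift_measurable:
  assumes g: "(\<lambda>(x, a). g x a) \<in> borel_measurable (restrict_space borel (S \<times> A))"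
  shows "(\<lambda>(xo, a). lift g xo a) \<in> borel_measurable (optM \<Otimes>\<^sub>M MA)"
proof -
  have "S \<times> A \<in> sets (borel :: ('s \<times> 'a) measure)"
    using S_borel A_borel by (subst borel_prod[symmetric]) simp
  then have [measurable]: "(\<lambda>p. if p \<in> S \<times> A then g (fst p) (snd p) else 0) \<in> borel_measurable (borel \<Otimes>\<^sub>M borel)"
    unfolding borel_prod using g
    by (intro measurable_restrict_space_iff[THEN iffD1]) (auto simp: case_prod_beta')
  have [measurable]: "snd \<in> measurable (optM \<Otimes>\<^sub>M MA) (borel :: 'a measure)"
    by (rule measurable_compose[OF measurable_snd measurable_restrict_space1]) simp
  have [measurable]: "(\<lambda>p. (the (fst p), snd p)) \<in> measurable (optM \<Otimes>\<^sub>M MA) (borel \<Otimes>\<^sub>M borel)"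
    by measurable
  have m: "(\<lambda>p. if (the (fst p), snd p) \<in> S \<times> A then g (the (fst p)) (snd p) else 0)
      \<in> borel_measurable (optM \<Otimes>\<^sub>M MA)"
    using measurable_compose[of "\<lambda>p. (the (fst p), snd p)" "optM \<Otimes>\<^sub>M MA" "borel \<Otimes>\<^sub>M borel"
        "\<lambda>p. if p \<in> S \<times> A then g (fst p) (snd p) else 0" borel] by (simp cong: if_cong)
  have "(\<lambda>p. if fst p \<in> range Some then if (the (fst p), snd p) \<in> S \<times> A then g (the (fst p)) (snd p) else 0 else 0)
      \<in> borel_measurable (optM \<Otimes>\<^sub>M MA)"
    by (rule measurable_If) (use m in \<open>auto simp del: mem_Sigma_iff\<close>)
  also have "(\<lambda>p. if fst p \<in> range Some then if (the (fst p), snd p) \<in> S \<times> A then g (the (fst p)) (snd p) else 0 else 0)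
    = (\<lambda>(xo, a). lift g xo a)"
    by (auto simp: fun_eq_iff lift_def split: option.split)
  finally show ?thesis .
qed

lemma lift_ennreal_measurable:
  assumes "(\<lambda>(x, a). f x a) \<in> borel_measurable (restrict_space borel (S \<times> A))"
  shows "(\<lambda>(xo, a). lift (\<lambda>x a. ennreal (f x a)) xo a) \<in> borel_measurable (optM \<Otimes>\<^sub>M MA)"
  using measurable_compose[OF assms measurable_ennreal] by (intro lift_measurable) (simp add: case_prod_beta')

section \<open>Jump rates and the normalised jump law\<close>

definition rq :: "'s option \<Rightarrow> 'a \<Rightarrow> ennreal" where
  "rq = lift (\<lambda>x a. ennreal (qx q x a))"

text \<open>The kernel condition speaks of a fixed set and so does not directly cover the moving set
  {x}; continuity of q_x(a) supplies joint measurability.\<close>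

lemma qx_measurable: "(\<lambda>(x, a). qx q x a) \<in> borel_measurable (restrict_space borel (S \<times> A))"
  by (rule borel_measurable_continuous_on_restrict[OF qx_continuous])

lemma rq_measurable: "(\<lambda>(xo, a). rq xo a) \<in> borel_measurable (optM \<Otimes>\<^sub>M MA)"
  unfolding rq_def  by (rule lift_ennreal_measurable[OF qx_measurable])

lemma qt_measurable:
  assumes "\<Gamma> \<in> sets borel" "\<Gamma> \<subseteq> S"
  shows "(\<lambda>(x, a). ennreal (qt q x a \<Gamma>)) \<in> borel_measurable (restrict_space borel (S \<times> A))"
proof -
  have [measurable]: "fst \<in> measurable (restrict_space (borel :: ('s \<times> 'a) measure) (S \<times> A)) (borel :: 's measure)"
    by (rule measurable_restrict_space1) (simp flip: borel_prod)
  note [measurable] = q_measurable[OF assms] qx_measurable assms(1)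
  have "(\<lambda>p. ennreal (if fst p \<in> \<Gamma> then (case p of (x, a) \<Rightarrow> q x a \<Gamma>) + (case p of (x, a) \<Rightarrow> qx q x a)
      else (case p of (x, a) \<Rightarrow> q x a \<Gamma>))) \<in> borel_measurable (restrict_space borel (S \<times> A))"
    by measurable
  then show ?thesis
    by (rule measurable_cong[THEN iffD1, rotated]) (auto simp: space_restrict_space qt_eq assms)
qed

text \<open>Where the rate vanishes, which includes every pair outside S and A, the point mass at
  \<open>None\<close> keeps \<open>J\<close> a probability kernel. The choice is invisible in all
  integrals, because \<open>J\<close> enters them multiplied by \<open>rq\<close>.\<close>

definition J :: "'s option \<Rightarrow> 'a \<Rightarrow> 's option measure" where
  "J xo a = (if 0 < rq xo a
     then scale_measure (inverse (rq xo a)) (distr (qtM S q (the xo) a) optM Some)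
     else return optM None)"

lemma space_J [simp]: "space (J xo a) = UNIV"
  by (simp add: J_def space_scale_measure)

lemma sets_J [simp, measurable_cong]: "sets (J xo a) = sets optM"
  by (simp add: J_def)

lemma measurable_Some_qtM: "Some \<in> measurable (qtM S q x a) optM"
  using measurable_restrict_space1[OF measurable_Some, of S]
  by (simp cong: measurable_cong_sets)

lemma rq_pos:
  assumes "0 < rq xo a"
  obtains x where "xo = Some x" "x \<in> S" "a \<in> A" "rq xo a = ennreal (qx q x a)" "0 < qx q x a"
  using assms by (cases xo) (auto simp: rq_def lift_def split: if_splits)

lemma rq_finite: "rq xo a < \<top>"
  by (auto simp: rq_def lift_def split: option.split)

text \<open>For a positive rate the normalisation cancels. For rate 0 both sides vanish, because
  q~(.|x,a) has total mass q_x(a).\<close>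

lemma rq_times_nn_integral_J:
  assumes x: "x \<in> S" "a \<in> A" and W [measurable]: "W \<in> borel_measurable optM"
  shows "rq (Some x) a * (\<integral>\<^sup>+y. W y \<partial>J (Some x) a) = (\<integral>\<^sup>+y. W (Some y) \<partial>qtM S q x a)"
proof (cases "0 < rq (Some x) a")
  case True
  have "(\<integral>\<^sup>+y. W y \<partial>J (Some x) a) = inverse (rq (Some x) a) * (\<integral>\<^sup>+y. W (Some y) \<partial>qtM S q x a)"
    using True by (simp add: J_def nn_integral_scale_measure nn_integral_distr measurable_Some_qtM)
  then show ?thesis using True rq_finite[of "Some x" a]
    by (simp add: mult.assoc[symmetric] ennreal_inverse_mult ennreal_divide_self[unfolded divide_ennreal_def])
next
  case False
  then have "qx q x a = 0" using x qx_nonneg[OF x] by (simp add: rq_def not_less)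
  then have "emeasure (qtM S q x a) (space (qtM S q x a)) = 0"
    using x by (simp add: emeasure_qtM qt_S)
  then have "AE y in qtM S q x a. False"
    by (auto simp: eventually_ae_filter null_sets_def intro!: bexI[of _ S])
  then have "(\<integral>\<^sup>+y. W (Some y) \<partial>qtM S q x a) = 0" by (subst nn_integral_cong_AE[where v = "\<lambda>_. 0"]) auto
  with False show ?thesis by simp
qed

lemma rq_times_J:
  assumes x: "x \<in> S" "a \<in> A" and B: "B \<in> sets optM"
  shows "rq (Some x) a * emeasure (J (Some x) a) B = ennreal (qt q x a (Some -` B \<inter> S))"
proof -
  have "Some -` B \<inter> S \<in> sets borel" using B by (simp add: sets_optM)
  then have "emeasure (qtM S q x a) (Some -` B \<inter> S) = (\<integral>\<^sup>+y. indicator (Some -` B \<inter> S) y \<partial>qtM S q x a)"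
    by (simp add: sets_restrict_space_iff)
  also have "\<dots> = (\<integral>\<^sup>+y. indicator B (Some y) \<partial>qtM S q x a)"
    by (intro nn_integral_cong) (simp split: split_indicator)
  finally show ?thesis
    using rq_times_nn_integral_J[OF x, of "indicator B"] B emeasure_qtM[OF x \<open>Some -` B \<inter> S \<in> sets borel\<close>]
    by simp
qed

lemma J_emeasure:
  assumes "0 < rq xo a" and B: "B \<in> sets optM"
  shows "emeasure (J xo a) B = lift (\<lambda>x a. ennreal (qt q x a (Some -` B \<inter> S))) xo a / rq xo a"
proof -
  from assms(1) obtain x where x: "xo = Some x" "x \<in> S" "a \<in> A" by (rule rq_pos)
  have "lift (\<lambda>x a. ennreal (qt q x a (Some -` B \<inter> S))) xo a / rq xo a = rq xo a * emeasure (J xo a) B / rq xo a"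
    using rq_times_J[OF x(2,3) B] x by simp
  also have "\<dots> = emeasure (J xo a) B"
    using assms(1) rq_finite[of xo a] by (subst mult.commute) (simp add: ennreal_mult_divide_eq)
  finally show ?thesis by simp
qed

lemma J_prob: "prob_space (J xo a)"
proof (cases "0 < rq xo a")
  case True
  from True obtain x where x: "xo = Some x" "x \<in> S" "a \<in> A" "rq xo a = ennreal (qx q x a)" "0 < qx q x a" by (rule rq_pos)
  show ?thesis
    by (rule prob_spaceI, subst space_J, subst J_emeasure[OF True])
       (use x in \<open>simp_all add: qt_S sets_optM ennreal_divide_self\<close>)
next
  case False then show ?thesis by (simp add: J_def prob_space_return)
qed

lemma J_measurable: "(\<lambda>(xo, a). J xo a) \<in> measurable (optM \<Otimes>\<^sub>M MA) (prob_algebra optM)"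
proof (rule measurable_prob_algebraI)
  show "prob_space (case p of (xo, a) \<Rightarrow> J xo a)" for p by (cases p) (simp add: J_prob)
  show "(\<lambda>(xo, a). J xo a) \<in> measurable (optM \<Otimes>\<^sub>M MA) (subprob_algebra optM)"
  proof (rule measurable_subprob_algebra)
    show "subprob_space (case p of (xo, a) \<Rightarrow> J xo a)" for p
      by (cases p) (simp add: J_prob prob_space_imp_subprob_space)
    show "sets (case p of (xo, a) \<Rightarrow> J xo a) = sets optM" for p by (cases p) simp
    fix B :: "'s option set" assume B: "B \<in> sets optM"
    then have "Some -` B \<inter> S \<in> sets borel" by (simp add: sets_optM)
    note [measurable] = lift_measurable[OF qt_measurable[OF this Int_lower2]] rq_measurable
    have "(\<lambda>p. if 0 < (case p of (xo, a) \<Rightarrow> rq xo a)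
        then (case p of (xo, a) \<Rightarrow> lift (\<lambda>x a. ennreal (qt q x a (Some -` B \<inter> S))) xo a) / (case p of (xo, a) \<Rightarrow> rq xo a)
        else indicator B None) \<in> borel_measurable (optM \<Otimes>\<^sub>M MA)"
      by measurable
    also have "(\<lambda>p. if 0 < (case p of (xo, a) \<Rightarrow> rq xo a)
        then (case p of (xo, a) \<Rightarrow> lift (\<lambda>x a. ennreal (qt q x a (Some -` B \<inter> S))) xo a) / (case p of (xo, a) \<Rightarrow> rq xo a)
        else indicator B None) = (\<lambda>p. emeasure (case p of (xo, a) \<Rightarrow> J xo a) B)"
      using B by (auto simp: fun_eq_iff J_emeasure) (simp add: J_def)
    finally show "(\<lambda>p. emeasure (case p of (xo, a) \<Rightarrow> J xo a) B) \<in> borel_measurable (optM \<Otimes>\<^sub>M MA)" .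
  qed
qed

end

section \<open>The kernel of one sojourn\<close>

text \<open>A Daniell-type representation on the nonnegative measurable functions: linearity and
  continuity along increasing sequences make the functional an integral. The kernel of a sojourn can
  then be defined by its integral formula instead of being assembled from products, scalings and
  images of measures.\<close>

lemma measure_of_functional:
  fixes M :: "'b measure" and I :: "('b \<Rightarrow> ennreal) \<Rightarrow> ennreal"
  assumes space: "space M = UNIV"
    and I_cmult: "\<And>f c. f \<in> borel_measurable M \<Longrightarrow> I (\<lambda>x. c * f x) = c * I f"
    and I_add: "\<And>f g. f \<in> borel_measurable M \<Longrightarrow> g \<in> borel_measurable M \<Longrightarrow> I (\<lambda>x. f x + g x) = I f + I g"
    and I_SUP: "\<And>f :: nat \<Rightarrow> 'b \<Rightarrow> ennreal. (\<And>i. f i \<in> borel_measurable M) \<Longrightarrow> incseq f \<Longrightarrow>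
      I (\<lambda>x. SUP i. f i x) = (SUP i. I (f i))"
  defines "N \<equiv> measure_of UNIV (sets M) (\<lambda>B. I (indicator B))"
  shows sets_measure_of_functional: "sets N = sets M"
    and nn_integral_measure_of_functional: "f \<in> borel_measurable M \<Longrightarrow> (\<integral>\<^sup>+x. f x \<partial>N) = I f"
proof -
  show sets: "sets N = sets M" unfolding N_def using sets.sets_measure_of_eq[of M] by (simp add: space)
  have zero: "I (\<lambda>_. 0) = 0" using I_cmult[of "\<lambda>_. 0" 0] by simp
  have em: "emeasure N B = I (indicator B)" if "B \<in> sets M" for B
    unfolding N_def
  proof (rule emeasure_measure_of_sigma)
    show "sigma_algebra UNIV (sets M)" using sets.sigma_algebra_axioms[of M] by (simp add: space)
    show "positive (sets M) (\<lambda>B. I (indicator B))" using zero by (simp add: positive_def indicator_def[abs_def])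
    show "countably_additive (sets M) (\<lambda>B. I (indicator B))"
      unfolding countably_additive_def
    proof safe
      fix F :: "nat \<Rightarrow> 'b set" assume F: "range F \<subseteq> sets M" "disjoint_family F"
      have [measurable]: "F i \<in> sets M" for i using F(1) by auto
      have sum: "I (\<lambda>x. \<Sum>i<n. indicator (F i) x) = (\<Sum>i<n. I (indicator (F i)))" for n
        by (induction n) (simp_all add: zero I_add)
      have "indicator (\<Union>i. F i) = (\<lambda>x. SUP n. \<Sum>i<n. indicator (F i) x :: ennreal)"
        using suminf_indicator[OF F(2)] by (simp add: fun_eq_iff suminf_eq_SUP[symmetric])
      then have "I (indicator (\<Union>i. F i)) = I (\<lambda>x. SUP n. \<Sum>i<n. indicator (F i) x :: ennreal)" by simp
      also have "\<dots> = (SUP n. I (\<lambda>x. \<Sum>i<n. indicator (F i) x))"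
        by (rule I_SUP) (auto simp: incseq_def le_fun_def intro!: sum_mono2)
      also have "\<dots> = (\<Sum>i. I (indicator (F i)))" by (simp add: sum suminf_eq_SUP)
      finally show "(\<Sum>i. I (indicator (F i))) = I (indicator (\<Union> (range F)))" by simp
    qed
  qed (rule that)
  show "(\<integral>\<^sup>+x. f x \<partial>N) = I f" if "f \<in> borel_measurable M"
    using that
  proof (induction rule: borel_measurable_induct)
    case (cong f g)
    then have "f = g" by (auto simp: space)
    with cong show ?case by simp
  next
    case (set B) then show ?case by (simp add: em sets)
  next
    case (mult u c) then show ?case by (subst nn_integral_cmult) (auto simp: I_cmult sets cong: measurable_cong_sets)
  next
    case (add u v) then show ?case by (subst nn_integral_add) (auto simp: I_add sets cong: measurable_cong_sets)
  next
    case (seq U)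
    have "(\<integral>\<^sup>+x. (SUP i. U i) x \<partial>N) = (SUP i. \<integral>\<^sup>+x. U i x \<partial>N)"
      unfolding SUP_apply using seq sets
      by (intro nn_integral_monotone_convergence_SUP) (auto cong: measurable_cong_sets)
    also have "\<dots> = I (\<lambda>x. SUP i. U i x)" using seq by (subst I_SUP) auto
    finally show ?case by (simp add: SUP_apply[abs_def] image_comp)
  qed
qed

section \<open>Policies as kernels of the history and averages over actions\<close>

locale ctmdp_policy = ctmdp S A q
  for S :: "'s::polish_space set" and A :: "'a::polish_space set" and q :: "'s \<Rightarrow> 'a \<Rightarrow> 's set \<Rightarrow> real" +
  fixes pol :: "nat \<Rightarrow> 's traj \<Rightarrow> real \<Rightarrow> 'a measure"
  assumes policy: "is_policy S A pol"
begin

lemma pol_cong: "(\<And>k. k \<le> n \<Longrightarrow> \<omega> k = \<omega>' k) \<Longrightarrow> pol (Suc n) \<omega> s = pol (Suc n) \<omega>' s"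
  using policy unfolding is_policy_def by (metis le_add1 less_Suc_eq_le plus_1_eq_Suc)

lemma pol_measurable:
  "(\<lambda>(\<omega>, s). pol (Suc n) \<omega> s) \<in> measurable (trajM \<Otimes>\<^sub>M restrict_space borel {0<..}) (prob_algebra MA)"
  using policy by (simp add: is_policy_def)

text \<open>Policies are unconstrained at nonpositive times; act fills in a harmless value there.\<close>

definition act :: "nat \<Rightarrow> 's traj \<Rightarrow> real \<Rightarrow> 'a measure" where
  "act n h s = (if 0 < s then pol (Suc n) h s else return MA (SOME a. a \<in> A))"

lemma act_pos: "0 < s \<Longrightarrow> act n h s = pol (Suc n) h s"
  by (simp add: act_def)

lemma act_cong: "(\<And>k. k \<le> n \<Longrightarrow> \<omega> k = \<omega>' k) \<Longrightarrow> act n \<omega> s = act n \<omega>' s"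
  using pol_cong[of n \<omega> \<omega>' s] by (simp add: act_def)

lemma act_restrict [simp]: "act n (restrict \<omega> {..n}) s = act n \<omega> s"
  by (rule act_cong) simp

lemma act_extend_hist: "act n (extend_hist n h) s = act n h s"
  by (rule act_cong) (simp add: extend_hist_def)

lemma act_measurable_traj:
  "(\<lambda>(\<omega>, s). act n \<omega> s) \<in> measurable (trajM \<Otimes>\<^sub>M borel) (prob_algebra MA)"
proof -
  let ?\<Omega> = "{p :: 's traj \<times> real. 0 < snd p}"
  let ?M = "(trajM :: 's traj measure) \<Otimes>\<^sub>M (borel :: real measure)"
  have a0: "(SOME a. a \<in> A) \<in> A" using A_nonempty by (simp add: some_in_eq)
  have "(\<lambda>p. (fst p, snd p)) \<in> measurable (restrict_space ?M ?\<Omega>) (trajM \<Otimes>\<^sub>M restrict_space borel {0<..})"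
    by (intro measurable_Pair measurable_restrict_space2 measurable_restrict_space1) (auto simp: space_restrict_space)
  from measurable_compose[OF this pol_measurable[of n]]
  have "(\<lambda>p. pol (Suc n) (fst p) (snd p)) \<in> measurable (restrict_space ?M ?\<Omega>) (prob_algebra MA)"
    by (simp add: case_prod_beta)
  moreover have "?\<Omega> \<inter> space ?M \<in> sets ?M"
  proof -
    have "{p \<in> space ?M. 0 < snd p} \<in> sets ?M" by measurable
    also have "{p \<in> space ?M. 0 < snd p} = ?\<Omega> \<inter> space ?M" by auto
    finally show ?thesis .
  qed
  moreover have "return MA (SOME a. a \<in> A) \<in> space (prob_algebra MA)"
    using a0 by (simp add: space_prob_algebra prob_space_return)
  ultimately have "(\<lambda>p. if p \<in> ?\<Omega> then pol (Suc n) (fst p) (snd p) else return MA (SOME a. a \<in> A)) \<in> measurable ?M (prob_algebra MA)"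
    by (subst measurable_restrict_space_iff[symmetric]) auto
  then show ?thesis by (simp add: act_def case_prod_beta)
qed

lemma act_measurable: "(\<lambda>(h, s). act n h s) \<in> measurable (histM n \<Otimes>\<^sub>M borel) (prob_algebra MA)"
proof -
  have "(\<lambda>p. (extend_hist n (fst p), snd p)) \<in> measurable (histM n \<Otimes>\<^sub>M borel) (trajM \<Otimes>\<^sub>M borel)"
    by measurable
  from measurable_compose[OF this act_measurable_traj[of n]]
  show ?thesis by (simp add: case_prod_beta act_extend_hist)
qed

lemma act_space: "prob_space (act n h s)" "sets (act n h s) = sets MA" "space (act n h s) = A"
proof -
  have "(\<lambda>(\<omega>, s). act n \<omega> s) (h, s) \<in> space (prob_algebra MA)"
    by (rule measurable_space[OF act_measurable_traj]) (simp add: space_pair_measure)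
  then show *: "prob_space (act n h s)" "sets (act n h s) = sets MA" by (simp_all add: space_prob_algebra)
  then show "space (act n h s) = A" using sets_eq_imp_space_eq[of "act n h s" MA] by simp
qed

lemma act_section_measurable:
  assumes "(\<lambda>(xo, a). u xo a) \<in> borel_measurable (optM \<Otimes>\<^sub>M MA)"
  shows "(\<lambda>a. u xo a) \<in> borel_measurable (act n \<omega> s)"
  using measurable_Pair2[OF assms, of xo] by (simp add: measurable_cong_sets[OF act_space(2) refl])

lemma act_integral_measurable:
  assumes "(\<lambda>(p, a). f p a) \<in> borel_measurable ((histM n \<Otimes>\<^sub>M borel) \<Otimes>\<^sub>M MA)"
  shows "(\<lambda>(h, s). \<integral>\<^sup>+a. f (h, s) a \<partial>act n h s) \<in> borel_measurable (histM n \<Otimes>\<^sub>M borel)"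
proof -
  have "(\<lambda>p. \<integral>\<^sup>+a. f p a \<partial>(case p of (h, s) \<Rightarrow> act n h s)) \<in> borel_measurable (histM n \<Otimes>\<^sub>M borel)"
    by (rule nn_integral_measurable_subprob_algebra2[OF assms measurable_prob_algebraD[OF act_measurable]])
  then show ?thesis by (simp add: case_prod_beta')
qed

lemma lift_hist_measurable:
  assumes g: "(\<lambda>(xo, a). g xo a) \<in> borel_measurable (optM \<Otimes>\<^sub>M MA)"
  shows "(\<lambda>(p, a). g (snd (fst p n)) a) \<in> borel_measurable ((histM n \<Otimes>\<^sub>M borel) \<Otimes>\<^sub>M MA)"
proof -
  note [measurable] = measurable_component_histM[OF order_refl, of n]
  have "(\<lambda>z. (snd (fst (fst z) n), snd z)) \<in> measurable ((histM n \<Otimes>\<^sub>M borel) \<Otimes>\<^sub>M MA) (optM \<Otimes>\<^sub>M MA)"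
    by measurable
  from measurable_compose[OF this g] show ?thesis by (simp add: case_prod_beta')
qed

definition avg :: "('s option \<Rightarrow> 'a \<Rightarrow> ennreal) \<Rightarrow> nat \<Rightarrow> 's traj \<Rightarrow> real \<Rightarrow> ennreal" where
  "avg g n h s = (\<integral>\<^sup>+a. g (snd (h n)) a \<partial>act n h s)"

lemma avg_restrict [simp]: "avg g n (restrict \<omega> {..n}) = avg g n \<omega>"
  by (simp add: avg_def fun_eq_iff)

lemma avg_measurable:
  assumes g: "(\<lambda>(xo, a). g xo a) \<in> borel_measurable (optM \<Otimes>\<^sub>M MA)"
  shows "(\<lambda>(h, s). avg g n h s) \<in> borel_measurable (histM n \<Otimes>\<^sub>M borel)"
  using act_integral_measurable[OF lift_hist_measurable[OF g]] by (simp add: avg_def)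

abbreviation rate :: "nat \<Rightarrow> 's traj \<Rightarrow> real \<Rightarrow> ennreal" where
  "rate \<equiv> avg rq"

text \<open>Rates are bounded over actions at each single state, and the current state is fixed by
  the history. The bound varies with the history, which suffices because \<open>hazard_rate\<close>
  is instantiated for one history at a time.\<close>

lemma rate_bounded:
  obtains Q where "0 \<le> Q" "\<And>s. rate n h s \<le> ennreal Q"
proof -
  obtain Q where Q: "0 \<le> Q" "\<And>a. rq (snd (h n)) a \<le> ennreal Q"
  proof (cases "snd (h n)")
    case (Some x)
    show thesis
    proof (cases "x \<in> S")
      case True
      from qx_bounded[OF this] obtain Q where "0 \<le> Q" "\<And>a. a \<in> A \<Longrightarrow> qx q x a \<le> Q" by metis
      then show thesis using Some True by (intro that[of Q]) (auto simp: rq_def lift_def intro: ennreal_leI)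
    qed (use that[of 0] Some in \<open>simp add: rq_def\<close>)
  qed (use that[of 0] in \<open>simp add: rq_def\<close>)
  have "rate n h s \<le> ennreal Q" for s
  proof -
    interpret prob_space "act n h s" by (rule act_space)
    have "rate n h s \<le> (\<integral>\<^sup>+a. ennreal Q \<partial>act n h s)" unfolding avg_def by (intro nn_integral_mono Q)
    then show ?thesis by (simp add: emeasure_space_1)
  qed
  with Q(1) show thesis by (rule that)
qed

lemma fixed_history_measurable:
  assumes "(\<lambda>(h, s). f h s) \<in> borel_measurable (histM n \<Otimes>\<^sub>M borel)" "h \<in> space (histM n)"
  shows "f h \<in> borel_measurable borel"
  using measurable_Pair2[OF assms] by simp

lemma rate_measurable:
  "(\<lambda>(h, s). rate n h s) \<in> borel_measurable (histM n \<Otimes>\<^sub>M borel)"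
  by (rule avg_measurable[OF rq_measurable])

lemma hazard_rate: assumes "h \<in> space (histM n)" obtains Q where "hazard_rate (rate n h) Q"
proof -
  obtain Q where "0 \<le> Q" "\<And>s. rate n h s \<le> ennreal Q" using rate_bounded[of n h] by metis
  then show thesis using fixed_history_measurable[OF rate_measurable assms]
    by (intro that[of Q] hazard_rate.intro) auto
qed

lemma survival_measurable:
  "(\<lambda>(h, s). survival (rate n h) s) \<in> borel_measurable (histM n \<Otimes>\<^sub>M borel)"
proof -
  have [measurable]: "(\<lambda>z. rate n (fst (fst z)) (snd z)) \<in> borel_measurable ((histM n \<Otimes>\<^sub>M borel) \<Otimes>\<^sub>M lborel)"
  proof -
    have "(\<lambda>z. (fst (fst z), snd z)) \<in> measurable ((histM n \<Otimes>\<^sub>M borel) \<Otimes>\<^sub>M lborel) (histM n \<Otimes>\<^sub>M borel)"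
      by measurable
    from measurable_compose[OF this rate_measurable] show ?thesis by simp
  qed
  have [measurable]: "Measurable.pred ((histM n \<Otimes>\<^sub>M borel) \<Otimes>\<^sub>M lborel) (\<lambda>z. (snd z :: real) \<in> {0<..snd (fst z)})"
  proof -
    have "Measurable.pred ((histM n \<Otimes>\<^sub>M borel) \<Otimes>\<^sub>M borel) (\<lambda>z. 0 < (snd z :: real) \<and> snd z \<le> snd (fst z))" by measurable
    then show ?thesis by (simp cong: measurable_cong_sets)
  qed
  have "(\<lambda>p. cum_hazard (rate n (fst p)) (snd p)) \<in> borel_measurable (histM n \<Otimes>\<^sub>M borel)"
    unfolding cum_hazard_def
    by (rule lborel.borel_measurable_nn_integral) (simp add: case_prod_beta')
  then show ?thesis unfolding survival_def by (simp add: case_prod_beta')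
qed

lemma time_integral_measurable:
  assumes "(\<lambda>(h, s). f h s) \<in> borel_measurable (histM n \<Otimes>\<^sub>M borel)"
  shows "(\<lambda>h. \<integral>\<^sup>+s. indicator {0<..} s * (survival (rate n h) s * f h s) \<partial>lborel) \<in> borel_measurable (histM n)"
proof -
  note [measurable] = assms survival_measurable[of n]
  have "(\<lambda>p. indicator {0<..} (snd p) * ((case p of (h, s) \<Rightarrow> survival (rate n h) s) * (case p of (h, s) \<Rightarrow> f h s)))
    \<in> borel_measurable (histM n \<Otimes>\<^sub>M borel)" by measurable
  then have "(\<lambda>(h, s). indicator {0<..} s * (survival (rate n h) s * f h s)) \<in> borel_measurable (histM n \<Otimes>\<^sub>M lborel)"
    by (simp add: case_prod_beta' cong: measurable_cong_sets)
  then show ?thesis by (rule lborel.borel_measurable_nn_integral)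
qed

lemma never_measurable: "(\<lambda>h. never (rate n h)) \<in> borel_measurable (histM n)"
  unfolding never_def using time_integral_measurable[OF rate_measurable] by measurable

text \<open>Averaging rate times jump law over the action gives the numerator of the prescribed
  transition probability. Together with the survival function it is the density of the pair
  (sojourn, next state), with no quotient left.\<close>

definition jump :: "nat \<Rightarrow> (ennreal \<times> 's option \<Rightarrow> ennreal) \<Rightarrow> 's traj \<Rightarrow> real \<Rightarrow> ennreal" where
  "jump n f h s = (\<integral>\<^sup>+a. rq (snd (h n)) a * (\<integral>\<^sup>+y. f (ennreal s, y) \<partial>J (snd (h n)) a) \<partial>act n h s)"

text \<open>An absolutely continuous part on the finite positive sojourns plus an atom at
  \<open>(\<top>, None)\<close> of mass \<open>never\<close>.\<close>

definition step_integral :: "nat \<Rightarrow> 's traj \<Rightarrow> (ennreal \<times> 's option \<Rightarrow> ennreal) \<Rightarrow> ennreal" where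
  "step_integral n h f =
     (\<integral>\<^sup>+s. indicator {0<..} s * (survival (rate n h) s * jump n f h s) \<partial>lborel) + never (rate n h) * f (\<top>, None)"

lemma jump_inner_measurable:
  assumes f: "(\<lambda>(h, z). f h z) \<in> borel_measurable (histM n \<Otimes>\<^sub>M stepM)"
  shows "(\<lambda>(p, a). rq (snd (fst p n)) a * (\<integral>\<^sup>+y. f (fst p) (ennreal (snd p), y) \<partial>J (snd (fst p n)) a))
      \<in> borel_measurable ((histM n \<Otimes>\<^sub>M borel) \<Otimes>\<^sub>M MA)"
proof -
  let ?M = "(histM n \<Otimes>\<^sub>M (borel :: real measure)) \<Otimes>\<^sub>M MA"
  note [measurable] = measurable_component_histM[OF order_refl, of n] f
  have K: "(\<lambda>z. J (snd (fst (fst z) n)) (snd z)) \<in> measurable ?M (subprob_algebra optM)"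
  proof -
    have "(\<lambda>z. (snd (fst (fst z) n), snd z)) \<in> measurable ?M (optM \<Otimes>\<^sub>M MA)" by measurable
    from measurable_compose[OF this measurable_prob_algebraD[OF J_measurable]] show ?thesis by simp
  qed
  have "(\<lambda>w. (fst (fst (fst w)), (ennreal (snd (fst (fst w))), snd w))) \<in> measurable (?M \<Otimes>\<^sub>M optM) (histM n \<Otimes>\<^sub>M stepM)"
    unfolding stepM_def by measurable
  from measurable_compose[OF this f]
  have "(\<lambda>(z, y). f (fst (fst z)) (ennreal (snd (fst z)), y)) \<in> borel_measurable (?M \<Otimes>\<^sub>M optM)"
    by (simp add: case_prod_beta')
  from nn_integral_measurable_subprob_algebra2[OF this K]
  have "(\<lambda>z. \<integral>\<^sup>+y. f (fst (fst z)) (ennreal (snd (fst z)), y) \<partial>J (snd (fst (fst z) n)) (snd z)) \<in> borel_measurable ?M" .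
  then show ?thesis using lift_hist_measurable[OF rq_measurable, of n]
    unfolding case_prod_beta' by (intro borel_measurable_times_ennreal) auto
qed

lemma jump_measurable:
  assumes f: "(\<lambda>(h, z). f h z) \<in> borel_measurable (histM n \<Otimes>\<^sub>M stepM)"
  shows "(\<lambda>(h, s). jump n (f h) h s) \<in> borel_measurable (histM n \<Otimes>\<^sub>M borel)"
  using act_integral_measurable[OF jump_inner_measurable[OF f]] by (simp add: jump_def)

lemma step_integral_measurable:
  assumes f: "(\<lambda>(h, z). f h z) \<in> borel_measurable (histM n \<Otimes>\<^sub>M stepM)"
  shows "(\<lambda>h. step_integral n h (f h)) \<in> borel_measurable (histM n)"
proof -
  have "(\<lambda>h. (h, (\<top>, None))) \<in> measurable (histM n) (histM n \<Otimes>\<^sub>M stepM)"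
    unfolding stepM_def by measurable
  from measurable_compose[OF this f] have [measurable]: "(\<lambda>h. f h (\<top>, None)) \<in> borel_measurable (histM n)" by simp
  note [measurable] = time_integral_measurable[OF jump_measurable[OF f]] never_measurable[of n]
  show ?thesis unfolding step_integral_def by measurable
qed

lemma jump_inner_measurable1:
  assumes f: "f \<in> borel_measurable stepM" and h: "h \<in> space (histM n)"
  shows "(\<lambda>a. rq (snd (h n)) a * (\<integral>\<^sup>+y. f (ennreal s, y) \<partial>J (snd (h n)) a)) \<in> borel_measurable (act n h s)"
    and "(\<lambda>y. f (ennreal s, y)) \<in> borel_measurable (J xo a)"
    and "(\<lambda>a. \<integral>\<^sup>+y. f (ennreal s, y) \<partial>J (snd (h n)) a) \<in> borel_measurable (act n h s)"
    and "(\<lambda>a. rq (snd (h n)) a) \<in> borel_measurable (act n h s)"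
    and "jump n f h \<in> borel_measurable borel"
proof -
  have f': "(\<lambda>(h, z). f z) \<in> borel_measurable (histM n \<Otimes>\<^sub>M stepM)"
    using measurable_compose[OF measurable_snd f] by (simp add: case_prod_beta')
  have hs: "(h, s) \<in> space (histM n \<Otimes>\<^sub>M borel)" using h by (simp add: space_pair_measure)
  show "(\<lambda>a. rq (snd (h n)) a * (\<integral>\<^sup>+y. f (ennreal s, y) \<partial>J (snd (h n)) a)) \<in> borel_measurable (act n h s)"
    using measurable_Pair2[OF jump_inner_measurable[OF f'] hs] act_space(2)[of n h s] by (simp cong: measurable_cong_sets)
  show [measurable]: "(\<lambda>y. f (ennreal s, y)) \<in> borel_measurable (J xo a)" for xo a
    using f by (simp add: stepM_def measurable_cong_sets[OF sets_J refl])
  have xo: "snd (h n) \<in> space optM" by simp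
  show "(\<lambda>a. rq (snd (h n)) a) \<in> borel_measurable (act n h s)"
    using measurable_Pair2[OF rq_measurable xo] act_space(2)[of n h s] by (simp cong: measurable_cong_sets)
  have "(\<lambda>a. J (snd (h n)) a) \<in> measurable MA (subprob_algebra optM)"
    using measurable_Pair2[OF measurable_prob_algebraD[OF J_measurable] xo] by simp
  moreover have "(\<lambda>y. f (ennreal s, y)) \<in> borel_measurable optM" using f by (simp add: stepM_def)
  ultimately have "(\<lambda>a. \<integral>\<^sup>+y. f (ennreal s, y) \<partial>J (snd (h n)) a) \<in> borel_measurable MA"
    by (rule measurable_compose[OF _ nn_integral_measurable_subprob_algebra])
  then show "(\<lambda>a. \<integral>\<^sup>+y. f (ennreal s, y) \<partial>J (snd (h n)) a) \<in> borel_measurable (act n h s)"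
    by (simp add: measurable_cong_sets[OF act_space(2) refl])
  show "jump n f h \<in> borel_measurable borel"
    by (rule fixed_history_measurable[OF jump_measurable[OF f'] h])
qed

lemma survival_measurable1: "h \<in> space (histM n) \<Longrightarrow> survival (rate n h) \<in> borel_measurable borel"
  by (rule fixed_history_measurable[OF survival_measurable])

lemma step_integral_cmult:
  assumes h: "h \<in> space (histM n)" and f: "f \<in> borel_measurable stepM"
  shows "step_integral n h (\<lambda>z. c * f z) = c * step_integral n h f"
proof -
  note [measurable] = jump_inner_measurable1[OF f h] survival_measurable1[OF h]
  have "jump n (\<lambda>z. c * f z) h s = c * jump n f h s" for s
    unfolding jump_def by (simp add: nn_integral_cmult mult.left_commute[of _ c])
  then show ?thesis unfolding step_integral_def
    by (simp add: mult.left_commute[of _ c] nn_integral_cmult distrib_left)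
qed

lemma step_integral_add:
  assumes h: "h \<in> space (histM n)" and f: "f \<in> borel_measurable stepM" "g \<in> borel_measurable stepM"
  shows "step_integral n h (\<lambda>z. f z + g z) = step_integral n h f + step_integral n h g"
proof -
  note [measurable] = jump_inner_measurable1[OF f(1) h] jump_inner_measurable1[OF f(2) h] survival_measurable1[OF h]
  have "jump n (\<lambda>z. f z + g z) h s = jump n f h s + jump n g h s" for s
    unfolding jump_def by (simp add: nn_integral_add distrib_left)
  then show ?thesis unfolding step_integral_def
    by (simp add: distrib_left nn_integral_add add_ac)
qed

lemma step_integral_SUP:
  assumes h: "h \<in> space (histM n)" and f: "\<And>i::nat. f i \<in> borel_measurable stepM" and inc: "incseq f"
  shows "step_integral n h (\<lambda>z. SUP i. f i z) = (SUP i. step_integral n h (f i))"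
proof -
  note [measurable] = jump_inner_measurable1[OF f h] survival_measurable1[OF h]
  have mono: "f i z \<le> f j z" if "i \<le> j" for i j z using incseqD[OF inc that] by (rule le_funD)
  have "(\<integral>\<^sup>+y. (SUP i. f i (ennreal s, y)) \<partial>J xo a) = (SUP i. \<integral>\<^sup>+y. f i (ennreal s, y) \<partial>J xo a)" for s xo a
    by (rule nn_integral_monotone_convergence_SUP) (auto simp: incseq_def le_fun_def mono)
  then have jmp: "jump n (\<lambda>z. SUP i. f i z) h s = (SUP i. jump n (f i) h s)" for s
    unfolding jump_def by (simp add: SUP_mult_left_ennreal)
      (rule nn_integral_monotone_convergence_SUP, auto simp: incseq_def le_fun_def intro!: mult_left_mono nn_integral_mono mono)
  have jmono: "jump n (f i) h s \<le> jump n (f j) h s" if "i \<le> j" for i j s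
    unfolding jump_def by (auto intro!: mult_left_mono nn_integral_mono mono that)
  have "(\<integral>\<^sup>+s. indicator {0<..} s * (survival (rate n h) s * jump n (\<lambda>z. SUP i. f i z) h s) \<partial>lborel) =
      (SUP i. \<integral>\<^sup>+s. indicator {0<..} s * (survival (rate n h) s * jump n (f i) h s) \<partial>lborel)"
    unfolding jmp SUP_mult_left_ennreal
    by (rule nn_integral_monotone_convergence_SUP) (auto simp: incseq_def le_fun_def intro!: mult_left_mono jmono)
  then show ?thesis unfolding step_integral_def
    by (simp add: SUP_mult_left_ennreal)
       (rule ennreal_SUP_add[symmetric], auto simp: incseq_def intro!: mult_left_mono nn_integral_mono jmono mono)
qed

text \<open>The joint law of the next sojourn time and the next state.\<close>

definition K :: "nat \<Rightarrow> 's traj \<Rightarrow> (ennreal \<times> 's option) measure" where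
  "K n h = measure_of UNIV (sets stepM) (\<lambda>B. step_integral n h (indicator B))"

lemma
  assumes h: "h \<in> space (histM n)"
  shows sets_K: "sets (K n h) = sets stepM"
    and nn_integral_K: "f \<in> borel_measurable stepM \<Longrightarrow> (\<integral>\<^sup>+z. f z \<partial>K n h) = step_integral n h f"
  unfolding K_def
  by (rule sets_measure_of_functional nn_integral_measure_of_functional;
      auto intro: step_integral_cmult[OF h] step_integral_add[OF h] step_integral_SUP[OF h])+

lemma space_K: "h \<in> space (histM n) \<Longrightarrow> space (K n h) = UNIV"
  using sets_eq_imp_space_eq[OF sets_K] by simp

lemma emeasure_K: "h \<in> space (histM n) \<Longrightarrow> B \<in> sets stepM \<Longrightarrow> emeasure (K n h) B = step_integral n h (indicator B)"
  by (subst nn_integral_K[symmetric]) (auto simp: sets_K)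

lemma prob_space_K: assumes h: "h \<in> space (histM n)" shows "prob_space (K n h)"
proof (rule prob_spaceI)
  obtain Q where "hazard_rate (rate n h) Q" using h by (rule hazard_rate)
  then interpret hazard_rate "rate n h" Q .
  have "jump n (\<lambda>_. 1) h s = rate n h s" for s
    unfolding jump_def avg_def using prob_space.emeasure_space_1[OF J_prob] by simp
  then have "step_integral n h (\<lambda>_. 1) = 1"
    using density_integral_plus_atom by (simp add: step_integral_def)
  then show "emeasure (K n h) (space (K n h)) = 1"
    using emeasure_K[OF h, of UNIV] sets.top[of stepM] by (simp add: space_K[OF h] indicator_def[abs_def])
qed

lemma K_measurable: "K n \<in> measurable (histM n) (subprob_algebra stepM)"
proof (rule measurable_subprob_algebra)
  fix B :: "(ennreal \<times> 's option) set" assume [measurable]: "B \<in> sets stepM"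
  have "(\<lambda>(h, z). indicator B z) \<in> borel_measurable (histM n \<Otimes>\<^sub>M stepM)" by measurable
  from step_integral_measurable[OF this]
  show "(\<lambda>h. emeasure (K n h) B) \<in> borel_measurable (histM n)"
    by (rule measurable_cong[THEN iffD1, rotated]) (simp add: emeasure_K)
qed (auto simp: prob_space_K prob_space_imp_subprob_space sets_K)

end

section \<open>Existence of the strategic measure\<close>

context ctmdp_policy
begin

lemma jump_restrict [simp]: "jump n f (restrict \<omega> {..n}) = jump n f \<omega>"
  by (simp add: jump_def fun_eq_iff)

lemma step_integral_restrict [simp]: "step_integral n (restrict \<omega> {..n}) f = step_integral n \<omega> f"
  by (simp add: step_integral_def)

definition init :: "'s measure \<Rightarrow> (ennreal \<times> 's option) measure" where
  "init \<gamma> = distr \<gamma> stepM (\<lambda>x. (0, Some x))"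

definition kern :: "'s measure \<Rightarrow> nat \<Rightarrow> 's traj \<Rightarrow> (ennreal \<times> 's option) measure" where
  "kern \<gamma> i h = (case i of 0 \<Rightarrow> init \<gamma> | Suc n \<Rightarrow> K n h)"

text \<open>Integrated form of the one-step transition, tested with functions of history, sojourn
  and next state together. In contrast to \<open>is_strategic\<close> it contains no quotient of
  averaged rates, and path functionals such as costs can be inserted directly.\<close>

definition step_law :: "'s traj measure \<Rightarrow> bool" where
  "step_law P \<longleftrightarrow> (\<forall>n f. (\<lambda>(h, z). f h z) \<in> borel_measurable (histM n \<Otimes>\<^sub>M stepM) \<longrightarrow>
     (\<integral>\<^sup>+\<omega>. f (restrict \<omega> {..n}) (\<omega> (Suc n)) \<partial>P) = (\<integral>\<^sup>+\<omega>. step_integral n \<omega> (f (restrict \<omega> {..n})) \<partial>P))"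

lemma histM_ivl: "histM n = PiM {0..<Suc n} (\<lambda>_. stepM)"
  by (simp add: histM_def atLeast0LessThan lessThan_Suc_atMost)

lemma measurable_init: "sets \<gamma> = sets (restrict_space borel S) \<Longrightarrow> (\<lambda>x. (0, Some x)) \<in> measurable \<gamma> stepM"
  unfolding stepM_def
  using measurable_restrict_space1[OF measurable_Some, of S] by (simp cong: measurable_cong_sets)

text \<open>Ionescu-Tulcea with \<open>init\<close> at index 0 and the kernels \<open>K n\<close>
  afterwards. The step law is the kernel property for histories of length n + 2, pulled back to the
  limit measure through its finite marginals.\<close>

lemma step_law_exists:
  assumes \<gamma>: "prob_space \<gamma>" "sets \<gamma> = sets (restrict_space borel S)"
  obtains P where "prob_space P" "sets P = sets trajM" "step_law P"
    "\<And>g. g \<in> borel_measurable stepM \<Longrightarrow> (\<integral>\<^sup>+\<omega>. g (\<omega> 0) \<partial>P) = (\<integral>\<^sup>+x. g (0, Some x) \<partial>\<gamma>)"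
proof -
  have init: "prob_space (init \<gamma>)" "sets (init \<gamma>) = sets stepM"
    using prob_space.prob_space_distr[OF \<gamma>(1) measurable_init[OF \<gamma>(2)]] by (simp_all add: init_def)
  have kern_measurable: "kern \<gamma> i \<in> measurable (PiM {0..<i} (\<lambda>_. stepM)) (subprob_algebra stepM)" for i
    using init K_measurable
    by (cases i) (auto simp: kern_def[abs_def] histM_ivl space_subprob_algebra prob_space_imp_subprob_space intro!: measurable_const)
  have kern_prob: "prob_space (kern \<gamma> i x)" if "x \<in> space (PiM {0..<i} (\<lambda>_. stepM))" for i x
    using that init prob_space_K by (cases i) (auto simp: kern_def histM_ivl)
  interpret IT: Ionescu_Tulcea "kern \<gamma>" "\<lambda>_. stepM"
    using kern_measurable kern_prob by (rule Ionescu_Tulcea.intro)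
  let ?P = "IT.PF.lim"
  \<comment> \<open>The undefined function is the only history of length 0, so this is the law of
    the first n components.\<close>
  let ?C = "\<lambda>n. IT.C 0 n (\<lambda>_. undefined)"
  have sets_P: "sets ?P = sets trajM" by (simp add: trajM_def)
  have undef: "(\<lambda>_. undefined) \<in> space (PiM {0..<0::nat} (\<lambda>_. stepM :: (ennreal \<times> 's option) measure))" by (simp add: space_PiM)
  have sets_C: "sets (?C n) = sets (PiM {0..<n} (\<lambda>_. stepM))" for n using IT.sets_C[OF undef, of n] by simp
  have C: "distr ?P (PiM {0..<n} (\<lambda>_. stepM)) (\<lambda>\<omega>. restrict \<omega> {0..<n}) = ?C n" for n
  proof -
    \<comment> \<open>\<open>IT.CI\<close> gives the marginal on a general index set; on an initial
      segment the cylinder embedding is the identity, and the marginal is the iterated kernel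
      itself.\<close>
    have "IT.CI {0..<n} = ?C n"
    proof (rule measure_eqI)
      show "sets (IT.CI {0..<n}) = sets (?C n)" by (simp add: IT.CI_def sets_C)
      fix X assume "X \<in> sets (IT.CI {0..<n})"
      then have X: "X \<in> sets (PiM {0..<n} (\<lambda>_. stepM))" by (simp add: IT.CI_def)
      then show "emeasure (IT.CI {0..<n}) X = emeasure (?C n) X"
        using prod_emb_id[of X "{0..<n}" "\<lambda>_. stepM"] sets.sets_into_space[OF X]
        by (subst IT.emeasure_CI[OF order_refl X]) (simp_all add: space_PiM)
    qed
    then show ?thesis using IT.distr_lim[of "{0..<n}"] by simp
  qed
  have meas_r: "(\<lambda>\<omega>. restrict \<omega> {0..<n}) \<in> measurable ?P (PiM {0..<n} (\<lambda>_. stepM))" for n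
    using measurable_restrict_subset[of "{0..<n}" UNIV "\<lambda>_. stepM"] by (simp cong: measurable_cong_sets)
  have int_C: "(\<integral>\<^sup>+h. f h \<partial>?C n) = (\<integral>\<^sup>+\<omega>. f (restrict \<omega> {0..<n}) \<partial>?P)"
    if "f \<in> borel_measurable (PiM {0..<n} (\<lambda>_. stepM))" for f n
    unfolding C[symmetric] by (rule nn_integral_distr[OF meas_r]) (use that in simp)
  have int_Suc: "(\<integral>\<^sup>+h. f h \<partial>?C (Suc n)) = (\<integral>\<^sup>+h. \<integral>\<^sup>+z. f (h(n := z)) \<partial>kern \<gamma> n h \<partial>?C n)"
    if f: "f \<in> borel_measurable (PiM {0..<Suc n} (\<lambda>_. stepM))" for f n
  proof -
    have "(\<integral>\<^sup>+h. f h \<partial>?C (Suc n)) = (\<integral>\<^sup>+h. \<integral>\<^sup>+h'. f h' \<partial>IT.eP n h \<partial>?C n)"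
      using IT.measurable_eP[of n] f
      by (simp, subst nn_integral_bind[where B = "PiM {0..<Suc n} (\<lambda>_. stepM)"]) (simp_all cong: measurable_cong_sets add: measurable_cong_sets[OF sets_C refl])
    also have "\<dots> = (\<integral>\<^sup>+h. \<integral>\<^sup>+z. f (h(n := z)) \<partial>kern \<gamma> n h \<partial>?C n)"
      using sets_eq_imp_space_eq[OF sets_C[of n]] f by (intro nn_integral_cong IT.nn_integral_eP) auto
    finally show ?thesis .
  qed
  show thesis
  proof (rule that[of ?P])
    show "sets ?P = sets trajM" by (rule sets_P)
    have "prob_space (distr ?P (PiM {0..<0::nat} (\<lambda>_. stepM)) (\<lambda>\<omega>. restrict \<omega> {0..<0}))"
      unfolding C by (rule IT.prob_space_C[OF undef])
    then show "prob_space ?P" by (rule prob_space_distrD[OF meas_r])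
    show "step_law ?P" unfolding step_law_def
    proof (intro allI impI)
      fix n and f :: "'s traj \<Rightarrow> ennreal \<times> 's option \<Rightarrow> ennreal"
      assume f: "(\<lambda>(h, z). f h z) \<in> borel_measurable (histM n \<Otimes>\<^sub>M stepM)"
      define g where "g h = f (restrict h {..n}) (h (Suc n))" for h
      have g: "g \<in> borel_measurable (PiM {0..<Suc (Suc n)} (\<lambda>_. stepM))"
      proof -
        have "(\<lambda>h. (restrict h {..n}, h (Suc n))) \<in> measurable (PiM {0..<Suc (Suc n)} (\<lambda>_. stepM)) (histM n \<Otimes>\<^sub>M stepM)"
          unfolding histM_def by (intro measurable_Pair measurable_restrict_subset measurable_component_singleton) auto
        from measurable_compose[OF this f] show ?thesis by (simp add: g_def[abs_def])
      qed
      have "(\<integral>\<^sup>+\<omega>. f (restrict \<omega> {..n}) (\<omega> (Suc n)) \<partial>?P) = (\<integral>\<^sup>+\<omega>. g (restrict \<omega> {0..<Suc (Suc n)}) \<partial>?P)"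
        by (intro nn_integral_cong) (simp add: g_def Int_absorb1 subset_eq)
      also have "\<dots> = (\<integral>\<^sup>+h. g h \<partial>?C (Suc (Suc n)))" by (rule int_C[OF g, symmetric])
      also have "\<dots> = (\<integral>\<^sup>+h. \<integral>\<^sup>+z. g (h(Suc n := z)) \<partial>kern \<gamma> (Suc n) h \<partial>?C (Suc n))" by (rule int_Suc[OF g])
      also have "\<dots> = (\<integral>\<^sup>+h. step_integral n h (f h) \<partial>?C (Suc n))"
      proof (rule nn_integral_cong)
        fix h assume "h \<in> space (?C (Suc n))"
        then have h: "h \<in> space (histM n)" using sets_eq_imp_space_eq[OF sets_C[of "Suc n"]] by (simp add: histM_ivl)
        have "g (h(Suc n := z)) = f h z" for z
        proof -
          have "restrict (h(Suc n := z)) {..n} = h" using h by (auto simp: space_histM extensional_def restrict_def fun_eq_iff)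
          then show ?thesis by (simp add: g_def)
        qed
        then have "(\<integral>\<^sup>+z. g (h(Suc n := z)) \<partial>kern \<gamma> (Suc n) h) = (\<integral>\<^sup>+z. f h z \<partial>K n h)" by (simp add: kern_def)
        also have "\<dots> = step_integral n h (f h)"
          using measurable_Pair2[OF f h] by (intro nn_integral_K[OF h]) simp
        finally show "(\<integral>\<^sup>+z. g (h(Suc n := z)) \<partial>kern \<gamma> (Suc n) h) = step_integral n h (f h)" .
      qed
      also have "\<dots> = (\<integral>\<^sup>+\<omega>. step_integral n (restrict \<omega> {0..<Suc n}) (f (restrict \<omega> {0..<Suc n})) \<partial>?P)"
        using step_integral_measurable[OF f] by (intro int_C) (simp add: histM_ivl)
      finally show "(\<integral>\<^sup>+\<omega>. f (restrict \<omega> {..n}) (\<omega> (Suc n)) \<partial>?P) = (\<integral>\<^sup>+\<omega>. step_integral n \<omega> (f (restrict \<omega> {..n})) \<partial>?P)"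
        by (simp add: atLeast0LessThan lessThan_Suc_atMost)
    qed
    fix g :: "ennreal \<times> 's option \<Rightarrow> ennreal" assume g: "g \<in> borel_measurable stepM"
    have g': "(\<lambda>h. g (h 0)) \<in> borel_measurable (PiM {0..<Suc 0} (\<lambda>_. stepM))"
      using g by (rule measurable_compose[of "\<lambda>h. h 0" _ stepM, rotated]) (rule measurable_component_singleton, simp)
    have "(\<integral>\<^sup>+\<omega>. g (\<omega> 0) \<partial>?P) = (\<integral>\<^sup>+h. g (h 0) \<partial>?C (Suc 0))"
      by (subst int_C[OF g']) simp
    also have "\<dots> = (\<integral>\<^sup>+h. \<integral>\<^sup>+z. g z \<partial>init \<gamma> \<partial>?C 0)" using int_Suc[OF g'] by (simp add: kern_def)
    also have "\<dots> = (\<integral>\<^sup>+z. g z \<partial>init \<gamma>)"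
      using prob_space.emeasure_space_1[OF IT.prob_space_C[OF undef, of 0]] by simp
    also have "\<dots> = (\<integral>\<^sup>+x. g (0, Some x) \<partial>\<gamma>)"
      unfolding init_def using g by (intro nn_integral_distr[OF measurable_init[OF \<gamma>(2)]]) simp
    finally show "(\<integral>\<^sup>+\<omega>. g (\<omega> 0) \<partial>?P) = (\<integral>\<^sup>+x. g (0, Some x) \<partial>\<gamma>)" .
  qed
qed

end

section \<open>The step law is strategic\<close>

lemma sets_trajM_Omega:
  fixes S :: "'s::topological_space set"
  assumes [measurable]: "S \<in> sets borel"
  shows "Omega S \<in> sets trajM"
proof -
  have "{\<omega> \<in> space (trajM :: 's traj measure). fst (\<omega> 0) = 0 \<and> snd (\<omega> 0) \<in> Some ` S \<and>
     (\<forall>n\<ge>1. fst (\<omega> n) > 0 \<and>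
        (fst (\<omega> n) < \<top> \<longrightarrow> snd (\<omega> n) \<in> Some ` S) \<and>
        (fst (\<omega> n) = \<top> \<longrightarrow> snd (\<omega> n) \<in> {None} \<and> fst (\<omega> (Suc n)) = \<top>))} \<in> sets trajM"
    by measurable
  then show ?thesis by (simp add: Omega_def)
qed

context ctmdp_policy
begin

lemma step_lawD:
  assumes "step_law P" "(\<lambda>(h, z). f h z) \<in> borel_measurable (histM n \<Otimes>\<^sub>M stepM)"
  shows "(\<integral>\<^sup>+\<omega>. f (restrict \<omega> {..n}) (\<omega> (Suc n)) \<partial>P) = (\<integral>\<^sup>+\<omega>. step_integral n \<omega> (f (restrict \<omega> {..n})) \<partial>P)"
  using assms unfolding step_law_def by blast

lemma jump_outside_S: "jump n f h s = 0" if "snd (h n) \<notin> Some ` S"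
  using that by (cases "snd (h n)") (auto simp: jump_def rq_def inj_image_mem_iff)

text \<open>Jumps leave only states of S, use only actions of A and land only in S: elsewhere
  \<open>rq\<close> is 0, and the measure \<open>qtM\<close> lives on S. Hence f has to vanish at
  such targets only.\<close>

lemma jump_eq_0:
  assumes "\<And>x a y. snd (h n) = Some x \<Longrightarrow> x \<in> S \<Longrightarrow> a \<in> A \<Longrightarrow> y \<in> S \<Longrightarrow> f (ennreal s, Some y) = 0"
    and f: "f \<in> borel_measurable stepM"
  shows "jump n f h s = 0"
proof (cases "snd (h n) \<in> Some ` S")
  case True
  then obtain x where x: "snd (h n) = Some x" "x \<in> S" by auto
  have "rq (Some x) a * (\<integral>\<^sup>+y. f (ennreal s, y) \<partial>J (Some x) a) = 0" if "a \<in> A" for a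
  proof -
    have "(\<lambda>y. f (ennreal s, y)) \<in> borel_measurable optM" using f by (simp add: stepM_def)
    then have "rq (Some x) a * (\<integral>\<^sup>+y. f (ennreal s, y) \<partial>J (Some x) a) = (\<integral>\<^sup>+y. f (ennreal s, Some y) \<partial>qtM S q x a)"
      by (rule rq_times_nn_integral_J[OF x(2) that])
    also have "\<dots> = (\<integral>\<^sup>+y. 0 \<partial>qtM S q x a)" using assms(1)[OF x that] by (intro nn_integral_cong) auto
    finally show ?thesis by simp
  qed
  then have "jump n f h s = (\<integral>\<^sup>+a. 0 \<partial>act n h s)" unfolding jump_def x(1)
    by (intro nn_integral_cong) (auto simp: act_space(3))
  then show ?thesis by simp
qed (rule jump_outside_S)

text \<open>\<open>rq\<close> is set to 0 outside S and A, while \<open>qxO\<close> keeps the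
  arbitrary data there; this is why the current state is restricted. On \<open>Omega S\<close> the
  restriction always holds.\<close>

lemma survival_eq_hazard:
  assumes "snd (\<omega> n) \<in> insert None (Some ` S)"
  shows "ennreal (exp (- enn2real (hazard q pol n \<omega> t))) = survival (rate n \<omega>) t"
proof -
  have "hazard q pol n \<omega> t = cum_hazard (rate n \<omega>) t"
    unfolding hazard_def cum_hazard_def
  proof (rule nn_integral_cong)
    fix s :: real
    show "indicator {0<..t} s * (\<integral>\<^sup>+a. ennreal (qxO q (snd (\<omega> n)) a) \<partial>pol (Suc n) \<omega> s) = indicator {0<..t} s * rate n \<omega> s"
    proof (cases "0 < s")
      case True
      have "(\<integral>\<^sup>+a. ennreal (qxO q (snd (\<omega> n)) a) \<partial>act n \<omega> s) = rate n \<omega> s"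
        unfolding avg_def using assms
        by (intro nn_integral_cong) (auto simp: act_space(3) qxO_def rq_def split: option.split)
      then show ?thesis using True by (simp add: act_pos)
    qed simp
  qed
  then show ?thesis by (simp add: survival_def)
qed

lemma avg_measurable1:
  "(\<lambda>(xo, a). g xo a) \<in> borel_measurable (optM \<Otimes>\<^sub>M MA) \<Longrightarrow> avg g n \<omega> \<in> borel_measurable borel"
  using fixed_history_measurable[OF avg_measurable[of g n] restrict_in_space_histM[of \<omega> n]] by simp

lemma hazard_rate_traj: obtains Q where "hazard_rate (rate n \<omega>) Q"
  by (rule hazard_rate[of "restrict \<omega> {..n}" n]) (use that in simp_all)

lemma jump_time: "jump n (\<lambda>z. g (fst z)) h s = rate n h s * g (ennreal s)"
proof -
  have "(\<lambda>a. rq (snd (h n)) a) \<in> borel_measurable (act n h s)"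
    using jump_inner_measurable1(4)[of "\<lambda>_. 0" "restrict h {..n}" n s] by simp
  then show ?thesis unfolding jump_def avg_def
    using prob_space.emeasure_space_1[OF J_prob] by (simp add: nn_integral_multc)
qed

text \<open>Two versions, because \<open>is_strategic\<close> prescribes the probability of theta >=
  t while a cost at time s accrues if theta > s. They agree since a single finite time is a null set
  of the density, and the atom at infinity lies in both tails.\<close>

lemma step_integral_tail:
  assumes "0 \<le> t"
  shows "step_integral n \<omega> (\<lambda>z. indicator {ennreal t<..} (fst z)) = survival (rate n \<omega>) t"
    and "step_integral n \<omega> (\<lambda>z. indicator {ennreal t..} (fst z)) = survival (rate n \<omega>) t"
proof -
  obtain Q where "hazard_rate (rate n \<omega>) Q" using hazard_rate_traj .
  then interpret hazard_rate "rate n \<omega>" Q .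
  have ind: "indicator {0<..} s * (survival (rate n \<omega>) s * (rate n \<omega> s * indicator {ennreal t<..} (ennreal s))) =
     indicator {0<..} s * (survival (rate n \<omega>) s * (rate n \<omega> s * indicator {t<..} s))" for s
    using assms by (auto simp: ennreal_less_iff split: split_indicator)
  show *: "step_integral n \<omega> (\<lambda>z. indicator {ennreal t<..} (fst z)) = survival (rate n \<omega>) t"
    unfolding step_integral_def jump_time ind using tail_plus_atom[of t] by simp
  have "(\<integral>\<^sup>+s. indicator {0<..} s * (survival (rate n \<omega>) s * (rate n \<omega> s * indicator {ennreal t..} (ennreal s))) \<partial>lborel) =
    (\<integral>\<^sup>+s. indicator {0<..} s * (survival (rate n \<omega>) s * (rate n \<omega> s * indicator {ennreal t<..} (ennreal s))) \<partial>lborel)"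
    using AE_lborel_singleton[of t]
    by (intro nn_integral_cong_AE) (auto simp: ennreal_less_iff assms split: split_indicator)
  then show "step_integral n \<omega> (\<lambda>z. indicator {ennreal t..} (fst z)) = survival (rate n \<omega>) t"
    using * unfolding step_integral_def jump_time by simp
qed

lemma Omega_snd: "\<omega> \<in> Omega S \<Longrightarrow> snd (\<omega> n) \<in> insert None (Some ` S)"
  by (cases n) (auto simp: Omega_def less_top)

lemma measurable_trajM_sets_eq: "sets P = sets trajM \<Longrightarrow> f \<in> measurable trajM N \<Longrightarrow> f \<in> measurable P N"
  by (simp cong: measurable_cong_sets)

abbreviation qt_lift :: "'s set \<Rightarrow> 's option \<Rightarrow> 'a \<Rightarrow> ennreal" where
  "qt_lift \<Gamma> \<equiv> lift (\<lambda>x a. ennreal (qt q x a \<Gamma>))"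

text \<open>A version of \<open>jprob\<close> built from the totalised rates. It is measurable in
  history and time, and it agrees with \<open>jprob\<close> on \<open>Omega S\<close> at positive
  times.\<close>

definition jp :: "'s set \<Rightarrow> nat \<Rightarrow> 's traj \<Rightarrow> real \<Rightarrow> ennreal" where
  "jp \<Gamma> n h s = ennreal (enn2real (avg (qt_lift \<Gamma>) n h s) / enn2real (rate n h s))"

lemma jp_restrict [simp]: "jp \<Gamma> n (restrict \<omega> {..n}) = jp \<Gamma> n \<omega>"
  by (simp add: jp_def fun_eq_iff)

lemma jp_measurable:
  assumes "\<Gamma> \<in> sets borel" "\<Gamma> \<subseteq> S"
  shows "(\<lambda>(h, s). jp \<Gamma> n h s) \<in> borel_measurable (histM n \<Otimes>\<^sub>M borel)"
  using avg_measurable[OF lift_measurable[OF qt_measurable[OF assms]], of n] rate_measurable[of n]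
  unfolding jp_def case_prod_beta' by measurable

lemma jp_time_measurable:
  assumes "\<Gamma> \<in> sets borel" "\<Gamma> \<subseteq> S"
  shows "(\<lambda>p. jp \<Gamma> n (fst p) (enn2real (snd p))) \<in> borel_measurable (histM n \<Otimes>\<^sub>M borel)"
proof -
  have "(\<lambda>p. (fst p, enn2real (snd p))) \<in> measurable (histM n \<Otimes>\<^sub>M borel) (histM n \<Otimes>\<^sub>M borel)" by measurable
  from measurable_compose[OF this jp_measurable[OF assms, of n]] show ?thesis by simp
qed

lemma qt_le_qx: "x \<in> S \<Longrightarrow> a \<in> A \<Longrightarrow> \<Gamma> \<in> sets borel \<Longrightarrow> \<Gamma> \<subseteq> S \<Longrightarrow> ennreal (qt q x a \<Gamma>) \<le> ennreal (qx q x a)"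
  using emeasure_mono[of \<Gamma> S "qtM S q x a"]
  by (simp add: emeasure_qtM qt_S sets_restrict_space_iff)

text \<open>The numerator is at most the rate, and the rate is finite; so a vanishing rate forces a
  vanishing numerator, and the convention 0/0 = 0 is consistent.\<close>

lemma rate_times_jp:
  assumes "\<Gamma> \<in> sets borel" "\<Gamma> \<subseteq> S"
  shows "rate n h s * jp \<Gamma> n h s = avg (qt_lift \<Gamma>) n h s"
proof -
  have le: "avg (qt_lift \<Gamma>) n h s \<le> rate n h s"
    unfolding avg_def rq_def using qt_le_qx[OF _ _ assms]
    by (intro nn_integral_mono) (auto simp: act_space(3) lift_def split: option.split)
  obtain Q where Q: "rate n h s \<le> ennreal Q" using rate_bounded[of n h] by metis
  then have "rate n h s < \<top>" by (meson ennreal_less_top le_less_trans)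
  with le show ?thesis
    by (cases "rate n h s"; cases "avg (qt_lift \<Gamma>) n h s")
       (auto simp: jp_def top_unique simp flip: ennreal_mult)
qed

lemma jump_state:
  assumes \<Gamma>: "\<Gamma> \<in> sets borel" "\<Gamma> \<subseteq> S"
  shows "jump n (\<lambda>z. g (fst z) * indicator (Some ` \<Gamma>) (snd z)) h s = g (ennreal s) * avg (qt_lift \<Gamma>) n h s"
proof -
  have eq: "rq xo a * (\<integral>\<^sup>+y. g (ennreal s) * indicator (Some ` \<Gamma>) y \<partial>J xo a) = g (ennreal s) * qt_lift \<Gamma> xo a"
    if "a \<in> A" for xo a
  proof -
    have "rq xo a * emeasure (J xo a) (Some ` \<Gamma>) = qt_lift \<Gamma> xo a"
    proof (cases xo)
      case (Some x)
      show ?thesis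
      proof (cases "x \<in> S")
        case True
        have "Some -` Some ` \<Gamma> \<inter> S = \<Gamma>" using \<Gamma>(2) by auto
        then show ?thesis using rq_times_J[OF True that, of "Some ` \<Gamma>"] \<Gamma>(1) that True Some by simp
      qed (simp add: Some rq_def)
    qed (simp add: rq_def)
    then show ?thesis using \<Gamma>(1) by (simp add: nn_integral_cmult mult.left_commute)
  qed
  have m: "(\<lambda>a. qt_lift \<Gamma> (snd (h n)) a) \<in> borel_measurable (act n h s)"
    by (rule act_section_measurable[OF lift_measurable[OF qt_measurable[OF \<Gamma>]]])
  show ?thesis unfolding jump_def avg_def
    by (subst nn_integral_cmult[OF m, symmetric]) (auto intro!: nn_integral_cong simp: act_space(3) eq)
qed

lemma jp_eq_jprob:
  assumes "snd (\<omega> n) \<in> insert None (Some ` S)" "0 < s"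
  shows "ennreal (jprob q pol n \<omega> s \<Gamma>) = jp \<Gamma> n \<omega> s"
proof -
  have "(\<integral>\<^sup>+a. ennreal (qxO q (snd (\<omega> n)) a) \<partial>pol (Suc n) \<omega> s) = rate n \<omega> s"
    unfolding avg_def act_pos[OF assms(2), symmetric] using assms(1)
    by (intro nn_integral_cong) (auto simp: act_space(3) qxO_def rq_def split: option.split)
  moreover have "(\<integral>\<^sup>+a. ennreal (qtO q (snd (\<omega> n)) a \<Gamma>) \<partial>pol (Suc n) \<omega> s) = avg (qt_lift \<Gamma>) n \<omega> s"
    unfolding avg_def act_pos[OF assms(2), symmetric] using assms(1)
    by (intro nn_integral_cong) (auto simp: act_space(3) qtO_def split: option.split)
  ultimately show ?thesis by (simp add: jprob_def jp_def)
qed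

section \<open>Verification of the strategic conditions for a measure with the step law\<close>

context
  fixes P \<gamma>
  assumes P: "prob_space P" "sets P = sets trajM" "step_law P"
    and P0: "\<And>g. g \<in> borel_measurable stepM \<Longrightarrow> (\<integral>\<^sup>+\<omega>. g (\<omega> 0) \<partial>P) = (\<integral>\<^sup>+x. g (0, Some x) \<partial>\<gamma>)"
    and \<gamma>: "prob_space \<gamma>" "sets \<gamma> = sets (restrict_space borel S)"
begin

lemma space_P: "space P = UNIV"
  using sets_eq_imp_space_eq[OF P(2)] by simp

lemma space_\<gamma>: "space \<gamma> = S"
  using sets_eq_imp_space_eq[OF \<gamma>(2)] by (simp add: space_restrict_space)

lemma AE_init: "AE \<omega> in P. fst (\<omega> 0) = 0 \<and> snd (\<omega> 0) \<in> Some ` S"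
proof -
  note [measurable (raw)] = measurable_trajM_sets_eq[OF P(2)]
  let ?B = "{z :: ennreal \<times> 's option. \<not> (fst z = 0 \<and> snd z \<in> Some ` S)}"
  have "{z \<in> space stepM. \<not> (fst z = 0 \<and> snd z \<in> Some ` S)} \<in> sets (stepM :: (ennreal \<times> 's option) measure)" by measurable
  then have B: "?B \<in> sets stepM" by simp
  have m: "(\<lambda>\<omega>. indicator ?B (\<omega> 0) :: ennreal) \<in> borel_measurable P" using B by measurable
  have "(\<integral>\<^sup>+\<omega>. indicator ?B (\<omega> 0) \<partial>P) = (\<integral>\<^sup>+x. indicator ?B (0, Some x) \<partial>\<gamma>)" using B by (intro P0) simp
  also have "\<dots> = (\<integral>\<^sup>+x. 0 \<partial>\<gamma>)" by (intro nn_integral_cong) (auto simp: space_\<gamma>)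
  finally show ?thesis using m by (auto simp: nn_integral_0_iff_AE indicator_def elim: AE_mp split: if_splits)
qed

text \<open>The indicator of a violation has step integral 0 for every history: the density charges
  finite positive sojourns ending in S, the atom sits at \<open>(\<top>, None)\<close>, and from
  \<open>None\<close> all rates vanish.\<close>

lemma AE_step: "AE \<omega> in P. 0 < fst (\<omega> (Suc n)) \<and> (fst (\<omega> (Suc n)) < \<top> \<longrightarrow> snd (\<omega> (Suc n)) \<in> Some ` S) \<and>
    (fst (\<omega> (Suc n)) = \<top> \<longrightarrow> snd (\<omega> (Suc n)) = None) \<and> (snd (\<omega> n) = None \<longrightarrow> fst (\<omega> (Suc n)) = \<top>)"
proof -
  note [measurable (raw)] = measurable_trajM_sets_eq[OF P(2)]
  let ?ok = "\<lambda>h z. 0 < fst z \<and> (fst z < \<top> \<longrightarrow> snd z \<in> Some ` S) \<and>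
    (fst z = \<top> \<longrightarrow> snd z \<in> {None}) \<and> (snd (h n) \<in> {None} \<longrightarrow> fst z = \<top>)"
  let ?f = "\<lambda>(h :: 's traj) z. if ?ok h z then 0 else 1 :: ennreal"
  note [measurable] = measurable_component_histM[OF order_refl, of n]
  have f: "(\<lambda>(h, z). ?f h z) \<in> borel_measurable (histM n \<Otimes>\<^sub>M stepM)" by measurable
  have "(\<integral>\<^sup>+\<omega>. ?f (restrict \<omega> {..n}) (\<omega> (Suc n)) \<partial>P) = (\<integral>\<^sup>+\<omega>. step_integral n \<omega> (?f (restrict \<omega> {..n})) \<partial>P)"
    by (rule step_lawD[OF P(3) f])
  also have "\<dots> = (\<integral>\<^sup>+\<omega>. 0 \<partial>P)"
  proof (rule nn_integral_cong)
    fix \<omega> :: "'s traj"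
    have fm: "?f (restrict \<omega> {..n}) \<in> borel_measurable stepM"
      using measurable_Pair2[OF f, of "restrict \<omega> {..n}"] by simp
    have "jump n (?f (restrict \<omega> {..n})) \<omega> s = 0" if "0 < s" for s
      by (rule jump_eq_0[OF _ fm]) (use that in auto)
    then have "indicator {0<..} s * (survival (rate n \<omega>) s * jump n (?f (restrict \<omega> {..n})) \<omega> s) = 0" for s
      by (cases "0 < s") auto
    then show "step_integral n \<omega> (?f (restrict \<omega> {..n})) = 0"
      unfolding step_integral_def by (simp only: nn_integral_const) simp
  qed
  finally have "(\<integral>\<^sup>+\<omega>. ?f (restrict \<omega> {..n}) (\<omega> (Suc n)) \<partial>P) = 0" by simp
  moreover have "(\<lambda>\<omega>. ?f (restrict \<omega> {..n}) (\<omega> (Suc n))) \<in> borel_measurable P"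
    using measurable_compose[OF _ f, of "\<lambda>\<omega>. (restrict \<omega> {..n}, \<omega> (Suc n))" P] by simp
  ultimately have "AE \<omega> in P. ?f (restrict \<omega> {..n}) (\<omega> (Suc n)) = 0" by (simp add: nn_integral_0_iff_AE)
  then show ?thesis by eventually_elim (auto split: if_splits)
qed

lemma AE_Omega: "AE \<omega> in P. \<omega> \<in> Omega S"
proof -
  have "AE \<omega> in P. \<forall>n. 0 < fst (\<omega> (Suc n)) \<and> (fst (\<omega> (Suc n)) < \<top> \<longrightarrow> snd (\<omega> (Suc n)) \<in> Some ` S) \<and>
    (fst (\<omega> (Suc n)) = \<top> \<longrightarrow> snd (\<omega> (Suc n)) = None) \<and> (snd (\<omega> n) = None \<longrightarrow> fst (\<omega> (Suc n)) = \<top>)"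
    unfolding AE_all_countable using AE_step by blast
  with AE_init show ?thesis
  proof eventually_elim
    case (elim \<omega>)
    \<comment> \<open>Absorption couples neighbouring components: an infinite sojourn n leads to
      \<open>None\<close>, and from \<open>None\<close> the sojourn n + 1 is infinite. Hence the
      instances at n - 1 and at n.\<close>
    have "0 < fst (\<omega> n) \<and> (fst (\<omega> n) < \<top> \<longrightarrow> snd (\<omega> n) \<in> Some ` S) \<and>
        (fst (\<omega> n) = \<top> \<longrightarrow> snd (\<omega> n) = None \<and> fst (\<omega> (Suc n)) = \<top>)" if "1 \<le> n" for n
      using elim(2)[rule_format, of "n - 1"] elim(2)[rule_format, of n] that by simp
    with elim(1) show ?case by (simp add: Omega_def)
  qed
qed

lemma strategic_tail:
  assumes B: "B \<in> sets (histM n)" and t: "0 \<le> t"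
  shows "emeasure P {\<omega>\<in>space P. restrict \<omega> {..n} \<in> B \<and> ennreal t \<le> fst (\<omega> (Suc n))} =
        (\<integral>\<^sup>+ \<omega>. indicator B (restrict \<omega> {..n}) * ennreal (exp (- enn2real (hazard q pol n \<omega> t))) \<partial>P)"
proof -
  note [measurable (raw)] = measurable_trajM_sets_eq[OF P(2)]
  let ?f = "\<lambda>h z. indicator B h * indicator {ennreal t..} (fst z) :: ennreal"
  note [measurable] = B
  have f: "(\<lambda>(h, z). ?f h z) \<in> borel_measurable (histM n \<Otimes>\<^sub>M stepM)" by measurable
  have m: "{\<omega>\<in>space P. restrict \<omega> {..n} \<in> B \<and> ennreal t \<le> fst (\<omega> (Suc n))} \<in> sets P" by measurable
  have "emeasure P {\<omega>\<in>space P. restrict \<omega> {..n} \<in> B \<and> ennreal t \<le> fst (\<omega> (Suc n))} =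
    (\<integral>\<^sup>+\<omega>. ?f (restrict \<omega> {..n}) (\<omega> (Suc n)) \<partial>P)"
    by (subst nn_integral_indicator[OF m, symmetric]) (auto intro!: nn_integral_cong simp: space_P split: split_indicator)
  also have "\<dots> = (\<integral>\<^sup>+\<omega>. step_integral n \<omega> (?f (restrict \<omega> {..n})) \<partial>P)" by (rule step_lawD[OF P(3) f])
  also have "\<dots> = (\<integral>\<^sup>+ \<omega>. indicator B (restrict \<omega> {..n}) * ennreal (exp (- enn2real (hazard q pol n \<omega> t))) \<partial>P)"
  proof (rule nn_integral_cong_AE)
    show "AE \<omega> in P. step_integral n \<omega> (?f (restrict \<omega> {..n})) =
        indicator B (restrict \<omega> {..n}) * ennreal (exp (- enn2real (hazard q pol n \<omega> t)))"
      using AE_Omega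
    proof eventually_elim
      case (elim \<omega>)
      have "step_integral n (restrict \<omega> {..n}) (?f (restrict \<omega> {..n})) =
          indicator B (restrict \<omega> {..n}) * step_integral n (restrict \<omega> {..n}) (\<lambda>z. indicator {ennreal t..} (fst z))"
        by (rule step_integral_cmult) simp_all
      then show ?case using step_integral_tail(2)[OF t] survival_eq_hazard[OF Omega_snd[OF elim]] by simp
    qed
  qed
  finally show ?thesis .
qed

text \<open>The indicator of the next state lying in \<open>\<Gamma>\<close> and the function
  \<open>jp\<close> of the sojourn have equal step integrals, because rate times \<open>jp\<close>
  is the averaged q~(\<open>\<Gamma>\<close>). The step law is applied once in each direction, and
  \<open>jp\<close> becomes \<open>jprob\<close> almost surely.\<close>

lemma strategic_jump:
  assumes D: "D \<in> sets (histM n \<Otimes>\<^sub>M (borel :: ennreal measure))" and \<Gamma>: "\<Gamma> \<in> sets borel" "\<Gamma> \<subseteq> S"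
  shows "emeasure P {\<omega>\<in>space P. (restrict \<omega> {..n}, fst (\<omega> (Suc n))) \<in> D \<and> fst (\<omega> (Suc n)) < \<top> \<and>
                                 snd (\<omega> (Suc n)) \<in> Some ` \<Gamma>} =
        (\<integral>\<^sup>+ \<omega>. indicator D (restrict \<omega> {..n}, fst (\<omega> (Suc n))) * indicator {..<\<top>} (fst (\<omega> (Suc n))) *
                  ennreal (jprob q pol n \<omega> (enn2real (fst (\<omega> (Suc n)))) \<Gamma>) \<partial>P)"
proof -
  note [measurable (raw)] = measurable_trajM_sets_eq[OF P(2)]
  note [measurable] = D \<Gamma>(1)
  define g where "g h t = (indicator D (h, t) * indicator {..<\<top>} t :: ennreal)" for h t
  have g [measurable]: "(\<lambda>(h, z). g h (fst z)) \<in> borel_measurable (histM n \<Otimes>\<^sub>M stepM)"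
    unfolding g_def by measurable
  have f1: "(\<lambda>(h, z). g h (fst z) * indicator (Some ` \<Gamma>) (snd z)) \<in> borel_measurable (histM n \<Otimes>\<^sub>M stepM)"
    using g unfolding case_prod_beta' by measurable
  have f2: "(\<lambda>(h, z). g h (fst z) * jp \<Gamma> n h (enn2real (fst z))) \<in> borel_measurable (histM n \<Otimes>\<^sub>M stepM)"
  proof -
    have "(\<lambda>p. (fst p, enn2real (fst (snd p)))) \<in> measurable (histM n \<Otimes>\<^sub>M stepM) (histM n \<Otimes>\<^sub>M borel)" by measurable
    from measurable_compose[OF this jp_measurable[OF \<Gamma>]]
    show ?thesis using g unfolding case_prod_beta' by (intro borel_measurable_times_ennreal) auto
  qed
  have m: "{\<omega>\<in>space P. (restrict \<omega> {..n}, fst (\<omega> (Suc n))) \<in> D \<and> fst (\<omega> (Suc n)) < \<top> \<and>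
                                 snd (\<omega> (Suc n)) \<in> Some ` \<Gamma>} \<in> sets P" by measurable
  have "emeasure P {\<omega>\<in>space P. (restrict \<omega> {..n}, fst (\<omega> (Suc n))) \<in> D \<and> fst (\<omega> (Suc n)) < \<top> \<and>
                                 snd (\<omega> (Suc n)) \<in> Some ` \<Gamma>} =
     (\<integral>\<^sup>+\<omega>. g (restrict \<omega> {..n}) (fst (\<omega> (Suc n))) * indicator (Some ` \<Gamma>) (snd (\<omega> (Suc n))) \<partial>P)"
    by (subst nn_integral_indicator[OF m, symmetric])
       (auto intro!: nn_integral_cong simp: space_P g_def split: split_indicator)
  also have "\<dots> = (\<integral>\<^sup>+\<omega>. step_integral n \<omega> (\<lambda>z. g (restrict \<omega> {..n}) (fst z) * indicator (Some ` \<Gamma>) (snd z)) \<partial>P)"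
    by (rule step_lawD[OF P(3) f1])
  also have "\<dots> = (\<integral>\<^sup>+\<omega>. step_integral n \<omega> (\<lambda>z. g (restrict \<omega> {..n}) (fst z) * jp \<Gamma> n (restrict \<omega> {..n}) (enn2real (fst z))) \<partial>P)"
  proof (rule nn_integral_cong)
    fix \<omega> :: "'s traj"
    have "indicator {0<..} s * (survival (rate n \<omega>) s * (g (restrict \<omega> {..n}) (ennreal s) * avg (qt_lift \<Gamma>) n \<omega> s)) =
      indicator {0<..} s * (survival (rate n \<omega>) s * (rate n \<omega> s * (g (restrict \<omega> {..n}) (ennreal s) * jp \<Gamma> n \<omega> (enn2real (ennreal s)))))" for s
      by (cases "0 < s") (simp_all add: rate_times_jp[OF \<Gamma>, symmetric] mult_ac)
    then show "step_integral n \<omega> (\<lambda>z. g (restrict \<omega> {..n}) (fst z) * indicator (Some ` \<Gamma>) (snd z)) =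
      step_integral n \<omega> (\<lambda>z. g (restrict \<omega> {..n}) (fst z) * jp \<Gamma> n (restrict \<omega> {..n}) (enn2real (fst z)))"
      unfolding step_integral_def jump_state[OF \<Gamma>] jp_restrict
        jump_time[where g = "\<lambda>t. g (restrict \<omega> {..n}) t * jp \<Gamma> n \<omega> (enn2real t)"]
      by (simp add: g_def)
  qed
  also have "\<dots> = (\<integral>\<^sup>+\<omega>. g (restrict \<omega> {..n}) (fst (\<omega> (Suc n))) * jp \<Gamma> n (restrict \<omega> {..n}) (enn2real (fst (\<omega> (Suc n)))) \<partial>P)"
    by (rule step_lawD[OF P(3) f2, symmetric])
  also have "\<dots> = (\<integral>\<^sup>+ \<omega>. indicator D (restrict \<omega> {..n}, fst (\<omega> (Suc n))) * indicator {..<\<top>} (fst (\<omega> (Suc n))) *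
                  ennreal (jprob q pol n \<omega> (enn2real (fst (\<omega> (Suc n)))) \<Gamma>) \<partial>P)"
  proof (rule nn_integral_cong_AE)
    show "AE \<omega> in P. g (restrict \<omega> {..n}) (fst (\<omega> (Suc n))) * jp \<Gamma> n (restrict \<omega> {..n}) (enn2real (fst (\<omega> (Suc n)))) =
        indicator D (restrict \<omega> {..n}, fst (\<omega> (Suc n))) * indicator {..<\<top>} (fst (\<omega> (Suc n))) *
                  ennreal (jprob q pol n \<omega> (enn2real (fst (\<omega> (Suc n)))) \<Gamma>)"
      using AE_Omega
    proof eventually_elim
      case (elim \<omega>)
      show ?case
      proof (cases "fst (\<omega> (Suc n)) < \<top>")
        case True
        have "0 < fst (\<omega> (Suc n))" using elim by (auto simp: Omega_def)
        with True have "0 < enn2real (fst (\<omega> (Suc n)))" by (simp add: enn2real_positive_iff)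
        then show ?thesis using jp_eq_jprob[OF Omega_snd[OF elim]] by (simp add: g_def)
      qed (simp add: g_def)
    qed
  qed
  finally show ?thesis .
qed

lemma is_strategic_step_law: "is_strategic S q \<gamma> pol P"
  unfolding is_strategic_def
proof (intro conjI allI ballI impI)
  show "emeasure P (Omega S) = 1"
    using sets_trajM_Omega[OF S_borel] AE_Omega P(2) by (intro prob_space.emeasure_eq_1_AE[OF P(1)]) auto
next
  fix \<Gamma> :: "'s set" assume \<Gamma>: "\<Gamma> \<in> sets borel" "\<Gamma> \<subseteq> S"
  note [measurable (raw)] = measurable_trajM_sets_eq[OF P(2)]
  note [measurable] = \<Gamma>(1)
  have m: "{\<omega>\<in>space P. snd (\<omega> 0) \<in> Some ` \<Gamma>} \<in> sets P" by measurable
  have "emeasure P {\<omega>\<in>space P. snd (\<omega> 0) \<in> Some ` \<Gamma>} = (\<integral>\<^sup>+\<omega>. indicator (Some ` \<Gamma>) (snd (\<omega> 0)) \<partial>P)"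
    by (subst nn_integral_indicator[OF m, symmetric])
       (auto intro!: nn_integral_cong simp: space_P split: split_indicator)
  also have "\<dots> = (\<integral>\<^sup>+x. indicator (Some ` \<Gamma>) (snd (0 :: ennreal, Some x)) \<partial>\<gamma>)" by (rule P0) measurable
  also have "\<dots> = (\<integral>\<^sup>+x. indicator \<Gamma> x \<partial>\<gamma>)" by (intro nn_integral_cong) (auto split: split_indicator)
  also have "\<dots> = emeasure \<gamma> \<Gamma>" using \<Gamma> \<gamma>(2) by (simp add: sets_restrict_space_iff)
  finally show "emeasure P {\<omega>\<in>space P. snd (\<omega> 0) \<in> Some ` \<Gamma>} = emeasure \<gamma> \<Gamma>" .
qed (fact P strategic_tail strategic_jump)+

end

end

section \<open>Uniqueness of the strategic measure\<close>

text \<open>Sojourn laws are prescribed through P(theta >= t), so uniqueness needs the closed upper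
  rays as generator.\<close>

lemma sets_borel_atLeast:
  "sets (borel :: 'a::{linorder_topology, second_countable_topology} measure) = sigma_sets UNIV (range atLeast)"
proof -
  have "sets (borel :: 'a measure) = sigma_sets UNIV (range lessThan)" by (subst borel_Iio) simp
  also have "\<dots> = sigma_sets UNIV (range atLeast)"
  proof (rule sigma_sets_eqI)
    fix X :: "'a set" assume "X \<in> range lessThan"
    then obtain t where X: "X = {..<t}" by blast
    have "UNIV - {t..} \<in> sigma_sets UNIV (range atLeast)" by (intro sigma_sets.Compl sigma_sets.Basic rangeI)
    also have "UNIV - {t..} = X" unfolding X by auto
    finally show "X \<in> sigma_sets UNIV (range atLeast)" .
  next
    fix X :: "'a set" assume "X \<in> range atLeast"
    then obtain t where X: "X = {t..}" by blast
    have "UNIV - {..<t} \<in> sigma_sets UNIV (range lessThan)" by (intro sigma_sets.Compl sigma_sets.Basic rangeI)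
    also have "UNIV - {..<t} = X" unfolding X by auto
    finally show "X \<in> sigma_sets UNIV (range lessThan)" .
  qed
  finally show ?thesis .
qed

context ctmdp_policy
begin

lemma strategicD:
  assumes "is_strategic S q \<gamma> pol P"
  shows "prob_space P" "sets P = sets trajM" "AE \<omega> in P. \<omega> \<in> Omega S"
    "\<And>\<Gamma>. \<Gamma> \<in> sets borel \<Longrightarrow> \<Gamma> \<subseteq> S \<Longrightarrow> emeasure P {\<omega>\<in>space P. snd (\<omega> 0) \<in> Some ` \<Gamma>} = emeasure \<gamma> \<Gamma>"
    "\<And>n B t. B \<in> sets (histM n) \<Longrightarrow> 0 \<le> t \<Longrightarrow>
      emeasure P {\<omega>\<in>space P. restrict \<omega> {..n} \<in> B \<and> ennreal t \<le> fst (\<omega> (Suc n))} =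
        (\<integral>\<^sup>+ \<omega>. indicator B (restrict \<omega> {..n}) * ennreal (exp (- enn2real (hazard q pol n \<omega> t))) \<partial>P)"
    "\<And>n D \<Gamma>. D \<in> sets (histM n \<Otimes>\<^sub>M (borel :: ennreal measure)) \<Longrightarrow> \<Gamma> \<in> sets borel \<Longrightarrow> \<Gamma> \<subseteq> S \<Longrightarrow>
      emeasure P {\<omega>\<in>space P. (restrict \<omega> {..n}, fst (\<omega> (Suc n))) \<in> D \<and> fst (\<omega> (Suc n)) < \<top> \<and>
                                 snd (\<omega> (Suc n)) \<in> Some ` \<Gamma>} =
        (\<integral>\<^sup>+ \<omega>. indicator D (restrict \<omega> {..n}, fst (\<omega> (Suc n))) * indicator {..<\<top>} (fst (\<omega> (Suc n))) *
                  ennreal (jprob q pol n \<omega> (enn2real (fst (\<omega> (Suc n)))) \<Gamma>) \<partial>P)"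
proof -
  show P: "prob_space P" "sets P = sets trajM" using assms by (simp_all add: is_strategic_def)
  have "emeasure P (Omega S) = 1" using assms by (simp add: is_strategic_def)
  then show "AE \<omega> in P. \<omega> \<in> Omega S"
    using sets_trajM_Omega[OF S_borel] P(2)
    by (intro prob_space.AE_prob_1[OF P(1)]) (simp add: measure_def)
qed (use assms in \<open>unfold is_strategic_def, blast+\<close>)

text \<open>Induction on the length of the history. Its law determines the joint law with the next
  sojourn through the tails, which in turn determines the joint law with the next state through the
  jump probabilities. Histories of all lengths determine all finite cylinders, hence the
  measure.\<close>

lemma strategic_unique:
  assumes P: "is_strategic S q \<gamma> pol P" and P': "is_strategic S q \<gamma> pol P'"
  shows "P = P'"
proof -
  note D = strategicD[OF P] and D' = strategicD[OF P']
  interpret P: prob_space P by (rule D)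
  interpret P': prob_space P' by (rule D')
  note [measurable (raw)] = measurable_trajM_sets_eq[OF D(2)] measurable_trajM_sets_eq[OF D'(2)]
  have space: "space P = UNIV" "space P' = UNIV"
    using sets_eq_imp_space_eq[OF D(2)] sets_eq_imp_space_eq[OF D'(2)] by simp_all
  have int: "(\<integral>\<^sup>+\<omega>. f (X \<omega>) \<partial>P) = (\<integral>\<^sup>+\<omega>. f (X \<omega>) \<partial>P')"
    if "distr P M X = distr P' M X" "X \<in> measurable trajM M" "f \<in> borel_measurable M" for f M and X :: "'s traj \<Rightarrow> 'x"
    using nn_integral_distr[of X P M f] nn_integral_distr[of X P' M f] that
      measurable_trajM_sets_eq[OF D(2) that(2)] measurable_trajM_sets_eq[OF D'(2) that(2)] by simp
  have rect: "distr P (M \<Otimes>\<^sub>M N) (\<lambda>\<omega>. (X \<omega>, Y \<omega>)) = distr P' (M \<Otimes>\<^sub>M N) (\<lambda>\<omega>. (X \<omega>, Y \<omega>))"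
    if [measurable]: "X \<in> measurable trajM M" "Y \<in> measurable trajM N"
      and eq: "\<And>B C. B \<in> sets M \<Longrightarrow> C \<in> sets N \<Longrightarrow>
        emeasure P {\<omega>\<in>space P. X \<omega> \<in> B \<and> Y \<omega> \<in> C} = emeasure P' {\<omega>\<in>space P'. X \<omega> \<in> B \<and> Y \<omega> \<in> C}"
    for M :: "'x measure" and N :: "'y measure" and X Y
  proof (rule measure_eqI_generator_eq[OF Int_stable_pair_measure_generator[of M N] pair_measure_closed[of M N]])
    fix Z assume "Z \<in> {B \<times> C | B C. B \<in> sets M \<and> C \<in> sets N}"
    then obtain B C where Z: "Z = B \<times> C" and [measurable]: "B \<in> sets M" "C \<in> sets N" by auto
    show "emeasure (distr P (M \<Otimes>\<^sub>M N) (\<lambda>\<omega>. (X \<omega>, Y \<omega>))) Z = emeasure (distr P' (M \<Otimes>\<^sub>M N) (\<lambda>\<omega>. (X \<omega>, Y \<omega>))) Z"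
      using eq[of B C] unfolding Z by (subst (1 2) emeasure_distr) (simp_all add: vimage_def Int_def conj_ac)
  next
    show "range (\<lambda>_::nat. space M \<times> space N) \<subseteq> {B \<times> C | B C. B \<in> sets M \<and> C \<in> sets N}" by auto
    show "emeasure (distr P (M \<Otimes>\<^sub>M N) (\<lambda>\<omega>. (X \<omega>, Y \<omega>))) (space M \<times> space N) \<noteq> \<infinity>" for i :: nat
      using P.prob_space_distr[of "\<lambda>\<omega>. (X \<omega>, Y \<omega>)" "M \<Otimes>\<^sub>M N"]
      by (simp add: prob_space.emeasure_space_1[of "distr _ (M \<Otimes>\<^sub>M N) _", simplified space_distr space_pair_measure])
  qed (simp_all add: sets_pair_measure)
  have hist: "distr P (histM n) (\<lambda>\<omega>. restrict \<omega> {..n}) = distr P' (histM n) (\<lambda>\<omega>. restrict \<omega> {..n})" for n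
  proof (induction n)
    case 0
    show ?case
    proof (rule measure_eqI)
      fix B assume "B \<in> sets (distr P (histM 0) (\<lambda>\<omega>. restrict \<omega> {..0}))"
      then have B [measurable]: "B \<in> sets (histM 0)" by simp
      \<comment> \<open>On \<open>Omega S\<close> component 0 equals \<open>(0, Some x)\<close> with
        x in S, so an event on the shortest history is an event on x.\<close>
      define \<Gamma> where "\<Gamma> = {x\<in>S. restrict (\<lambda>_. (0, Some x)) {..0} \<in> B}"
      have "(\<lambda>x. restrict (\<lambda>_. (0, Some x)) {..0}) \<in> measurable borel (histM 0)"
        unfolding histM_def stepM_def by (intro measurable_restrict) measurable
      from measurable_sets[OF this B] have "\<Gamma> \<in> sets borel"
        unfolding \<Gamma>_def by (auto simp: vimage_def Collect_conj_eq)
      then have \<Gamma>: "\<Gamma> \<in> sets borel" "\<Gamma> \<subseteq> S" by (auto simp: \<Gamma>_def)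
      have "emeasure R {\<omega>. restrict \<omega> {..0} \<in> B} = emeasure R {\<omega>\<in>space R. snd (\<omega> 0) \<in> Some ` \<Gamma>}"
        if R: "AE \<omega> in R. \<omega> \<in> Omega S" "sets R = sets trajM" for R
      proof (rule emeasure_eq_AE)
        note [measurable (raw)] = measurable_trajM_sets_eq[OF R(2)]
        note [measurable] = \<Gamma>(1)
        have sp: "space R = UNIV" using sets_eq_imp_space_eq[OF R(2)] by simp
        have "{\<omega>\<in>space R. restrict \<omega> {..0} \<in> B} \<in> sets R" by measurable
        then show "{\<omega>. restrict \<omega> {..0} \<in> B} \<in> sets R" by (simp add: sp)
        show "{\<omega>\<in>space R. snd (\<omega> 0) \<in> Some ` \<Gamma>} \<in> sets R" by measurable
        show "AE \<omega> in R. (\<omega> \<in> {\<omega>. restrict \<omega> {..0} \<in> B}) = (\<omega> \<in> {\<omega>\<in>space R. snd (\<omega> 0) \<in> Some ` \<Gamma>})"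
          using R(1)
        proof eventually_elim
          case (elim \<omega>)
          then obtain x where x: "x \<in> S" "\<omega> 0 = (0, Some x)" by (auto simp: Omega_def prod_eq_iff)
          have "restrict \<omega> {..0} = restrict (\<lambda>_. (0, Some x)) {..0}" using x by (auto simp: restrict_def)
          then show ?case using x by (auto simp: \<Gamma>_def sp)
        qed
      qed
      from this[OF D(3,2)] this[OF D'(3,2)] D(4)[OF \<Gamma>] D'(4)[OF \<Gamma>]
      show "emeasure (distr P (histM 0) (\<lambda>\<omega>. restrict \<omega> {..0})) B = emeasure (distr P' (histM 0) (\<lambda>\<omega>. restrict \<omega> {..0})) B"
        using B measurable_trajM_sets_eq[OF D(2) measurable_restrict_trajM[of 0]]
          measurable_trajM_sets_eq[OF D'(2) measurable_restrict_trajM[of 0]]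
        by (subst (1 2) emeasure_distr) (simp_all add: space vimage_def del: atMost_0)
    qed simp
  next
    case (Suc n)
    have tail: "emeasure P {\<omega>\<in>space P. restrict \<omega> {..n} \<in> B \<and> ennreal t \<le> fst (\<omega> (Suc n))} =
        emeasure P' {\<omega>\<in>space P'. restrict \<omega> {..n} \<in> B \<and> ennreal t \<le> fst (\<omega> (Suc n))}"
      if B [measurable]: "B \<in> sets (histM n)" and t: "0 \<le> t" for B t
    proof -
      \<comment> \<open>The hazard is replaced by the survival function of the totalised rate: it is
        measurable in the history and agrees almost surely, so equality of the history laws can be
        applied to it.\<close>
      have m: "(\<lambda>h. indicator B h * survival (rate n h) t) \<in> borel_measurable (histM n)"
      proof -
        have "(\<lambda>h. (h, t)) \<in> measurable (histM n) (histM n \<Otimes>\<^sub>M borel)" by measurable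
        from measurable_compose[OF this survival_measurable[of n]]
        have [measurable]: "(\<lambda>h. survival (rate n h) t) \<in> borel_measurable (histM n)" by simp
        show ?thesis by measurable
      qed
      have "emeasure R {\<omega>\<in>space R. restrict \<omega> {..n} \<in> B \<and> ennreal t \<le> fst (\<omega> (Suc n))} =
          (\<integral>\<^sup>+\<omega>. indicator B (restrict \<omega> {..n}) * survival (rate n (restrict \<omega> {..n})) t \<partial>R)"
        if R: "is_strategic S q \<gamma> pol R" for R
        unfolding strategicD(5)[OF R B t]
      proof (rule nn_integral_cong_AE)
        show "AE \<omega> in R. indicator B (restrict \<omega> {..n}) * ennreal (exp (- enn2real (hazard q pol n \<omega> t))) =
            indicator B (restrict \<omega> {..n}) * survival (rate n (restrict \<omega> {..n})) t"
          using strategicD(3)[OF R] by eventually_elim (simp add: survival_eq_hazard[OF Omega_snd])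
      qed
      from this[OF P] this[OF P'] int[OF Suc measurable_restrict_trajM m] show ?thesis by simp
    qed
    \<comment> \<open>Tails are prescribed at real times only; the tail at infinity is their limit
      along the integers, by continuity from above.\<close>
    have tail_top: "emeasure P {\<omega>\<in>space P. restrict \<omega> {..n} \<in> B \<and> t \<le> fst (\<omega> (Suc n))} =
        emeasure P' {\<omega>\<in>space P'. restrict \<omega> {..n} \<in> B \<and> t \<le> fst (\<omega> (Suc n))}"
      if B [measurable]: "B \<in> sets (histM n)" for B t
    proof (cases t)
      case (real r) then show ?thesis using tail[OF B] by simp
    next
      case top
      have "emeasure R {\<omega>\<in>space R. restrict \<omega> {..n} \<in> B \<and> \<top> \<le> fst (\<omega> (Suc n))} =
        (INF i::nat. emeasure R {\<omega>\<in>space R. restrict \<omega> {..n} \<in> B \<and> ennreal (real i) \<le> fst (\<omega> (Suc n))})"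
        if R: "prob_space R" "sets R = sets trajM" for R
      proof -
        note [measurable (raw)] = measurable_trajM_sets_eq[OF R(2)]
        interpret prob_space R by (rule R)
        let ?E = "\<lambda>i::nat. {\<omega>\<in>space R. restrict \<omega> {..n} \<in> B \<and> ennreal (real i) \<le> fst (\<omega> (Suc n))}"
        have "range ?E \<subseteq> sets R" by (safe, measurable)
        moreover have "decseq ?E"
        proof (rule decseq_SucI)
          fix i
          have "ennreal (real i) \<le> ennreal (real (Suc i))" by (rule ennreal_leI) simp
          from order_trans[OF this] show "?E (Suc i) \<subseteq> ?E i" by blast
        qed
        ultimately have "(INF i. emeasure R (?E i)) = emeasure R (\<Inter>i. ?E i)"
          by (intro INF_emeasure_decseq) auto
        also have "(\<Inter>i. ?E i) = {\<omega>\<in>space R. restrict \<omega> {..n} \<in> B \<and> \<top> \<le> fst (\<omega> (Suc n))}"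
        proof -
          have "\<top> \<le> u \<longleftrightarrow> (\<forall>i::nat. ennreal (real i) \<le> u)" for u :: ennreal
          proof
            assume "\<forall>i::nat. ennreal (real i) \<le> u"
            then have "(SUP i::nat. of_nat i) \<le> u" by (intro SUP_least) (simp add: ennreal_of_nat_eq_real_of_nat)
            then show "\<top> \<le> u" by (simp add: ennreal_SUP_of_nat_eq_top)
          qed (simp add: top_unique)
          then show ?thesis by auto
        qed
        finally show ?thesis by (rule sym)
      qed
      from this[OF D(1,2)] this[OF D'(1,2)] show ?thesis using tail[OF B] top by simp
    qed
    have time: "distr P (histM n \<Otimes>\<^sub>M borel) (\<lambda>\<omega>. (restrict \<omega> {..n}, fst (\<omega> (Suc n)))) =
        distr P' (histM n \<Otimes>\<^sub>M borel) (\<lambda>\<omega>. (restrict \<omega> {..n}, fst (\<omega> (Suc n))))"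
    proof (rule rect)
      fix B :: "'s traj set" and C :: "ennreal set" assume B [measurable]: "B \<in> sets (histM n)" and C: "C \<in> sets borel"
      define E where "E = {\<omega> :: 's traj. restrict \<omega> {..n} \<in> B}"
      have "{\<omega>\<in>space (trajM :: 's traj measure). restrict \<omega> {..n} \<in> B} \<in> sets trajM" by measurable
      then have E: "E \<in> sets P" "E \<in> sets P'" using D(2) D'(2) by (simp_all add: E_def)
      have em: "emeasure (distr (restrict_space R E) borel (\<lambda>\<omega>. fst (\<omega> (Suc n)))) C =
          emeasure R {\<omega>\<in>space R. restrict \<omega> {..n} \<in> B \<and> fst (\<omega> (Suc n)) \<in> C}"
        if "E \<in> sets R" "sets R = sets trajM" "C \<in> sets borel" for R C
      proof -
        have sp: "space R = UNIV" using sets_eq_imp_space_eq[OF that(2)] by simp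
        have "(\<lambda>\<omega>. fst (\<omega> (Suc n))) \<in> measurable (restrict_space R E) borel"
          using measurable_compose[OF measurable_component_trajM measurable_fst_stepM]
          by (intro measurable_restrict_space1 measurable_trajM_sets_eq[OF that(2)])
        then have "emeasure (distr (restrict_space R E) borel (\<lambda>\<omega>. fst (\<omega> (Suc n)))) C =
          emeasure (restrict_space R E) ((\<lambda>\<omega>. fst (\<omega> (Suc n))) -` C \<inter> E)"
          using that(3) by (subst emeasure_distr) (simp_all add: space_restrict_space sp)
        also have "\<dots> = emeasure R ((\<lambda>\<omega>. fst (\<omega> (Suc n))) -` C \<inter> E)"
          using that(1) by (intro emeasure_restrict_space) auto
        finally show ?thesis by (simp add: E_def sp vimage_def Int_def conj_commute)
      qed
      have "distr (restrict_space P E) borel (\<lambda>\<omega>. fst (\<omega> (Suc n))) = distr (restrict_space P' E) borel (\<lambda>\<omega>. fst (\<omega> (Suc n)))"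
      proof (rule measure_eqI_generator_eq[where E = "range (\<lambda>t::ennreal. {t..})" and \<Omega> = UNIV and A = "\<lambda>_. {0..}"])
        show "Int_stable (range (\<lambda>t::ennreal. {t..}))"
        proof -
          have "{s..} \<inter> {t..} = {max s t..}" for s t :: ennreal by auto
          then show ?thesis by (auto simp: Int_stable_def)
        qed
        show "emeasure (distr (restrict_space P E) borel (\<lambda>\<omega>. fst (\<omega> (Suc n)))) X =
            emeasure (distr (restrict_space P' E) borel (\<lambda>\<omega>. fst (\<omega> (Suc n)))) X" if "X \<in> range (\<lambda>t::ennreal. {t..})" for X
          using that E D(2) D'(2) tail_top[OF B] by (auto simp: em)
        show "sets (distr (restrict_space P E) borel (\<lambda>\<omega>. fst (\<omega> (Suc n)))) = sigma_sets UNIV (range (\<lambda>t::ennreal. {t..}))"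
          "sets (distr (restrict_space P' E) borel (\<lambda>\<omega>. fst (\<omega> (Suc n)))) = sigma_sets UNIV (range (\<lambda>t::ennreal. {t..}))"
          by (simp_all add: sets_borel_atLeast)
        show "emeasure (distr (restrict_space P E) borel (\<lambda>\<omega>. fst (\<omega> (Suc n)))) {0..} \<noteq> \<infinity>" for i :: nat
          using E D(2) by (simp add: em P.emeasure_finite)
      qed auto
      with em[OF E(1) D(2) C] em[OF E(2) D'(2) C]
      show "emeasure P {\<omega>\<in>space P. restrict \<omega> {..n} \<in> B \<and> fst (\<omega> (Suc n)) \<in> C} =
        emeasure P' {\<omega>\<in>space P'. restrict \<omega> {..n} \<in> B \<and> fst (\<omega> (Suc n)) \<in> C}" by simp
    qed measurable
    have state: "distr P ((histM n \<Otimes>\<^sub>M borel) \<Otimes>\<^sub>M optM) (\<lambda>\<omega>. ((restrict \<omega> {..n}, fst (\<omega> (Suc n))), snd (\<omega> (Suc n)))) =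
        distr P' ((histM n \<Otimes>\<^sub>M borel) \<Otimes>\<^sub>M optM) (\<lambda>\<omega>. ((restrict \<omega> {..n}, fst (\<omega> (Suc n))), snd (\<omega> (Suc n))))"
    proof (rule rect)
      fix B :: "('s traj \<times> ennreal) set" and C :: "'s option set" assume B [measurable]: "B \<in> sets (histM n \<Otimes>\<^sub>M (borel :: ennreal measure))" and C [measurable]: "C \<in> sets optM"
      define \<Gamma> where "\<Gamma> = Some -` C \<inter> S"
      have \<Gamma>: "\<Gamma> \<in> sets borel" "\<Gamma> \<subseteq> S" using C by (auto simp: \<Gamma>_def sets_optM)
      \<comment> \<open>A finite sojourn contributes the jump probability. After an infinite one the
        state is almost surely \<open>None\<close>, which explains the second summand. The result
        depends on history and sojourn only, whose joint law is already known to coincide.\<close>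
      let ?f = "\<lambda>p. indicator B p * (indicator {..<\<top>} (snd p) * jp \<Gamma> n (fst p) (enn2real (snd p)) + indicator {\<top>} (snd p) * indicator C None) :: ennreal"
      have f: "?f \<in> borel_measurable (histM n \<Otimes>\<^sub>M borel)"
        using jp_time_measurable[OF \<Gamma>, of n] by measurable
      have "emeasure R {\<omega>\<in>space R. (restrict \<omega> {..n}, fst (\<omega> (Suc n))) \<in> B \<and> snd (\<omega> (Suc n)) \<in> C} =
          (\<integral>\<^sup>+\<omega>. ?f (restrict \<omega> {..n}, fst (\<omega> (Suc n))) \<partial>R)" if R: "is_strategic S q \<gamma> pol R" for R
      proof -
        note DR = strategicD[OF R]
        note [measurable (raw)] = measurable_trajM_sets_eq[OF DR(2)]
        note [measurable] = \<Gamma>(1)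
        have sp: "space R = UNIV" using sets_eq_imp_space_eq[OF DR(2)] by simp
        let ?X = "\<lambda>\<omega>. (restrict \<omega> {..n}, fst (\<omega> (Suc n)))"
        let ?E = "{\<omega>\<in>space R. ?X \<omega> \<in> B \<and> fst (\<omega> (Suc n)) < \<top> \<and> snd (\<omega> (Suc n)) \<in> Some ` \<Gamma>}"
        have E: "?E \<in> sets R" by measurable
        have "{\<omega>\<in>space R. ?X \<omega> \<in> B \<and> snd (\<omega> (Suc n)) \<in> C} \<in> sets R" by measurable
        then have "emeasure R {\<omega>\<in>space R. ?X \<omega> \<in> B \<and> snd (\<omega> (Suc n)) \<in> C} =
          (\<integral>\<^sup>+\<omega>. indicator {\<omega>\<in>space R. ?X \<omega> \<in> B \<and> snd (\<omega> (Suc n)) \<in> C} \<omega> \<partial>R)" by simp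
        also have "\<dots> = (\<integral>\<^sup>+\<omega>. indicator ?E \<omega> + indicator B (?X \<omega>) * (indicator {\<top>} (fst (\<omega> (Suc n))) * indicator C None) \<partial>R)"
        proof (rule nn_integral_cong_AE)
          show "AE \<omega> in R. (indicator {\<omega>\<in>space R. ?X \<omega> \<in> B \<and> snd (\<omega> (Suc n)) \<in> C} \<omega> :: ennreal) =
            indicator ?E \<omega> + indicator B (?X \<omega>) * (indicator {\<top>} (fst (\<omega> (Suc n))) * indicator C None)"
            using DR(3)
          proof eventually_elim
            case (elim \<omega>)
            show ?case
            proof (cases "fst (\<omega> (Suc n)) < \<top>")
              case True
              then have "snd (\<omega> (Suc n)) \<in> Some ` S" using elim by (auto simp: Omega_def)
              then show ?thesis using True by (auto simp: sp \<Gamma>_def split: split_indicator)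
            next
              case False
              then have "fst (\<omega> (Suc n)) = \<top>" by (simp add: less_top[symmetric])
              moreover from this have "snd (\<omega> (Suc n)) = None" using elim by (auto simp: Omega_def)
              ultimately show ?thesis by (auto simp: sp split: split_indicator)
            qed
          qed
        qed
        also have "\<dots> = emeasure R ?E + (\<integral>\<^sup>+\<omega>. indicator B (?X \<omega>) * (indicator {\<top>} (fst (\<omega> (Suc n))) * indicator C None) \<partial>R)"
        proof (subst nn_integral_add)
          show "(\<lambda>\<omega>. indicator B (?X \<omega>) * (indicator {\<top>} (fst (\<omega> (Suc n))) * indicator C None) :: ennreal) \<in> borel_measurable R"
            by measurable
        qed (use E in simp_all)
        also have "emeasure R ?E = (\<integral>\<^sup>+\<omega>. indicator B (?X \<omega>) * (indicator {..<\<top>} (fst (\<omega> (Suc n))) * jp \<Gamma> n (restrict \<omega> {..n}) (enn2real (fst (\<omega> (Suc n))))) \<partial>R)"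
          unfolding DR(6)[OF B \<Gamma>]
        proof (rule nn_integral_cong_AE)
          show "AE \<omega> in R. indicator B (?X \<omega>) * indicator {..<\<top>} (fst (\<omega> (Suc n))) *
                  ennreal (jprob q pol n \<omega> (enn2real (fst (\<omega> (Suc n)))) \<Gamma>) =
              indicator B (?X \<omega>) * (indicator {..<\<top>} (fst (\<omega> (Suc n))) * jp \<Gamma> n (restrict \<omega> {..n}) (enn2real (fst (\<omega> (Suc n)))))"
            using DR(3)
          proof eventually_elim
            case (elim \<omega>)
            show ?case
            proof (cases "fst (\<omega> (Suc n)) < \<top>")
              case True
              have "0 < fst (\<omega> (Suc n))" using elim by (auto simp: Omega_def)
              with True have "0 < enn2real (fst (\<omega> (Suc n)))" by (simp add: enn2real_positive_iff)
              then show ?thesis using jp_eq_jprob[OF Omega_snd[OF elim]] by (simp add: mult.assoc)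
            qed simp
          qed
        qed
        also have "\<dots> + (\<integral>\<^sup>+\<omega>. indicator B (?X \<omega>) * (indicator {\<top>} (fst (\<omega> (Suc n))) * indicator C None) \<partial>R) =
          (\<integral>\<^sup>+\<omega>. ?f (?X \<omega>) \<partial>R)"
        proof -
          have "?X \<in> measurable R (histM n \<Otimes>\<^sub>M borel)" by measurable
          from measurable_compose[OF this jp_time_measurable[OF \<Gamma>]]
          have [measurable]: "(\<lambda>\<omega>. jp \<Gamma> n (restrict \<omega> {..n}) (enn2real (fst (\<omega> (Suc n))))) \<in> borel_measurable R" by simp
          have m1: "(\<lambda>\<omega>. indicator B (?X \<omega>) * (indicator {..<\<top>} (fst (\<omega> (Suc n))) * jp \<Gamma> n (restrict \<omega> {..n}) (enn2real (fst (\<omega> (Suc n)))))) \<in> borel_measurable R"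
            by measurable
          have m2: "(\<lambda>\<omega>. indicator B (?X \<omega>) * (indicator {\<top>} (fst (\<omega> (Suc n))) * indicator C None) :: ennreal) \<in> borel_measurable R"
            by measurable
          show ?thesis by (subst nn_integral_add[OF m1 m2, symmetric]) (simp add: distrib_left)
        qed
        finally show ?thesis .
      qed
      from this[OF P] this[OF P'] int[OF time _ f]
      show "emeasure P {\<omega>\<in>space P. (restrict \<omega> {..n}, fst (\<omega> (Suc n))) \<in> B \<and> snd (\<omega> (Suc n)) \<in> C} =
        emeasure P' {\<omega>\<in>space P'. (restrict \<omega> {..n}, fst (\<omega> (Suc n))) \<in> B \<and> snd (\<omega> (Suc n)) \<in> C}" by simp
    qed measurable
    let ?Y = "\<lambda>\<omega>. ((restrict \<omega> {..n}, fst (\<omega> (Suc n))), snd (\<omega> (Suc n)))"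
    let ?M = "(histM n \<Otimes>\<^sub>M (borel :: ennreal measure)) \<Otimes>\<^sub>M (optM :: 's option measure)"
    define \<phi> where "\<phi> = (\<lambda>p :: ('s traj \<times> ennreal) \<times> 's option. (fst (fst p))(Suc n := (snd (fst p), snd p)))"
    have \<phi>: "\<phi> \<in> measurable ?M (histM (Suc n))"
      unfolding \<phi>_def histM_def stepM_def by (rule measurable_fun_upd[where J = "{..n}"]) (auto simp: atMost_Suc)
    have Y: "?Y \<in> measurable trajM ?M" by measurable
    have comp: "\<phi> (?Y \<omega>) = restrict \<omega> {..Suc n}" for \<omega> by (auto simp: \<phi>_def restrict_def fun_eq_iff le_Suc_eq)
    have "distr P (histM (Suc n)) (\<lambda>\<omega>. restrict \<omega> {..Suc n}) = distr (distr P ?M ?Y) (histM (Suc n)) \<phi>"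
      using distr_distr[OF \<phi> measurable_trajM_sets_eq[OF D(2) Y]] by (simp add: comp_def comp)
    also have "\<dots> = distr (distr P' ?M ?Y) (histM (Suc n)) \<phi>" by (simp only: state)
    also have "\<dots> = distr P' (histM (Suc n)) (\<lambda>\<omega>. restrict \<omega> {..Suc n})"
      using distr_distr[OF \<phi> measurable_trajM_sets_eq[OF D'(2) Y]] by (simp add: comp_def comp)
    finally show ?case .
  qed
  show ?thesis
  proof (rule measure_eqI_PiM_infinite[where I = UNIV and M = "\<lambda>_. stepM"])
    show "sets P = sets (PiM UNIV (\<lambda>_. stepM))" "sets P' = sets (PiM UNIV (\<lambda>_. stepM))"
      using D(2) D'(2) by (simp_all add: trajM_def)
    show "finite_measure P" by unfold_locales
    fix C :: "nat \<Rightarrow> (ennreal \<times> 's option) set" and J :: "nat set"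
    assume J: "finite J" and C: "\<And>i. i \<in> J \<Longrightarrow> C i \<in> sets stepM"
    obtain n where n: "J \<subseteq> {..n}" using J by (meson finite_nat_iff_bounded_le)
    define B where "B = {h \<in> space (histM n). \<forall>i\<in>J. h i \<in> C i}"
    have B: "B \<in> sets (histM n)" unfolding B_def
    proof (intro sets.sets_Collect_finite_All J)
      fix i assume "i \<in> J"
      then have "(\<lambda>h. h i) \<in> measurable (histM n) stepM" using n by (intro measurable_component_histM) auto
      from measurable_sets[OF this C[OF \<open>i \<in> J\<close>]]
      show "{h \<in> space (histM n). h i \<in> C i} \<in> sets (histM n)" by (simp add: vimage_def Int_def conj_commute)
    qed
    have "prod_emb UNIV (\<lambda>_. stepM) J (Pi\<^sub>E J C) = {\<omega>. restrict \<omega> {..n} \<in> B}"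
    proof -
      have "i \<le> n" if "i \<in> J" for i using n that by auto
      then show ?thesis by (auto simp: prod_emb_def B_def PiE_iff)
    qed
    moreover have "emeasure (distr P (histM n) (\<lambda>\<omega>. restrict \<omega> {..n})) B = emeasure (distr P' (histM n) (\<lambda>\<omega>. restrict \<omega> {..n})) B"
      by (simp only: hist)
    then have "emeasure P {\<omega>. restrict \<omega> {..n} \<in> B} = emeasure P' {\<omega>. restrict \<omega> {..n} \<in> B}"
      using B by (subst (asm) (1 2) emeasure_distr) (simp_all add: space vimage_def)
    ultimately show "emeasure P (prod_emb UNIV (\<lambda>_. stepM) J (Pi\<^sub>E J C)) = emeasure P' (prod_emb UNIV (\<lambda>_. stepM) J (Pi\<^sub>E J C))"
      by simp
  qed
qed

text \<open>By existence and uniqueness the definite description in \<open>law\<close> denotes the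
  constructed measure, which carries over the step law and the initial distribution.\<close>

lemma law_step_law:
  assumes \<gamma>: "prob_space \<gamma>" "sets \<gamma> = sets (restrict_space borel S)"
  shows "is_strategic S q \<gamma> pol (law S q \<gamma> pol)" "step_law (law S q \<gamma> pol)"
    "\<And>g. g \<in> borel_measurable stepM \<Longrightarrow> (\<integral>\<^sup>+\<omega>. g (\<omega> 0) \<partial>law S q \<gamma> pol) = (\<integral>\<^sup>+x. g (0, Some x) \<partial>\<gamma>)"
proof -
  obtain P where P: "prob_space P" "sets P = sets trajM" "step_law P"
    and P0: "\<And>g. g \<in> borel_measurable stepM \<Longrightarrow> (\<integral>\<^sup>+\<omega>. g (\<omega> 0) \<partial>P) = (\<integral>\<^sup>+x. g (0, Some x) \<partial>\<gamma>)"
    using step_law_exists[OF \<gamma>] by metis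
  have strat: "is_strategic S q \<gamma> pol P" by (rule is_strategic_step_law[OF P P0 \<gamma>])
  then have "law S q \<gamma> pol = P" unfolding law_def by (blast intro: strategic_unique)
  with P P0 strat show "is_strategic S q \<gamma> pol (law S q \<gamma> pol)" "step_law (law S q \<gamma> pol)"
    "\<And>g. g \<in> borel_measurable stepM \<Longrightarrow> (\<integral>\<^sup>+\<omega>. g (\<omega> 0) \<partial>law S q \<gamma> pol) = (\<integral>\<^sup>+x. g (0, Some x) \<partial>\<gamma>)"
    by simp_all
qed

end

section \<open>Costs as sums over sojourns\<close>

lemma tn_Suc: "tn \<omega> (Suc n) = tn \<omega> n + fst (\<omega> (Suc n))"
  by (simp add: tn_def)

lemma tn_mono: "m \<le> n \<Longrightarrow> tn \<omega> m \<le> tn \<omega> n"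
  unfolding tn_def by (rule sum_mono2) auto

lemma xi_eq:
  assumes "tn \<omega> n \<le> ennreal t" "ennreal t < tn \<omega> (Suc n)"
  shows "xi \<omega> t = snd (\<omega> n)"
proof -
  have uniq: "m = n" if m: "tn \<omega> m \<le> ennreal t \<and> ennreal t < tn \<omega> (Suc m)" for m
  proof (rule ccontr)
    assume "m \<noteq> n"
    then consider "Suc m \<le> n" | "Suc n \<le> m" by linarith
    then show False
      using m assms tn_mono[of "Suc m" n \<omega>] tn_mono[of "Suc n" m \<omega>] by cases auto
  qed
  have "(SOME n. tn \<omega> n \<le> ennreal t \<and> ennreal t < tn \<omega> (Suc n)) = n"
    by (rule some_equality) (use assms uniq in blast)+
  moreover have "\<exists>n. tn \<omega> n \<le> ennreal t \<and> ennreal t < tn \<omega> (Suc n)" using assms by blast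
  ultimately show ?thesis by (simp only: xi_def if_True)
qed

text \<open>An infinite jump time requires an infinite sojourn at some index up to n, and from there
  on \<open>Omega\<close> keeps every sojourn infinite and every state \<open>None\<close>.\<close>

lemma Omega_top_absorbing:
  assumes \<omega>: "\<omega> \<in> Omega S" and "tn \<omega> n = \<top>"
  shows "snd (\<omega> n) = None"
proof -
  have "\<exists>k\<in>{1..n}. fst (\<omega> k) = \<top>"
    using assms(2)
  proof (induction n)
    case 0 then show ?case by (simp add: tn_def)
  next
    case (Suc n)
    then have "tn \<omega> n = \<top> \<or> fst (\<omega> (Suc n)) = \<top>" by (simp add: tn_Suc)
    then show ?case using Suc.IH by (fastforce simp: atLeastAtMostSuc_conv)
  qed
  then obtain k where k: "1 \<le> k" "k \<le> n" "fst (\<omega> k) = \<top>" by auto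
  have "fst (\<omega> n) = \<top>" using k(2)
  proof (induction rule: dec_induct)
    case (step m)
    then show ?case using \<omega> k(1) by (auto simp: Omega_def)
  qed (rule k)
  then show ?thesis using \<omega> k by (auto simp: Omega_def)
qed

context ctmdp_policy
begin

text \<open>\<open>crate\<close> attaches actions to the intervals (t_n, t_{n+1}], whereas
  \<open>xi\<close> attaches states to [t_n, t_{n+1}). The mismatch is confined to the countably
  many jump times, so open intervals may be used, and a shift by t_n lets each sojourn start at
  0.\<close>

lemma path_integral:
  assumes f: "(\<lambda>(x, a). f x a) \<in> borel_measurable (restrict_space borel (S \<times> A))" and \<omega>: "\<omega> \<in> Omega S"
  shows "(\<integral>\<^sup>+t. indicator {0..} t * crate f pol \<omega> t \<partial>lborel) =
    (\<Sum>n. \<integral>\<^sup>+s. indicator {0<..} s * (indicator {ennreal s<..} (fst (\<omega> (Suc n))) * avg (lift (\<lambda>x a. ennreal (f x a))) n \<omega> s) \<partial>lborel)"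
proof -
  let ?g = "lift (\<lambda>x a. ennreal (f x a))"
  have [measurable]: "avg ?g n \<omega> \<in> borel_measurable borel" for n
    by (rule avg_measurable1[OF lift_ennreal_measurable[OF f]])
  define T where "T n t = (if tn \<omega> n < ennreal t \<and> ennreal t < tn \<omega> (Suc n) then avg ?g n \<omega> (t - enn2real (tn \<omega> n)) else 0)" for n t
  have [measurable]: "T n \<in> borel_measurable borel" for n unfolding T_def by measurable
  have avg_eq: "(\<integral>\<^sup>+a. ennreal (case snd (\<omega> n) of None \<Rightarrow> 0 | Some x \<Rightarrow> f x a) \<partial>pol (Suc n) \<omega> s) = avg ?g n \<omega> s"
    if "0 < s" for n s
    unfolding avg_def act_pos[OF that, symmetric] using Omega_snd[OF \<omega>, of n]
    by (intro nn_integral_cong) (auto simp: act_space(3) split: option.split)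
  have "AE t in lborel. \<forall>n. t \<noteq> enn2real (tn \<omega> (Suc n))"
    unfolding AE_all_countable using AE_lborel_singleton by blast
  then have "AE t in lborel. indicator {0..} t * crate f pol \<omega> t = (\<Sum>n. T n t)"
  proof eventually_elim
    case (elim t)
    have "indicator {0..} t * (if tn \<omega> n < ennreal t \<and> ennreal t \<le> tn \<omega> (Suc n)
        then (\<integral>\<^sup>+ a. ennreal (case xi \<omega> t of None \<Rightarrow> 0 | Some x \<Rightarrow> f x a)
                  \<partial>(pol (Suc n) \<omega> (t - enn2real (tn \<omega> n)))) else 0) = T n t" for n
    proof (cases "tn \<omega> n < ennreal t \<and> ennreal t \<le> tn \<omega> (Suc n)")
      case True
      then have t: "0 < t" by (metis ennreal_neg leI not_less_zero)
      have "ennreal t \<noteq> tn \<omega> (Suc n)" using elim[rule_format, of n] t by (metis enn2real_ennreal less_imp_le)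
      then have lt: "ennreal t < tn \<omega> (Suc n)" using True by (simp add: order_less_le)
      have "enn2real (tn \<omega> n) < t" using True t by (cases "tn \<omega> n") (auto simp: ennreal_less_iff)
      moreover have "xi \<omega> t = snd (\<omega> n)" using True lt by (intro xi_eq) (simp_all add: less_imp_le)
      ultimately show ?thesis using True lt t avg_eq[of "t - enn2real (tn \<omega> n)" n] by (simp add: T_def)
    qed (auto simp: T_def)
    then show ?case by (simp add: crate_def ennreal_suminf_cmult[symmetric])
  qed
  then have "(\<integral>\<^sup>+t. indicator {0..} t * crate f pol \<omega> t \<partial>lborel) = (\<integral>\<^sup>+t. (\<Sum>n. T n t) \<partial>lborel)"
    by (rule nn_integral_cong_AE)
  also have "\<dots> = (\<Sum>n. \<integral>\<^sup>+t. T n t \<partial>lborel)" by (rule nn_integral_suminf) simp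
  finally have sum_T: "(\<integral>\<^sup>+t. indicator {0..} t * crate f pol \<omega> t \<partial>lborel) = (\<Sum>n. \<integral>\<^sup>+t. T n t \<partial>lborel)" .
  have "(\<integral>\<^sup>+t. T n t \<partial>lborel) =
    (\<integral>\<^sup>+s. indicator {0<..} s * (indicator {ennreal s<..} (fst (\<omega> (Suc n))) * avg ?g n \<omega> s) \<partial>lborel)" for n
  proof (cases "tn \<omega> n = \<top>")
    case True
    then have "snd (\<omega> n) = None" by (rule Omega_top_absorbing[OF \<omega>])
    then have "avg ?g n \<omega> s = 0" for s by (simp add: avg_def)
    then show ?thesis using True by (simp add: T_def)
  next
    case False
    then obtain c where c: "tn \<omega> n = ennreal c" "0 \<le> c" by (cases "tn \<omega> n") auto
    have "(\<integral>\<^sup>+t. T n t \<partial>lborel) = (\<integral>\<^sup>+s. T n (c + 1 * s) \<partial>lborel)"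
      using nn_integral_real_affine[of "T n" 1 c] by simp
    also have "\<dots> = (\<integral>\<^sup>+s. indicator {0<..} s * (indicator {ennreal s<..} (fst (\<omega> (Suc n))) * avg ?g n \<omega> s) \<partial>lborel)"
    proof (rule nn_integral_cong)
      fix s :: real
      show "T n (c + 1 * s) = indicator {0<..} s * (indicator {ennreal s<..} (fst (\<omega> (Suc n))) * avg ?g n \<omega> s)"
      proof (cases "0 < s")
        case True
        have "ennreal (c + s) = ennreal c + ennreal s" using True c by simp
        then have "ennreal (c + s) < tn \<omega> (Suc n) \<longleftrightarrow> ennreal s < fst (\<omega> (Suc n))"
          by (simp add: tn_Suc c)
        then show ?thesis using True c by (simp add: T_def ennreal_less_iff)
      next
        case False
        then have "\<not> tn \<omega> n < ennreal (c + s)" using c by (auto simp: not_less intro: ennreal_leI)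
        then show ?thesis using False by (simp add: T_def)
      qed
    qed
    finally show ?thesis .
  qed
  then show ?thesis by (simp only: sum_T)
qed

text \<open>The conditional mean, given the history up to index n, of g accumulated during the
  sojourn in x_n; integrating against the survival function replaces the random end of the
  sojourn.\<close>

definition sojourn :: "('s option \<Rightarrow> 'a \<Rightarrow> ennreal) \<Rightarrow> nat \<Rightarrow> 's traj \<Rightarrow> ennreal" where
  "sojourn g n \<omega> = (\<integral>\<^sup>+s. indicator {0<..} s * (survival (rate n \<omega>) s * avg g n \<omega> s) \<partial>lborel)"

context
  fixes P \<gamma>
  assumes \<gamma>: "prob_space \<gamma>" "sets \<gamma> = sets (restrict_space borel S)"
  defines "P \<equiv> law S q \<gamma> pol"
begin

lemmas P_strategic = law_step_law(1)[OF \<gamma>, folded P_def]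
lemmas P_step = law_step_law(2)[OF \<gamma>, folded P_def]
lemmas P_sets = strategicD(2)[OF P_strategic]

lemma sojourn_measurable:
  assumes "(\<lambda>(xo, a). g xo a) \<in> borel_measurable (optM \<Otimes>\<^sub>M MA)"
  shows "sojourn g n \<in> borel_measurable P"
proof -
  have "(\<lambda>\<omega>. sojourn g n (restrict \<omega> {..n})) \<in> borel_measurable P"
    unfolding sojourn_def
    by (rule measurable_compose[OF measurable_trajM_sets_eq[OF P_sets measurable_restrict_trajM] time_integral_measurable[OF avg_measurable[OF assms]]])
  then show ?thesis by (simp add: sojourn_def[abs_def])
qed

text \<open>Fubini under the kernel \<open>K\<close>: the sojourn exceeds s with probability
  survival at s, a tail that includes the atom at infinity.\<close>

lemma step_integral_time_integral:
  assumes g: "(\<lambda>(xo, a). g xo a) \<in> borel_measurable (optM \<Otimes>\<^sub>M MA)"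
  shows "step_integral n \<omega> (\<lambda>z. \<integral>\<^sup>+s. indicator {0<..} s * (indicator {ennreal s<..} (fst z) * avg g n \<omega> s) \<partial>lborel) = sojourn g n \<omega>"
proof -
  define h where "h = restrict \<omega> {..n}"
  have h: "h \<in> space (histM n)" and h_\<omega>: "step_integral n h = step_integral n \<omega>" by (simp_all add: h_def fun_eq_iff)
  interpret K: prob_space "K n h" by (rule prob_space_K[OF h])
  interpret pair_sigma_finite "K n h" lborel ..
  note [measurable] = avg_measurable1[OF g, of n \<omega>]
  have F: "(\<lambda>(z, s). indicator {0<..} s * (indicator {ennreal s<..} (fst z) * avg g n \<omega> s)) \<in> borel_measurable (stepM \<Otimes>\<^sub>M lborel)"
  proof -
    have "Measurable.pred (stepM \<Otimes>\<^sub>M borel) (\<lambda>p :: (ennreal \<times> 's option) \<times> real. ennreal (snd p) < fst (fst p))" by measurable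
    then have "(\<lambda>p :: (ennreal \<times> 's option) \<times> real. indicator {0<..} (snd p) * (indicator {p. ennreal (snd p) < fst (fst p)} p * avg g n \<omega> (snd p)))
      \<in> borel_measurable (stepM \<Otimes>\<^sub>M borel)" by measurable
    then show ?thesis by (simp add: case_prod_beta' indicator_def cong: measurable_cong_sets if_cong)
  qed
  have F': "(\<lambda>(z, s). indicator {0<..} s * (indicator {ennreal s<..} (fst z) * avg g n \<omega> s)) \<in> borel_measurable (K n h \<Otimes>\<^sub>M lborel)"
    using F sets_K[OF h] by (simp cong: measurable_cong_sets sets_pair_measure_cong)
  have "step_integral n h (\<lambda>z. \<integral>\<^sup>+s. indicator {0<..} s * (indicator {ennreal s<..} (fst z) * avg g n \<omega> s) \<partial>lborel) =
    (\<integral>\<^sup>+z. \<integral>\<^sup>+s. indicator {0<..} s * (indicator {ennreal s<..} (fst z) * avg g n \<omega> s) \<partial>lborel \<partial>K n h)"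
    using lborel.borel_measurable_nn_integral[OF F] by (intro nn_integral_K[OF h, symmetric]) simp_all
  also have "\<dots> = (\<integral>\<^sup>+s. \<integral>\<^sup>+z. indicator {0<..} s * (indicator {ennreal s<..} (fst z) * avg g n \<omega> s) \<partial>K n h \<partial>lborel)"
    by (rule Fubini'[OF F', symmetric])
  also have "\<dots> = sojourn g n \<omega>" unfolding sojourn_def
  proof (rule nn_integral_cong)
    fix s :: real
    have m: "(\<lambda>z. indicator {ennreal s<..} (fst z) :: ennreal) \<in> borel_measurable stepM" by measurable
    have "(\<integral>\<^sup>+z. indicator {0<..} s * (indicator {ennreal s<..} (fst z) * avg g n \<omega> s) \<partial>K n h) =
      (indicator {0<..} s * avg g n \<omega> s) * (\<integral>\<^sup>+z. indicator {ennreal s<..} (fst z) \<partial>K n h)"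
      using m by (subst nn_integral_cmult[symmetric]) (simp_all add: mult_ac measurable_cong_sets[OF sets_K[OF h] refl])
    also have "(\<integral>\<^sup>+z. indicator {ennreal s<..} (fst z) \<partial>K n h) = step_integral n \<omega> (\<lambda>z. indicator {ennreal s<..} (fst z))"
      using m by (subst nn_integral_K[OF h]) (simp_all add: h_\<omega>)
    finally show "(\<integral>\<^sup>+z. indicator {0<..} s * (indicator {ennreal s<..} (fst z) * avg g n \<omega> s) \<partial>K n h) =
      indicator {0<..} s * (survival (rate n \<omega>) s * avg g n \<omega> s)"
      using step_integral_tail(1)[of s n \<omega>] by (cases "0 < s") (simp_all add: mult_ac)
  qed
  finally show ?thesis by (simp add: h_\<omega>)
qed

lemma exp_cost_eq:
  assumes f: "(\<lambda>(x, a). f x a) \<in> borel_measurable (restrict_space borel (S \<times> A))"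
  shows "exp_cost S q \<gamma> pol f = (\<Sum>n. \<integral>\<^sup>+\<omega>. sojourn (lift (\<lambda>x a. ennreal (f x a))) n \<omega> \<partial>P)"
proof -
  let ?g = "lift (\<lambda>x a. ennreal (f x a))"
  note g = lift_ennreal_measurable[OF f]
  let ?F = "\<lambda>n h z. \<integral>\<^sup>+s. indicator {0<..} s * (indicator {ennreal s<..} (fst z) * avg ?g n h s) \<partial>lborel"
  have F: "(\<lambda>(h, z). ?F n h z) \<in> borel_measurable (histM n \<Otimes>\<^sub>M stepM)" for n
  proof -
    have "(\<lambda>p. (fst (fst p), snd p)) \<in> measurable ((histM n \<Otimes>\<^sub>M stepM) \<Otimes>\<^sub>M borel) (histM n \<Otimes>\<^sub>M borel)" by measurable
    from measurable_compose[OF this avg_measurable[OF g, of n]]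
    have [measurable]: "(\<lambda>p. avg ?g n (fst (fst p)) (snd p)) \<in> borel_measurable ((histM n \<Otimes>\<^sub>M stepM) \<Otimes>\<^sub>M borel)" by simp
    have "Measurable.pred ((histM n \<Otimes>\<^sub>M stepM) \<Otimes>\<^sub>M borel) (\<lambda>p :: ('s traj \<times> (ennreal \<times> 's option)) \<times> real. ennreal (snd p) < fst (snd (fst p)))" by measurable
    then have "(\<lambda>p :: ('s traj \<times> (ennreal \<times> 's option)) \<times> real. indicator {0<..} (snd p) *
        (indicator {p. ennreal (snd p) < fst (snd (fst p))} p * avg ?g n (fst (fst p)) (snd p)))
      \<in> borel_measurable ((histM n \<Otimes>\<^sub>M stepM) \<Otimes>\<^sub>M borel)" by measurable
    then have "(\<lambda>(p, s). indicator {0<..} s * (indicator {ennreal s<..} (fst (snd p)) * avg ?g n (fst p) s))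
      \<in> borel_measurable ((histM n \<Otimes>\<^sub>M stepM) \<Otimes>\<^sub>M lborel)"
      by (simp add: case_prod_beta' indicator_def cong: measurable_cong_sets if_cong)
    from lborel.borel_measurable_nn_integral[OF this] show ?thesis by (simp add: case_prod_beta')
  qed
  have F_P: "(\<lambda>\<omega>. ?F n \<omega> (\<omega> (Suc n))) \<in> borel_measurable P" for n
  proof -
    have "(\<lambda>\<omega>. (restrict \<omega> {..n}, \<omega> (Suc n))) \<in> measurable P (histM n \<Otimes>\<^sub>M stepM)"
      by (rule measurable_trajM_sets_eq[OF P_sets]) measurable
    from measurable_compose[OF this F] show ?thesis by simp
  qed
  have "exp_cost S q \<gamma> pol f = (\<integral>\<^sup>+\<omega>. (\<Sum>n. ?F n \<omega> (\<omega> (Suc n))) \<partial>P)"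
    unfolding exp_cost_def P_def[symmetric]
  proof (rule nn_integral_cong_AE)
    show "AE \<omega> in P. (\<integral>\<^sup>+t. indicator {0..} t * crate f pol \<omega> t \<partial>lborel) = (\<Sum>n. ?F n \<omega> (\<omega> (Suc n)))"
      using strategicD(3)[OF P_strategic] by eventually_elim (rule path_integral[OF f])
  qed
  also have "\<dots> = (\<Sum>n. \<integral>\<^sup>+\<omega>. ?F n \<omega> (\<omega> (Suc n)) \<partial>P)" by (rule nn_integral_suminf[OF F_P])
  finally have sum_F: "exp_cost S q \<gamma> pol f = (\<Sum>n. \<integral>\<^sup>+\<omega>. ?F n \<omega> (\<omega> (Suc n)) \<partial>P)" .
  have "(\<integral>\<^sup>+\<omega>. ?F n \<omega> (\<omega> (Suc n)) \<partial>P) = (\<integral>\<^sup>+\<omega>. sojourn ?g n \<omega> \<partial>P)" for n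
    using step_lawD[OF P_step F, of n] by (simp add: step_integral_time_integral[OF g])
  then show ?thesis by (simp only: sum_F)
qed

text \<open>The density of the jump has the same shape as a running reward, with reward rate
  \<open>rq\<close> times the mean of W under \<open>J\<close>. The condition
  \<open>W None = 0\<close> removes the atom.\<close>

lemma next_state:
  assumes W: "W \<in> borel_measurable optM" "W None = 0"
  shows "(\<integral>\<^sup>+\<omega>. W (snd (\<omega> (Suc n))) \<partial>P) = (\<integral>\<^sup>+\<omega>. sojourn (\<lambda>xo a. rq xo a * (\<integral>\<^sup>+y. W y \<partial>J xo a)) n \<omega> \<partial>P)"
proof -
  have "(\<lambda>(h, z). W (snd z)) \<in> borel_measurable (histM n \<Otimes>\<^sub>M stepM)"
    using W(1) by (simp add: case_prod_beta')
  from step_lawD[OF P_step this] show ?thesis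
    by (simp add: step_integral_def jump_def W(2) sojourn_def avg_def)
qed

end

text \<open>Averaging the hypothesis over actions and integrating it against the survival function
  yields w D + w R on the left, where D is the mean sojourn and R the probability that a jump
  occurs. If R = 1 this is the claim.\<close>

lemma sojourn_inequality:
  assumes g: "(\<lambda>(xo, a). g xo a) \<in> borel_measurable (optM \<Otimes>\<^sub>M MA)"
    and j: "(\<lambda>(xo, a). j xo a) \<in> borel_measurable (optM \<Otimes>\<^sub>M MA)"
    and ineq: "\<And>a. a \<in> A \<Longrightarrow> w * (1 + rq (snd (\<omega> n)) a) \<le> g (snd (\<omega> n)) a + j (snd (\<omega> n)) a"
  shows "sojourn (\<lambda>_ _. w) n \<omega> + w \<le> sojourn g n \<omega> + sojourn j n \<omega>"
proof -
  obtain Q where "hazard_rate (rate n \<omega>) Q" using hazard_rate_traj .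
  then interpret hazard_rate "rate n \<omega>" Q .
  have avg: "w + w * rate n \<omega> s \<le> avg g n \<omega> s + avg j n \<omega> s" for s
  proof -
    interpret prob_space "act n \<omega> s" by (rule act_space)
    have "w + w * rate n \<omega> s = (\<integral>\<^sup>+a. w * (1 + rq (snd (\<omega> n)) a) \<partial>act n \<omega> s)"
      using act_section_measurable[OF rq_measurable] by (simp add: avg_def nn_integral_cmult nn_integral_add emeasure_space_1 distrib_left)
    also have "\<dots> \<le> (\<integral>\<^sup>+a. g (snd (\<omega> n)) a + j (snd (\<omega> n)) a \<partial>act n \<omega> s)"
      using ineq by (intro nn_integral_mono) (auto simp: act_space(3))
    also have "\<dots> = avg g n \<omega> s + avg j n \<omega> s"
      using act_section_measurable[OF g] act_section_measurable[OF j] by (simp add: avg_def nn_integral_add)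
    finally show ?thesis .
  qed
  note [measurable] = avg_measurable1[OF g] avg_measurable1[OF j]
  define D where "D = (\<integral>\<^sup>+s. indicator {0<..} s * surv s \<partial>lborel)"
  define R where "R = (\<integral>\<^sup>+s. indicator {0<..} s * (surv s * rate n \<omega> s) \<partial>lborel)"
  have "w * D + w * R = (\<integral>\<^sup>+s. indicator {0<..} s * (surv s * (w + w * rate n \<omega> s)) \<partial>lborel)"
    unfolding D_def R_def
    by (subst (1 2) nn_integral_cmult[symmetric], simp, simp, subst nn_integral_add[symmetric])
       (simp_all add: distrib_left mult_ac)
  also have "\<dots> \<le> (\<integral>\<^sup>+s. indicator {0<..} s * (surv s * (avg g n \<omega> s + avg j n \<omega> s)) \<partial>lborel)"
    by (intro nn_integral_mono mult_left_mono avg) auto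
  also have "\<dots> = sojourn g n \<omega> + sojourn j n \<omega>"
    unfolding sojourn_def by (subst nn_integral_add[symmetric]) (auto simp: distrib_left)
  finally have le: "w * D + w * R \<le> sojourn g n \<omega> + sojourn j n \<omega>" .
  have "sojourn (\<lambda>_ _. w) n \<omega> = (\<integral>\<^sup>+s. w * (indicator {0<..} s * surv s) \<partial>lborel)"
    unfolding sojourn_def using prob_space.emeasure_space_1[OF act_space(1)[of n \<omega>]]
    by (simp add: avg_def mult_ac)
  also have "\<dots> = w * D" unfolding D_def by (rule nn_integral_cmult) measurable
  finally have D: "sojourn (\<lambda>_ _. w) n \<omega> = w * D" .
  txt \<open>A sojourn that is infinite with positive probability has infinite mean, so the missing mass of the
    jump does not matter.\<close>
  consider "never (rate n \<omega>) = 0" | "D = \<top>" using atom_zero_or_sojourn_infinite by (auto simp: D_def)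
  then show ?thesis
  proof cases
    case 1
    then have "R = 1" using density_integral_plus_atom by (simp add: R_def)
    then show ?thesis using le D by simp
  next
    case 2
    then show ?thesis using le D by (cases "w = 0") (auto simp: ennreal_mult_top top_unique)
  qed
qed

end

section \<open>Bellman iterates\<close>

lemma lsc_on_eventually:
  fixes p :: "nat \<Rightarrow> 'b::topological_space"
  assumes u: "lsc_on X u" and p: "p \<longlonglongrightarrow> l" "\<And>n. p n \<in> X" "l \<in> X" and "y < u l"
  shows "\<forall>\<^sub>F n in sequentially. y < u (p n)"
proof -
  obtain T where T: "open T" "{x\<in>X. y < u x} = X \<inter> T"
    using u by (auto simp: lsc_on_def openin_open)
  then have "l \<in> T" using p(3) \<open>y < u l\<close> by blast
  from topological_tendstoD[OF p(1) T(1) this] show ?thesis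
  proof eventually_elim
    case (elim n)
    then have "p n \<in> {x\<in>X. y < u x}" unfolding T(2) using p(2) by blast
    then show ?case by simp
  qed
qed

locale ctmdp_cost = ctmdp S A q
  for S :: "'s::polish_space set" and A :: "'a::polish_space set" and q :: "'s \<Rightarrow> 'a \<Rightarrow> 's set \<Rightarrow> real" +
  fixes c :: "'s \<Rightarrow> 'a \<Rightarrow> real"
  assumes A_compact: "compact A"
    and weakly_continuous: "\<And>f::'s \<Rightarrow> real. continuous_on S f \<Longrightarrow> bounded (f ` S) \<Longrightarrow>
        continuous_on (S \<times> A) (\<lambda>(x, a). (\<integral>y. f y \<partial>(qtM S q x a)) / qx q x a)"
    and c_lsc: "lsc_on (S \<times> A) (\<lambda>(x, a). c x a)"
    and c_nonneg: "\<And>x a. x \<in> S \<Longrightarrow> a \<in> A \<Longrightarrow> 0 \<le> c x a"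
begin

section \<open>Functions with values in [0,1] and their integrals against q~\<close>

definition unit_fun :: "('s \<Rightarrow> real) \<Rightarrow> bool" where
  "unit_fun W \<longleftrightarrow> W \<in> borel_measurable (restrict_space borel S) \<and> (\<forall>x\<in>S. 0 \<le> W x \<and> W x \<le> 1)"

definition mean :: "('s \<Rightarrow> real) \<Rightarrow> 's \<Rightarrow> 'a \<Rightarrow> real" where
  "mean W x a = (\<integral>y. W y \<partial>qtM S q x a)"

lemma finite_measure_qtM: "x \<in> S \<Longrightarrow> a \<in> A \<Longrightarrow> finite_measure (qtM S q x a)"
  by (rule finite_measureI) (simp add: emeasure_qtM)

lemma integrable_unit_fun:
  assumes "unit_fun W" "x \<in> S" "a \<in> A"
  shows "integrable (qtM S q x a) W"
proof -
  interpret finite_measure "qtM S q x a" by (rule finite_measure_qtM) fact+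
  show ?thesis
    using assms(1) by (intro integrable_const_bound[where B = 1])
      (auto simp: unit_fun_def measurable_cong_sets[OF sets_qtM refl])
qed

lemma mean_nonneg: "unit_fun W \<Longrightarrow> x \<in> S \<Longrightarrow> a \<in> A \<Longrightarrow> 0 \<le> mean W x a"
  unfolding mean_def by (rule Bochner_Integration.integral_nonneg) (auto simp: unit_fun_def)

lemma mean_mono:
  assumes "unit_fun W" "unit_fun W'" "\<And>y. y \<in> S \<Longrightarrow> W y \<le> W' y" "x \<in> S" "a \<in> A"
  shows "mean W x a \<le> mean W' x a"
  unfolding mean_def by (intro integral_mono integrable_unit_fun) (use assms in auto)

lemma mean_tendsto:
  assumes "\<And>n. unit_fun (f n)" "unit_fun W" "\<And>y. y \<in> S \<Longrightarrow> (\<lambda>n. f n y) \<longlonglongrightarrow> W y" "x \<in> S" "a \<in> A"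
  shows "(\<lambda>n. mean (f n) x a) \<longlonglongrightarrow> mean W x a"
proof -
  interpret finite_measure "qtM S q x a" by (rule finite_measure_qtM) fact+
  show ?thesis unfolding mean_def
    by (rule integral_dominated_convergence[where w = "\<lambda>_. 1"])
       (use assms in \<open>auto simp: unit_fun_def measurable_cong_sets[OF sets_qtM refl]\<close>)
qed

lemma unit_fun_lsc:
  "lsc_on S W \<Longrightarrow> (\<And>x. x \<in> S \<Longrightarrow> 0 \<le> W x) \<Longrightarrow> (\<And>x. x \<in> S \<Longrightarrow> W x \<le> 1) \<Longrightarrow> unit_fun W"
  by (simp add: unit_fun_def lsc_on_borel_measurable)

text \<open>The Feller condition concerns the normalised kernel, so its integral is multiplied by
  the continuous q_x(a). At rate 0 the quotient is 0 by convention and q~ is the null measure, so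
  the product is correct there too.\<close>

lemma mean_continuous:
  assumes f: "continuous_on S f" "unit_fun f"
  shows "continuous_on (S \<times> A) (\<lambda>(x, a). mean f x a)"
proof -
  have "bounded (f ` S)" using f(2) by (intro boundedI[of _ 1]) (auto simp: unit_fun_def)
  then have "continuous_on (S \<times> A) (\<lambda>p. (case p of (x, a) \<Rightarrow> (\<integral>y. f y \<partial>(qtM S q x a)) / qx q x a) * (case p of (x, a) \<Rightarrow> qx q x a))"
    using weakly_continuous[OF f(1)] qx_continuous by (intro continuous_on_mult)
  then show ?thesis
  proof (rule continuous_on_cong[THEN iffD1, rotated 2])
    fix p assume p: "p \<in> S \<times> A"
    obtain x a where [simp]: "p = (x, a)" by (cases p)
    have x: "x \<in> S" "a \<in> A" using p by auto
    show "(case p of (x, a) \<Rightarrow> (\<integral>y. f y \<partial>(qtM S q x a)) / qx q x a) * (case p of (x, a) \<Rightarrow> qx q x a) = (case p of (x, a) \<Rightarrow> mean f x a)"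
    proof (cases "qx q x a = 0")
      case True
      then have "emeasure (qtM S q x a) S = 0" using x by (simp add: emeasure_qtM qt_S)
      then have "AE y in qtM S q x a. f y = 0"
        by (auto simp: eventually_ae_filter null_sets_def intro!: bexI[of _ S])
      then have "(\<integral>y. f y \<partial>(qtM S q x a)) = 0" by (simp add: integral_eq_zero_AE)
      then show ?thesis using True by (simp add: mean_def)
    qed (simp add: mean_def)
  qed simp
qed

text \<open>W is an increasing limit of continuous functions with values in [0,1]. Their means are
  continuous by the Feller condition and converge by dominated convergence, and a supremum of
  continuous functions is lower semicontinuous.\<close>

lemma mean_lsc:
  assumes W: "lsc_on S W" "\<And>x. x \<in> S \<Longrightarrow> 0 \<le> W x" "\<And>x. x \<in> S \<Longrightarrow> W x \<le> 1"
  shows "lsc_on (S \<times> A) (\<lambda>(x, a). mean W x a)"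
proof -
  from lsc_on_approx_continuous[OF W] obtain f :: "nat \<Rightarrow> 's \<Rightarrow> real" where f: "\<And>n. continuous_on S (f n)"
    "\<And>n x. x \<in> S \<Longrightarrow> 0 \<le> f n x" "\<And>n x. x \<in> S \<Longrightarrow> f n x \<le> W x"
    "\<And>x. x \<in> S \<Longrightarrow> incseq (\<lambda>n. f n x)" "\<And>x. x \<in> S \<Longrightarrow> (\<lambda>n. f n x) \<longlonglongrightarrow> W x" by blast
  have uW: "unit_fun W" by (rule unit_fun_lsc[OF W])
  have uf: "unit_fun (f n)" for n
    using f(2,3) W(3) order_trans by (intro unit_fun_lsc lsc_on_continuous f(1)) blast+
  have le: "mean (f n) x a \<le> mean W x a" if "x \<in> S" "a \<in> A" for n x a
    using f(3) that by (intro mean_mono uf uW)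
  have inc: "incseq (\<lambda>n. mean (f n) x a)" if "x \<in> S" "a \<in> A" for x a
    using f(4) that by (intro incseq_SucI mean_mono uf) (auto simp: incseq_Suc_iff)
  have bdd: "bdd_above (range (\<lambda>n. mean (f n) x a))" if "x \<in> S" "a \<in> A" for x a
    using le[OF that] by (auto intro!: bdd_aboveI[of _ "mean W x a"])
  have SUP: "(SUP n. mean (f n) x a) = mean W x a" if "x \<in> S" "a \<in> A" for x a
    using LIMSEQ_incseq_SUP[OF bdd[OF that] inc[OF that]] mean_tendsto[OF uf uW f(5) that] by (rule LIMSEQ_unique)
  have "lsc_on (S \<times> A) (\<lambda>p. SUP n. (case p of (x, a) \<Rightarrow> mean (f n) x a))"
    using bdd by (intro lsc_on_SUP lsc_on_continuous mean_continuous f(1) uf) auto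
  then show ?thesis
    by (rule lsc_on_cong[THEN iffD1, rotated]) (auto simp: SUP)
qed

definition ratio :: "('s \<Rightarrow> real) \<Rightarrow> 's \<times> 'a \<Rightarrow> real" where
  "ratio W = (\<lambda>(x, a). (c x a + mean W x a) / (1 + qx q x a))"

section \<open>Value iteration and its increasing limit\<close>

primrec V :: "nat \<Rightarrow> 's \<Rightarrow> real" where
  "V 0 = (\<lambda>_. 0)"
| "V (Suc k) = (\<lambda>x. min 1 (INF a\<in>A. ratio (V k) (x, a)))"

lemma ratio_nonneg: "unit_fun W \<Longrightarrow> x \<in> S \<Longrightarrow> a \<in> A \<Longrightarrow> 0 \<le> ratio W (x, a)"
  by (simp add: ratio_def c_nonneg mean_nonneg qx_nonneg)

lemma ratio_lsc:
  assumes W: "lsc_on S W" "\<And>x. x \<in> S \<Longrightarrow> 0 \<le> W x" "\<And>x. x \<in> S \<Longrightarrow> W x \<le> 1"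
  shows "lsc_on (S \<times> A) (ratio W)"
proof -
  have "lsc_on (S \<times> A) (\<lambda>p. ((case p of (x, a) \<Rightarrow> c x a) + (case p of (x, a) \<Rightarrow> mean W x a)) / (1 + (case p of (x, a) \<Rightarrow> qx q x a)))"
    using qx_nonneg by (intro lsc_on_divide lsc_on_add c_lsc mean_lsc[OF W] continuous_intros qx_continuous) (auto intro: add_pos_nonneg)
  then show ?thesis by (simp add: ratio_def case_prod_beta')
qed

lemma V_props: "lsc_on S (V k)" "x \<in> S \<Longrightarrow> 0 \<le> V k x" "x \<in> S \<Longrightarrow> V k x \<le> 1"
proof (induction k arbitrary: x)
  case 0
  { case 1 show ?case by (simp add: lsc_on_continuous) }
  { case 2 show ?case by simp }
  { case 3 show ?case by simp }
next
  case (Suc k)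
  note u = unit_fun_lsc[OF Suc.IH]
  { case 1 show ?case
      using ratio_nonneg[OF u] by (simp, intro lsc_on_min_const lsc_on_INF_compact ratio_lsc Suc.IH A_compact A_nonempty) }
  { case 2 then show ?case using ratio_nonneg[OF u] A_nonempty by (auto intro!: cINF_greatest) }
  { case 3 show ?case by simp }
qed

lemma V_unit: "unit_fun (V k)"
  by (rule unit_fun_lsc) (auto intro: V_props)

lemma ratio_bdd: "unit_fun W \<Longrightarrow> x \<in> S \<Longrightarrow> bdd_below ((\<lambda>a. ratio W (x, a)) ` A)"
  by (rule bdd_belowI[of _ 0]) (auto simp: ratio_nonneg)

lemma ratio_mono:
  "unit_fun W \<Longrightarrow> unit_fun W' \<Longrightarrow> (\<And>y. y \<in> S \<Longrightarrow> W y \<le> W' y) \<Longrightarrow> x \<in> S \<Longrightarrow> a \<in> A \<Longrightarrow> ratio W (x, a) \<le> ratio W' (x, a)"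
  using mean_mono[of W W' x a] qx_nonneg[of x a] by (simp add: ratio_def divide_right_mono)

lemma V_Suc_mono: "x \<in> S \<Longrightarrow> V k x \<le> V (Suc k) x"
proof (induction k arbitrary: x)
  case 0 then show ?case using V_props(2)[of x 1] by simp
next
  case (Suc k)
  have "(INF a\<in>A. ratio (V k) (x, a)) \<le> (INF a\<in>A. ratio (V (Suc k)) (x, a))"
    using Suc.IH Suc.prems
    by (intro cINF_mono A_nonempty ratio_bdd V_unit) (auto intro!: bexI ratio_mono V_unit simp del: V.simps)
  then show ?case by (subst (1 2) V.simps) auto
qed

lemma V_inc: "x \<in> S \<Longrightarrow> incseq (\<lambda>k. V k x)"
  by (rule incseq_SucI) (rule V_Suc_mono)

lemma V_Suc_ineq:
  assumes "x \<in> S" "a \<in> A"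
  shows "V (Suc k) x * (1 + qx q x a) \<le> c x a + mean (V k) x a"
proof -
  have "V (Suc k) x \<le> ratio (V k) (x, a)"
    using cINF_lower[OF ratio_bdd[OF V_unit assms(1)] assms(2), of k] by simp
  then show ?thesis using qx_nonneg[OF assms] by (simp add: ratio_def pos_le_divide_eq add_pos_nonneg)
qed

definition Vinf :: "'s \<Rightarrow> real" where
  "Vinf x = (SUP k. V k x)"

lemma V_bdd: "x \<in> S \<Longrightarrow> bdd_above (range (\<lambda>k. V k x))"
  using V_props(3) by (auto intro!: bdd_aboveI[of _ 1])

lemma V_le_Vinf: "x \<in> S \<Longrightarrow> V k x \<le> Vinf x"
  unfolding Vinf_def by (rule cSUP_upper[OF _ V_bdd]) simp_all

lemma V_tendsto: "x \<in> S \<Longrightarrow> (\<lambda>k. V k x) \<longlonglongrightarrow> Vinf x"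
  unfolding Vinf_def by (rule LIMSEQ_incseq_SUP[OF V_bdd V_inc])

lemma Vinf_props: "lsc_on S Vinf" "x \<in> S \<Longrightarrow> 0 \<le> Vinf x" "x \<in> S \<Longrightarrow> Vinf x \<le> 1"
proof -
  show "lsc_on S Vinf" unfolding Vinf_def using V_props(1) V_bdd by (intro lsc_on_SUP) auto
  show "0 \<le> Vinf x" if "x \<in> S" using V_le_Vinf[OF that, of 0] by simp
  show "Vinf x \<le> 1" if "x \<in> S" unfolding Vinf_def using V_props(3)[OF that] by (intro cSUP_least) auto
qed

lemma Vinf_unit: "unit_fun Vinf"
  by (rule unit_fun_lsc) (auto intro: Vinf_props)

lemma Vinf_ineq:
  assumes "x \<in> S" "a \<in> A"
  shows "Vinf x * (1 + qx q x a) \<le> c x a + mean Vinf x a"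
proof -
  have "V (Suc k) x * (1 + qx q x a) \<le> c x a + mean Vinf x a" for k
    using V_Suc_ineq[OF assms, of k] mean_mono[OF V_unit Vinf_unit V_le_Vinf assms, of k] by simp
  moreover have "(\<lambda>k. V (Suc k) x * (1 + qx q x a)) \<longlonglongrightarrow> Vinf x * (1 + qx q x a)"
    using V_tendsto[OF assms(1)] by (intro tendsto_intros) (rule LIMSEQ_Suc)
  ultimately show ?thesis by (intro LIMSEQ_le_const2) auto
qed

text \<open>Compactness interchanges the infimum over actions with the limit in k. Actions
  \<open>b k\<close> that nearly minimise the ratio for \<open>V k\<close> accumulate at some a. For
  fixed k, monotonicity in the iteration index makes the ratio for \<open>V k\<close> small along
  late members of the subsequence, and lower semicontinuity passes this to a. Finally k tends to
  infinity by dominated convergence.\<close>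

lemma zero_action:
  assumes x: "x \<in> S" "Vinf x = 0"
  shows "\<exists>a\<in>A. c x a + mean Vinf x a \<le> 0"
proof -
  have V0: "V k x = 0" for k using V_le_Vinf[OF x(1), of k] V_props(2)[OF x(1), of k] x(2) by simp
  have "\<exists>a\<in>A. ratio (V k) (x, a) < 1 / real (Suc k)" for k
  proof -
    \<comment> \<open>The cut-off is inactive here: min 1 y = 0 forces y = 0.\<close>
    have "(INF a\<in>A. ratio (V k) (x, a)) \<le> 0" using V0[of "Suc k"] by (simp add: min_def split: if_splits)
    also have "(0::real) < 1 / real (Suc k)" by simp
    finally show ?thesis using cINF_less_iff[OF A_nonempty ratio_bdd[OF V_unit x(1)], of k] by simp
  qed
  then obtain b where b: "\<And>k. b k \<in> A" "\<And>k. ratio (V k) (x, b k) < 1 / real (Suc k)" by metis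
  obtain a r where a: "a \<in> A" "strict_mono (r :: nat \<Rightarrow> nat)" "(b \<circ> r) \<longlonglongrightarrow> a"
    using A_compact b(1) unfolding compact_def by metis
  have ratio0: "ratio (V k) (x, a) \<le> 0" for k
  proof (rule ccontr)
    assume "\<not> ratio (V k) (x, a) \<le> 0"
    then obtain e where e: "0 < e" "e < ratio (V k) (x, a)" by (meson dense not_le)
    have lsc: "lsc_on (S \<times> A) (ratio (V k))" by (rule ratio_lsc) (auto intro: V_props)
    have "(\<lambda>j. (x, (b \<circ> r) j)) \<longlonglongrightarrow> (x, a)" using a(3) by (intro tendsto_intros)
    then have "\<forall>\<^sub>F j in sequentially. e < ratio (V k) (x, (b \<circ> r) j)"
      by (rule lsc_on_eventually[OF lsc]) (use x a b e in auto)
    moreover have "\<forall>\<^sub>F j in sequentially. 1 / real (Suc j) < e"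
      using e(1) by (rule order_tendstoD(2)[OF lim_inverse_n'[THEN LIMSEQ_Suc]])
    ultimately have "\<forall>\<^sub>F j in sequentially. False" using eventually_ge_at_top[of k]
    proof eventually_elim
      case (elim j)
      have "k \<le> r j" using elim(3) seq_suble[OF a(2), of j] by simp
      then have "ratio (V k) (x, b (r j)) \<le> ratio (V (r j)) (x, b (r j))"
        using V_inc x(1) b(1) by (intro ratio_mono V_unit) (auto simp: incseq_def)
      also have "\<dots> < 1 / real (Suc (r j))" by (rule b)
      also have "\<dots> \<le> 1 / real (Suc j)" using seq_suble[OF a(2), of j] by (intro divide_left_mono) auto
      finally show False using elim by simp
    qed
    then show False by simp
  qed
  have "c x a + mean (V k) x a \<le> 0" for k
    using ratio0[of k] qx_nonneg[OF x(1) a(1)] by (simp add: ratio_def divide_le_0_iff)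
  moreover have "(\<lambda>k. c x a + mean (V k) x a) \<longlonglongrightarrow> c x a + mean Vinf x a"
    using mean_tendsto[OF V_unit Vinf_unit V_tendsto x(1) a(1)] by (intro tendsto_intros)
  ultimately have "c x a + mean Vinf x a \<le> 0" by (intro LIMSEQ_le_const2) auto
  with a(1) show ?thesis by blast
qed

text \<open>Cost and mean are nonnegative, so an action for which their sum is at most 0 annihilates
  both; lower semicontinuity of the sum is what the selection requires.\<close>

lemma zero_selector:
  obtains f where "f \<in> borel_measurable borel" "range f \<subseteq> A"
    "\<And>x. x \<in> S \<Longrightarrow> Vinf x = 0 \<Longrightarrow> c x (f x) = 0" "\<And>x. x \<in> S \<Longrightarrow> Vinf x = 0 \<Longrightarrow> mean Vinf x (f x) = 0"
proof -
  let ?F = "{x\<in>S. Vinf x = 0}"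
  have "{x\<in>S. Vinf x = 0} = S - {x\<in>S. 0 < Vinf x}" using Vinf_props(2) by force
  also have "\<dots> \<in> sets borel" using lsc_on_borel_sets[OF Vinf_props(1) S_borel] by (intro sets.Diff) auto
  finally have F: "?F \<in> sets borel" "?F \<subseteq> S" by auto
  have lsc: "lsc_on (S \<times> A) (\<lambda>p. (case p of (x, a) \<Rightarrow> c x a) + (case p of (x, a) \<Rightarrow> mean Vinf x a))"
    by (intro lsc_on_add c_lsc mean_lsc Vinf_props)
  obtain f where f: "f \<in> borel_measurable borel" "range f \<subseteq> A" "\<And>x. x \<in> ?F \<Longrightarrow> c x (f x) + mean Vinf x (f x) \<le> 0"
    using measurable_selection_compact[OF lsc A_compact A_nonempty F S_borel, of 0] zero_action by auto
  have "c x (f x) = 0 \<and> mean Vinf x (f x) = 0" if "x \<in> S" "Vinf x = 0" for x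
  proof -
    have fx: "f x \<in> A" using f(2) by blast
    show ?thesis using f(3)[of x] c_nonneg[OF that(1) fx] mean_nonneg[OF Vinf_unit that(1) fx] that by simp
  qed
  with f(1,2) show thesis by (intro that[of f]) auto
qed

section \<open>Transfer of the Bellman inequality to states with cemetery\<close>

definition opt :: "('s \<Rightarrow> real) \<Rightarrow> 's option \<Rightarrow> ennreal" where
  "opt W xo = (case xo of None \<Rightarrow> 0 | Some x \<Rightarrow> if x \<in> S then ennreal (W x) else 0)"

lemma opt_simps [simp]: "opt W None = 0" "x \<in> S \<Longrightarrow> opt W (Some x) = ennreal (W x)"
  by (simp_all add: opt_def)

lemma opt_le_1: "unit_fun W \<Longrightarrow> opt W xo \<le> 1"
  by (auto simp: opt_def unit_fun_def ennreal_le_1 split: option.split)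

lemma opt_measurable: "unit_fun W \<Longrightarrow> opt W \<in> borel_measurable optM"
proof -
  assume "unit_fun W"
  then have "(\<lambda>x. ennreal (W x)) \<in> borel_measurable (restrict_space borel S)"
    by (auto simp: unit_fun_def intro: measurable_compose[OF _ measurable_ennreal])
  then have "(\<lambda>x. if x \<in> S then ennreal (W x) else 0) \<in> borel_measurable borel"
    by (subst (asm) measurable_restrict_space_iff) auto
  then show ?thesis by (simp add: measurable_optM_iff opt_def)
qed

lemma rq_mean:
  assumes W: "unit_fun W" and x: "x \<in> S" "a \<in> A"
  shows "rq (Some x) a * (\<integral>\<^sup>+y. opt W y \<partial>J (Some x) a) = ennreal (mean W x a)"
proof -
  have "rq (Some x) a * (\<integral>\<^sup>+y. opt W y \<partial>J (Some x) a) = (\<integral>\<^sup>+y. ennreal (W y) \<partial>qtM S q x a)"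
    unfolding rq_times_nn_integral_J[OF x opt_measurable[OF W]] by (intro nn_integral_cong) simp
  also have "\<dots> = ennreal (mean W x a)" unfolding mean_def
    using W by (intro nn_integral_eq_integral integrable_unit_fun x) (auto simp: unit_fun_def)
  finally show ?thesis .
qed

lemma opt_ineq:
  assumes W: "unit_fun W" "unit_fun W'"
    and ineq: "\<And>x a. x \<in> S \<Longrightarrow> a \<in> A \<Longrightarrow> W x * (1 + qx q x a) \<le> c x a + mean W' x a"
    and xo: "xo \<in> insert None (Some ` S)" and a: "a \<in> A"
  shows "opt W xo * (1 + rq xo a) \<le> lift (\<lambda>x a. ennreal (c x a)) xo a + rq xo a * (\<integral>\<^sup>+y. opt W' y \<partial>J xo a)"
proof (cases xo)
  case (Some x)
  then have x: "x \<in> S" using xo by auto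
  have "0 \<le> W x" using W(1) x by (simp add: unit_fun_def)
  then have "opt W xo * (1 + rq xo a) = ennreal (W x * (1 + qx q x a))"
    using x a qx_nonneg[OF x a] Some by (simp add: rq_def ennreal_mult ennreal_plus flip: ennreal_1)
  also have "\<dots> \<le> ennreal (c x a + mean W' x a)" by (rule ennreal_leI[OF ineq[OF x a]])
  also have "\<dots> = ennreal (c x a) + ennreal (mean W' x a)"
    using c_nonneg[OF x a] mean_nonneg[OF W(2) x a] by (simp add: ennreal_plus)
  finally show ?thesis using rq_mean[OF W(2) x a] Some x a by simp
qed simp

lemma c_measurable: "(\<lambda>(x, a). c x a) \<in> borel_measurable (restrict_space borel (S \<times> A))"
  by (rule lsc_on_borel_measurable[OF c_lsc]) (use S_borel A_borel in \<open>simp flip: borel_prod\<close>)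

end

section \<open>Occupation measures\<close>

context ctmdp_policy
begin

lemma sojourn_add:
  assumes "(\<lambda>(xo, a). g xo a) \<in> borel_measurable (optM \<Otimes>\<^sub>M MA)" "(\<lambda>(xo, a). h xo a) \<in> borel_measurable (optM \<Otimes>\<^sub>M MA)"
  shows "sojourn (\<lambda>xo a. g xo a + h xo a) n \<omega> = sojourn g n \<omega> + sojourn h n \<omega>"
proof -
  have avg: "avg (\<lambda>xo a. g xo a + h xo a) n \<omega> s = avg g n \<omega> s + avg h n \<omega> s" for s
    using act_section_measurable[OF assms(1)] act_section_measurable[OF assms(2)] by (simp add: avg_def nn_integral_add)
  note [measurable] = avg_measurable1[OF assms(1)] avg_measurable1[OF assms(2)]
    survival_measurable1[of "restrict \<omega> {..n}" n, simplified]
  show ?thesis unfolding sojourn_def avg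
    by (subst nn_integral_add[symmetric]) (auto simp: distrib_left)
qed

lemma sojourn_mono:
  "(\<And>xo a. a \<in> A \<Longrightarrow> g xo a \<le> h xo a) \<Longrightarrow> sojourn g n \<omega> \<le> sojourn h n \<omega>"
  unfolding sojourn_def avg_def by (intro nn_integral_mono mult_left_mono) (auto simp: act_space(3))

lemma sojourn_cmult:
  assumes "(\<lambda>(xo, a). g xo a) \<in> borel_measurable (optM \<Otimes>\<^sub>M MA)"
  shows "sojourn (\<lambda>xo a. k * g xo a) n \<omega> = k * sojourn g n \<omega>"
proof -
  note m = act_section_measurable[OF assms]
  have avg: "avg (\<lambda>xo a. k * g xo a) n \<omega> s = k * avg g n \<omega> s" for s
    using m by (simp add: avg_def nn_integral_cmult)
  note [measurable] = avg_measurable1[OF assms] survival_measurable1[of "restrict \<omega> {..n}" n, simplified]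
  show ?thesis unfolding sojourn_def avg
    by (subst nn_integral_cmult[symmetric]) (auto simp: mult_ac)
qed

lemma sojourn_eq_0:
  assumes "\<And>s. 0 < s \<Longrightarrow> avg g n \<omega> s = 0"
  shows "sojourn g n \<omega> = 0"
proof -
  have "indicator {0<..} s * (survival (rate n \<omega>) s * avg g n \<omega> s) = 0" for s
    using assms by (cases "0 < s") auto
  then show ?thesis unfolding sojourn_def by (simp only: nn_integral_const) simp
qed

lemma next_state_measurable:
  assumes W: "W \<in> borel_measurable optM"
  shows "(\<lambda>(xo, a). rq xo a * (\<integral>\<^sup>+y. W y \<partial>J xo a)) \<in> borel_measurable (optM \<Otimes>\<^sub>M MA)"
proof -
  have "(\<lambda>p. \<integral>\<^sup>+y. W y \<partial>(case p of (xo, a) \<Rightarrow> J xo a)) \<in> borel_measurable (optM \<Otimes>\<^sub>M MA)"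
    by (rule measurable_compose[OF measurable_prob_algebraD[OF J_measurable] nn_integral_measurable_subprob_algebra[OF W]])
  then show ?thesis using rq_measurable unfolding case_prod_beta' by (intro borel_measurable_times_ennreal) auto
qed

text \<open>Policy measures live on A, so the mass of A is the integral of 1. Occupation times
  thereby inherit the decomposition into sojourns that is proved for costs.\<close>

lemma occ_eq_exp_cost: "occ S q \<gamma> pol Z A = exp_cost S q \<gamma> pol (\<lambda>x a. indicator Z x)"
  unfolding occ_def exp_cost_def
proof (intro nn_integral_cong)
  fix \<omega> t
  have eq: "indicator (Some ` Z) (xi \<omega> t) * (if tn \<omega> n < ennreal t \<and> ennreal t \<le> tn \<omega> (Suc n)
        then emeasure (pol (Suc n) \<omega> (t - enn2real (tn \<omega> n))) A else 0) =
      (if tn \<omega> n < ennreal t \<and> ennreal t \<le> tn \<omega> (Suc n)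
        then (\<integral>\<^sup>+ a. ennreal (case xi \<omega> t of None \<Rightarrow> 0 | Some x \<Rightarrow> indicator Z x)
                  \<partial>(pol (Suc n) \<omega> (t - enn2real (tn \<omega> n)))) else 0)" for n
  proof (cases "tn \<omega> n < ennreal t")
    case True
    then have "0 < t" by (metis ennreal_neg leI not_less_zero)
    then have pos: "0 < t - enn2real (tn \<omega> n)" using True by (cases "tn \<omega> n") (auto simp: ennreal_less_iff)
    let ?R = "pol (Suc n) \<omega> (t - enn2real (tn \<omega> n))"
    have "space ?R = A" using act_space(3)[of n \<omega> "t - enn2real (tn \<omega> n)"] by (simp add: act_pos[OF pos])
    then have "(\<integral>\<^sup>+ a. ennreal (case xi \<omega> t of None \<Rightarrow> 0 | Some x \<Rightarrow> indicator Z x) \<partial>?R) =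
        indicator (Some ` Z) (xi \<omega> t) * emeasure ?R A"
      by (cases "xi \<omega> t") (auto simp: inj_image_mem_iff split: split_indicator)
    then show ?thesis by simp
  qed simp
  have "indicator (Some ` Z) (xi \<omega> t) * pact pol \<omega> t A = crate (\<lambda>x a. indicator Z x) pol \<omega> t"
    unfolding pact_def crate_def ennreal_suminf_cmult[symmetric] by (simp only: eq)
  then show "indicator {0..} t * indicator (Some ` Z) (xi \<omega> t) * pact pol \<omega> t A =
      indicator {0..} t * crate (\<lambda>x a. indicator Z x) pol \<omega> t"
    by (simp only: mult.assoc)
qed

context
  fixes \<gamma> :: "'s measure"
  assumes \<gamma>: "prob_space \<gamma>" "sets \<gamma> = sets (restrict_space borel S)"
begin

abbreviation "P \<equiv> law S q \<gamma> pol"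

lemma exp_cost_add:
  assumes "(\<lambda>(x, a). f x a) \<in> borel_measurable (restrict_space borel (S \<times> A))"
    "(\<lambda>(x, a). g x a) \<in> borel_measurable (restrict_space borel (S \<times> A))"
    "\<And>x a. x \<in> S \<Longrightarrow> a \<in> A \<Longrightarrow> 0 \<le> f x a" "\<And>x a. x \<in> S \<Longrightarrow> a \<in> A \<Longrightarrow> 0 \<le> g x a"
  shows "exp_cost S q \<gamma> pol (\<lambda>x a. f x a + g x a) = exp_cost S q \<gamma> pol f + exp_cost S q \<gamma> pol g"
proof -
  have fg: "(\<lambda>(x, a). f x a + g x a) \<in> borel_measurable (restrict_space borel (S \<times> A))"
    using borel_measurable_add[OF assms(1,2)] by (simp add: case_prod_beta')
  have "lift (\<lambda>x a. ennreal (f x a + g x a)) = (\<lambda>xo a. lift (\<lambda>x a. ennreal (f x a)) xo a + lift (\<lambda>x a. ennreal (g x a)) xo a)"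
    using assms(3,4) by (auto simp: fun_eq_iff lift_def split: option.split)
  then show ?thesis
    using assms(1,2) fg
    by (simp add: exp_cost_eq[OF \<gamma>] sojourn_add lift_ennreal_measurable nn_integral_add sojourn_measurable[OF \<gamma> lift_ennreal_measurable] suminf_add[symmetric])
qed

lemma exp_cost_sum:
  assumes "\<And>i. i \<le> N \<Longrightarrow> (\<lambda>(x, a). f i x a) \<in> borel_measurable (restrict_space borel (S \<times> A))"
    "\<And>i x a. i \<le> N \<Longrightarrow> x \<in> S \<Longrightarrow> a \<in> A \<Longrightarrow> 0 \<le> f i x a"
  shows "exp_cost S q \<gamma> pol (\<lambda>x a. \<Sum>i\<le>N. f i x a) = (\<Sum>i\<le>(N::nat). exp_cost S q \<gamma> pol (f i))"
  using assms
proof (induction N)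
  case (Suc N)
  have m: "(\<lambda>(x, a). \<Sum>i\<le>N. f i x a) \<in> borel_measurable (restrict_space borel (S \<times> A))"
    using borel_measurable_sum[of "{..N}" "\<lambda>i (x, a). f i x a"] Suc.prems(1) by (simp add: case_prod_beta')
  have "exp_cost S q \<gamma> pol (\<lambda>x a. (\<Sum>i\<le>N. f i x a) + f (Suc N) x a) =
      exp_cost S q \<gamma> pol (\<lambda>x a. \<Sum>i\<le>N. f i x a) + exp_cost S q \<gamma> pol (f (Suc N))"
    by (rule exp_cost_add[OF m Suc.prems(1)]) (auto intro!: sum_nonneg Suc.prems(2))
  then show ?case using Suc by simp
qed simp

text \<open>\<open>sojourn_inequality\<close> is applied with w frozen at the value of W in x_n, and
  \<open>next_state\<close> converts the jump term into the expectation of W' at x_{n+1}. The pair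
  W, W' is \<open>V (Suc k)\<close>, \<open>V k\<close> for the lower bound on costs, and
  \<open>Vinf\<close> twice for the occupation bound.\<close>

lemma expected_inequality:
  assumes g: "(\<lambda>(xo, a). g xo a) \<in> borel_measurable (optM \<Otimes>\<^sub>M MA)"
    and W: "W \<in> borel_measurable optM" "W' \<in> borel_measurable optM" "W' None = 0"
    and ineq: "\<And>xo a. xo \<in> insert None (Some ` S) \<Longrightarrow> a \<in> A \<Longrightarrow>
      W xo * (1 + rq xo a) \<le> g xo a + rq xo a * (\<integral>\<^sup>+y. W' y \<partial>J xo a)"
  shows "(\<integral>\<^sup>+\<omega>. sojourn (\<lambda>xo a. W xo) n \<omega> \<partial>P) + (\<integral>\<^sup>+\<omega>. W (snd (\<omega> n)) \<partial>P) \<le>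
    (\<integral>\<^sup>+\<omega>. sojourn g n \<omega> \<partial>P) + (\<integral>\<^sup>+\<omega>. W' (snd (\<omega> (Suc n))) \<partial>P)"
proof -
  let ?j = "\<lambda>xo a. rq xo a * (\<integral>\<^sup>+y. W' y \<partial>J xo a)"
  have j: "(\<lambda>(xo, a). ?j xo a) \<in> borel_measurable (optM \<Otimes>\<^sub>M MA)" by (rule next_state_measurable[OF W(2)])
  have Wm: "(\<lambda>(xo, a). W xo) \<in> borel_measurable (optM \<Otimes>\<^sub>M MA)"
    using measurable_compose[OF measurable_fst W(1)] by (simp add: case_prod_beta')
  note D = strategicD[OF law_step_law(1)[OF \<gamma>]]
  have WP: "(\<lambda>\<omega>. W (snd (\<omega> n))) \<in> borel_measurable P"
    by (rule measurable_trajM_sets_eq[OF D(2)]) (use W(1) in measurable)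
  have "(\<integral>\<^sup>+\<omega>. sojourn (\<lambda>xo a. W xo) n \<omega> \<partial>P) + (\<integral>\<^sup>+\<omega>. W (snd (\<omega> n)) \<partial>P) =
    (\<integral>\<^sup>+\<omega>. sojourn (\<lambda>xo a. W xo) n \<omega> + W (snd (\<omega> n)) \<partial>P)"
    by (rule nn_integral_add[symmetric, OF sojourn_measurable[OF \<gamma> Wm] WP])
  also have "\<dots> \<le> (\<integral>\<^sup>+\<omega>. sojourn g n \<omega> + sojourn ?j n \<omega> \<partial>P)"
  proof (rule nn_integral_mono_AE)
    show "AE \<omega> in P. sojourn (\<lambda>xo a. W xo) n \<omega> + W (snd (\<omega> n)) \<le> sojourn g n \<omega> + sojourn ?j n \<omega>"
      using D(3)
    proof eventually_elim
      case (elim \<omega>)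
      \<comment> \<open>Within the sojourn the state is constant, so the constant weight
        \<open>W (snd (\<omega> n))\<close> and the state-dependent weight \<open>W xo\<close> give
        the same integral.\<close>
      have "sojourn (\<lambda>_ _. W (snd (\<omega> n))) n \<omega> + W (snd (\<omega> n)) \<le> sojourn g n \<omega> + sojourn ?j n \<omega>"
        by (rule sojourn_inequality[OF g j]) (use ineq Omega_snd[OF elim] in blast)
      then show ?case by (simp add: sojourn_def avg_def)
    qed
  qed
  also have "\<dots> = (\<integral>\<^sup>+\<omega>. sojourn g n \<omega> \<partial>P) + (\<integral>\<^sup>+\<omega>. sojourn ?j n \<omega> \<partial>P)"
    by (rule nn_integral_add[OF sojourn_measurable[OF \<gamma> g] sojourn_measurable[OF \<gamma> j]])
  also have "(\<integral>\<^sup>+\<omega>. sojourn ?j n \<omega> \<partial>P) = (\<integral>\<^sup>+\<omega>. W' (snd (\<omega> (Suc n))) \<partial>P)"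
    by (rule next_state[OF \<gamma> W(2,3), symmetric])
  finally show ?thesis .
qed

end

end

section \<open>Cost and occupation bounds for an arbitrary policy\<close>

locale ctmdp_cost_policy = ctmdp_cost S A q c + ctmdp_policy S A q pol
  for S :: "'s::polish_space set" and A :: "'a::polish_space set" and q :: "'s \<Rightarrow> 'a \<Rightarrow> 's set \<Rightarrow> real"
    and c :: "'s \<Rightarrow> 'a \<Rightarrow> real" and pol :: "nat \<Rightarrow> 's traj \<Rightarrow> real \<Rightarrow> 'a measure"
begin

abbreviation cO :: "'s option \<Rightarrow> 'a \<Rightarrow> ennreal" where
  "cO \<equiv> lift (\<lambda>x a. ennreal (c x a))"

lemma cO_measurable: "(\<lambda>(xo, a). cO xo a) \<in> borel_measurable (optM \<Otimes>\<^sub>M MA)"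
  by (rule lift_ennreal_measurable[OF c_measurable])

lemma opt_measurable2: "unit_fun W \<Longrightarrow> (\<lambda>(xo, a). opt W xo) \<in> borel_measurable (optM \<Otimes>\<^sub>M MA)"
  using measurable_compose[OF measurable_fst opt_measurable] by (simp add: case_prod_beta')

context
  fixes \<gamma> :: "'s measure"
  assumes \<gamma>: "prob_space \<gamma>" "sets \<gamma> = sets (restrict_space borel S)"
begin

text \<open>Each sojourn lowers the iteration index by one, and \<open>V 0 = 0\<close> leaves no
  boundary term. So the expectation of \<open>V k\<close> at any jump index is at most the cost of
  the next k sojourns; the nonnegative occupation term is dropped.\<close>

lemma cost_ge_V: "(\<integral>\<^sup>+x. opt (V k) (Some x) \<partial>\<gamma>) \<le> exp_cost S q \<gamma> pol c"
proof -
  let ?P = "law S q \<gamma> pol"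
  have "(\<integral>\<^sup>+\<omega>. opt (V k) (snd (\<omega> n)) \<partial>?P) \<le> (\<Sum>i<k. \<integral>\<^sup>+\<omega>. sojourn cO (n + i) \<omega> \<partial>?P)" for n
  proof (induction k arbitrary: n)
    case 0
    have "opt (V 0) xo = 0" for xo by (simp add: opt_def split: option.split)
    then show ?case by simp
  next
    case (Suc k)
    have "(\<integral>\<^sup>+\<omega>. sojourn (\<lambda>xo a. opt (V (Suc k)) xo) n \<omega> \<partial>?P) + (\<integral>\<^sup>+\<omega>. opt (V (Suc k)) (snd (\<omega> n)) \<partial>?P) \<le>
        (\<integral>\<^sup>+\<omega>. sojourn cO n \<omega> \<partial>?P) + (\<integral>\<^sup>+\<omega>. opt (V k) (snd (\<omega> (Suc n))) \<partial>?P)"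
      by (rule expected_inequality[OF \<gamma> cO_measurable]) (auto intro: opt_measurable V_unit opt_ineq V_Suc_ineq simp del: V.simps)
    then have "(\<integral>\<^sup>+\<omega>. opt (V (Suc k)) (snd (\<omega> n)) \<partial>?P) \<le>
        (\<integral>\<^sup>+\<omega>. sojourn cO n \<omega> \<partial>?P) + (\<integral>\<^sup>+\<omega>. opt (V k) (snd (\<omega> (Suc n))) \<partial>?P)"
      by (rule order_trans[rotated]) simp
    also have "\<dots> \<le> (\<integral>\<^sup>+\<omega>. sojourn cO n \<omega> \<partial>?P) + (\<Sum>i<k. \<integral>\<^sup>+\<omega>. sojourn cO (Suc n + i) \<omega> \<partial>?P)"
      by (intro add_left_mono Suc.IH)
    also have "\<dots> = (\<Sum>i<Suc k. \<integral>\<^sup>+\<omega>. sojourn cO (n + i) \<omega> \<partial>?P)"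
      by (subst sum.lessThan_Suc_shift) simp
    finally show ?case .
  qed
  from this[of 0] have "(\<integral>\<^sup>+\<omega>. opt (V k) (snd (\<omega> 0)) \<partial>?P) \<le> (\<Sum>i<k. \<integral>\<^sup>+\<omega>. sojourn cO i \<omega> \<partial>?P)" by simp
  also have "\<dots> \<le> exp_cost S q \<gamma> pol c"
    unfolding exp_cost_eq[OF \<gamma> c_measurable] by (rule sum_le_suminf) auto
  finally show ?thesis
    using law_step_law(3)[OF \<gamma>, of "\<lambda>z. opt (V k) (snd z)"] measurable_compose[OF measurable_snd_stepM opt_measurable[OF V_unit]]
    by simp
qed

text \<open>Telescoping with the limit function in place of the iterates, so one inequality serves
  every n. All terms stay in additive form to avoid truncated subtraction; the remaining boundary
  expectation is at most 1 because \<open>Vinf\<close> is.\<close>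

lemma occupation_le: "(\<Sum>n. \<integral>\<^sup>+\<omega>. sojourn (\<lambda>xo a. opt Vinf xo) n \<omega> \<partial>law S q \<gamma> pol) \<le> exp_cost S q \<gamma> pol c + 1"
proof -
  let ?P = "law S q \<gamma> pol"
  let ?e = "\<lambda>n. \<integral>\<^sup>+\<omega>. opt Vinf (snd (\<omega> n)) \<partial>?P"
  let ?O = "\<lambda>n. \<integral>\<^sup>+\<omega>. sojourn (\<lambda>xo a. opt Vinf xo) n \<omega> \<partial>?P"
  let ?C = "\<lambda>n. \<integral>\<^sup>+\<omega>. sojourn cO n \<omega> \<partial>?P"
  have step: "?O n + ?e n \<le> ?C n + ?e (Suc n)" for n
    by (rule expected_inequality[OF \<gamma> cO_measurable]) (auto intro: opt_measurable Vinf_unit opt_ineq Vinf_ineq)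
  have tele: "(\<Sum>n<m. ?O n) + ?e 0 \<le> (\<Sum>n<m. ?C n) + ?e m" for m
  proof (induction m)
    case (Suc m)
    have "(\<Sum>n<Suc m. ?O n) + ?e 0 = ((\<Sum>n<m. ?O n) + ?e 0) + ?O m" by (simp add: ac_simps)
    also have "\<dots> \<le> ((\<Sum>n<m. ?C n) + ?e m) + ?O m" by (intro add_right_mono Suc)
    also have "\<dots> = (\<Sum>n<m. ?C n) + (?O m + ?e m)" by (simp add: ac_simps)
    also have "\<dots> \<le> (\<Sum>n<m. ?C n) + (?C m + ?e (Suc m))" by (intro add_left_mono step)
    finally show ?case by (simp add: ac_simps)
  qed simp
  have e_le: "?e m \<le> 1" for m
  proof -
    interpret prob_space ?P by (rule strategicD(1)[OF law_step_law(1)[OF \<gamma>]])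
    have "?e m \<le> (\<integral>\<^sup>+\<omega>. 1 \<partial>?P)" by (intro nn_integral_mono opt_le_1 Vinf_unit)
    then show ?thesis by (simp add: emeasure_space_1)
  qed
  have "(\<Sum>n<m. ?O n) \<le> exp_cost S q \<gamma> pol c + 1" for m
  proof -
    have "(\<Sum>n<m. ?O n) \<le> (\<Sum>n<m. ?O n) + ?e 0" by simp
    also have "\<dots> \<le> (\<Sum>n<m. ?C n) + ?e m" by (rule tele)
    also have "\<dots> \<le> (\<Sum>n. ?C n) + 1" by (intro add_mono sum_le_suminf e_le) auto
    finally show ?thesis by (simp add: exp_cost_eq[OF \<gamma> c_measurable])
  qed
  then show ?thesis by (simp add: suminf_eq_SUP SUP_le_iff)
qed

text \<open>Markov's inequality: on the set in question the indicator is at most (m + 1) times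
  \<open>Vinf\<close>, whose integral against the occupation measure is bounded by the cost plus
  1.\<close>

lemma occ_finite:
  assumes "exp_cost S q \<gamma> pol c < \<top>"
  shows "occ S q \<gamma> pol {x\<in>S. 1 / real (Suc m) < Vinf x} A < \<top>"
proof -
  let ?Z = "{x\<in>S. 1 / real (Suc m) < Vinf x}"
  have Z: "?Z \<in> sets borel" by (rule lsc_on_borel_sets[OF Vinf_props(1) S_borel])
  have ind: "(\<lambda>(x, a). indicator ?Z x :: real) \<in> borel_measurable (restrict_space borel (S \<times> A))"
  proof -
    have "(fst :: 's \<times> 'a \<Rightarrow> 's) \<in> measurable (restrict_space borel (S \<times> A)) borel"
      by (rule measurable_restrict_space1) (simp flip: borel_prod)
    from measurable_compose[OF this borel_measurable_indicator[OF Z]] show ?thesis by (simp add: case_prod_beta')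
  qed
  have le: "lift (\<lambda>x a. ennreal (indicator ?Z x)) xo a \<le> ennreal (real (Suc m)) * opt Vinf xo" for xo a
  proof (cases xo)
    case (Some x)
    show ?thesis
    proof (cases "x \<in> ?Z \<and> a \<in> A")
      case True
      then have "1 \<le> ennreal (real (Suc m) * Vinf x)" by (simp add: field_simps)
      then have "1 \<le> ennreal (real (Suc m)) * ennreal (Vinf x)"
        using True Vinf_props(2)[of x] by (subst ennreal_mult[symmetric]) auto
      then show ?thesis using True Some by (simp del: of_nat_Suc)
    qed (auto simp: Some lift_def)
  qed simp
  have "occ S q \<gamma> pol ?Z A = (\<Sum>n. \<integral>\<^sup>+\<omega>. sojourn (lift (\<lambda>x a. ennreal (indicator ?Z x))) n \<omega> \<partial>law S q \<gamma> pol)"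
    unfolding occ_eq_exp_cost by (rule exp_cost_eq[OF \<gamma> ind])
  also have "\<dots> \<le> (\<Sum>n. \<integral>\<^sup>+\<omega>. sojourn (\<lambda>xo a. ennreal (real (Suc m)) * opt Vinf xo) n \<omega> \<partial>law S q \<gamma> pol)"
    by (intro suminf_le nn_integral_mono sojourn_mono le) auto
  also have "\<dots> = ennreal (real (Suc m)) * (\<Sum>n. \<integral>\<^sup>+\<omega>. sojourn (\<lambda>xo a. opt Vinf xo) n \<omega> \<partial>law S q \<gamma> pol)"
    by (simp add: sojourn_cmult opt_measurable2 Vinf_unit nn_integral_cmult sojourn_measurable[OF \<gamma>] del: of_nat_Suc)
  also have "\<dots> \<le> ennreal (real (Suc m)) * (exp_cost S q \<gamma> pol c + 1)"
    by (intro mult_left_mono occupation_le) simp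
  also have "\<dots> < \<top>" using assms by (simp add: ennreal_mult_less_top del: of_nat_Suc)
  finally show ?thesis .
qed

end

end

section \<open>States of value zero and the identification of \<open>zeta\<close>\<close>

context ctmdp_cost
begin

text \<open>Under the selector the set where \<open>Vinf\<close> vanishes is absorbing: a mean of 0
  for \<open>Vinf\<close> under q~ means that jumps almost surely land in it again. By induction
  every x_n lies there or in the cemetery almost surely, where the selected action costs
  nothing.\<close>

lemma zero_policy:
  assumes x0: "x0 \<in> S" "Vinf x0 = 0"
  obtains pol where "is_DM S A pol" "exp_cost S q (return (restrict_space borel S) x0) pol c = 0"
proof -
  obtain f where f: "f \<in> borel_measurable borel" "range f \<subseteq> A"
    "\<And>x. x \<in> S \<Longrightarrow> Vinf x = 0 \<Longrightarrow> c x (f x) = 0" "\<And>x. x \<in> S \<Longrightarrow> Vinf x = 0 \<Longrightarrow> mean Vinf x (f x) = 0"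
    using zero_selector by metis
  have fA: "f x \<in> A" for x using f(2) by blast
  \<comment> \<open>A policy must prescribe an admissible action for every history, also in the
    cemetery. The selector takes values in A everywhere, so only \<open>None\<close> needs a
    filler.\<close>
  obtain a0 where a0: "a0 \<in> A" using A_nonempty by blast
  define f' where "f' xo = (case xo of None \<Rightarrow> a0 | Some x \<Rightarrow> f x)" for xo
  have f'A: "f' xo \<in> A" for xo using fA a0 by (simp add: f'_def split: option.split)
  have "f' \<in> borel_measurable optM" using f(1) by (simp add: measurable_optM_iff f'_def)
  then have f'_m: "f' \<in> measurable optM MA" using f'A by (intro measurable_restrict_space2) auto
  define pol where "pol n \<omega> s = return MA (f' (snd (\<omega> (n - 1))))" for n :: nat and \<omega> :: "'s traj" and s :: real
  have "(\<lambda>p. return MA (f' (snd (fst p (n - 1))))) \<in> measurable (trajM \<Otimes>\<^sub>M restrict_space borel {0<..}) (prob_algebra MA)" for n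
  proof -
    have "(\<lambda>p. snd (fst p (n - 1))) \<in> measurable (trajM \<Otimes>\<^sub>M restrict_space borel {0<..}) optM" by measurable
    from measurable_compose[OF measurable_compose[OF this f'_m] measurable_return_prob_space] show ?thesis .
  qed
  then have policy: "is_policy S A pol"
    unfolding is_policy_def pol_def by (auto simp: case_prod_beta')
  have DM: "is_DM S A pol" using policy f'A unfolding is_DM_def by (auto simp: pol_def)
  interpret ctmdp_policy S A q pol by unfold_locales (rule policy)
  define \<gamma> where "\<gamma> = return (restrict_space borel S) x0"
  have \<gamma>: "prob_space \<gamma>" "sets \<gamma> = sets (restrict_space borel S)"
    using x0 by (simp_all add: \<gamma>_def prob_space_return space_restrict_space)
  let ?P = "law S q \<gamma> pol"
  note D = strategicD[OF law_step_law(1)[OF \<gamma>]]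
  let ?j = "\<lambda>xo a. rq xo a * (\<integral>\<^sup>+y. opt Vinf y \<partial>J xo a)"
  have avg: "avg g n \<omega> s = g (snd (\<omega> n)) (f' (snd (\<omega> n)))"
    if "(\<lambda>(xo, a). g xo a) \<in> borel_measurable (optM \<Otimes>\<^sub>M MA)" "0 < s" for g n \<omega> s
  proof -
    have "g (snd (\<omega> n)) \<in> borel_measurable MA" using measurable_Pair2[OF that(1), of "snd (\<omega> n)"] by simp
    then show ?thesis using f'A unfolding avg_def act_pos[OF that(2)] by (simp add: pol_def nn_integral_return)
  qed
  have cO: "(\<lambda>(xo, a). lift (\<lambda>x a. ennreal (c x a)) xo a) \<in> borel_measurable (optM \<Otimes>\<^sub>M MA)"
    by (rule lift_ennreal_measurable[OF c_measurable])
  have j: "(\<lambda>(xo, a). ?j xo a) \<in> borel_measurable (optM \<Otimes>\<^sub>M MA)"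
    by (rule next_state_measurable[OF opt_measurable[OF Vinf_unit]])
  have zero: "sojourn ?j n \<omega> = 0" "sojourn (lift (\<lambda>x a. ennreal (c x a))) n \<omega> = 0"
    if "\<omega> \<in> Omega S" "opt Vinf (snd (\<omega> n)) = 0" for n \<omega>
  proof -
    have "?j (snd (\<omega> n)) (f' (snd (\<omega> n))) = 0 \<and> lift (\<lambda>x a. ennreal (c x a)) (snd (\<omega> n)) (f' (snd (\<omega> n))) = 0"
    proof (cases "snd (\<omega> n)")
      case None then show ?thesis by (simp add: rq_def)
    next
      case (Some x)
      then have x: "x \<in> S" using Omega_snd[OF that(1), of n] by auto
      then have "Vinf x = 0" using that(2) Some Vinf_props(2)[OF x] by simp
      then show ?thesis using f(3,4)[OF x] rq_mean[OF Vinf_unit x fA] Some x fA by (simp add: f'_def)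
    qed
    then show "sojourn ?j n \<omega> = 0" "sojourn (lift (\<lambda>x a. ennreal (c x a))) n \<omega> = 0"
      using avg[OF j] avg[OF cO] by (auto intro!: sojourn_eq_0)
  qed
  have m: "(\<lambda>\<omega>. opt Vinf (snd (\<omega> n))) \<in> borel_measurable ?P" for n
    by (rule measurable_trajM_sets_eq[OF D(2)])
       (rule measurable_compose[OF measurable_compose[OF measurable_component_trajM measurable_snd_stepM] opt_measurable[OF Vinf_unit]])
  have null: "AE \<omega> in ?P. opt Vinf (snd (\<omega> n)) = 0" for n
  proof (induction n)
    case 0
    have "(\<integral>\<^sup>+\<omega>. opt Vinf (snd (\<omega> 0)) \<partial>?P) = (\<integral>\<^sup>+x. opt Vinf (Some x) \<partial>\<gamma>)"
      using law_step_law(3)[OF \<gamma>, of "\<lambda>z. opt Vinf (snd z)"] measurable_compose[OF measurable_snd_stepM opt_measurable[OF Vinf_unit]] by simp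
    also have "\<dots> = opt Vinf (Some x0)"
      using x0 measurable_restrict_space1[OF measurable_compose[OF measurable_Some opt_measurable[OF Vinf_unit]], of S]
      unfolding \<gamma>_def by (subst nn_integral_return) (simp_all add: space_restrict_space)
    finally show ?case using x0 m[of 0] by (simp add: nn_integral_0_iff_AE)
  next
    case (Suc n)
    have "(\<integral>\<^sup>+\<omega>. opt Vinf (snd (\<omega> (Suc n))) \<partial>?P) = (\<integral>\<^sup>+\<omega>. sojourn ?j n \<omega> \<partial>?P)"
      by (rule next_state[OF \<gamma> opt_measurable[OF Vinf_unit]]) simp
    also have "\<dots> = (\<integral>\<^sup>+\<omega>. 0 \<partial>?P)"
    proof (rule nn_integral_cong_AE)
      show "AE \<omega> in ?P. sojourn ?j n \<omega> = 0" using D(3) Suc by eventually_elim (rule zero)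
    qed
    finally show ?case using m[of "Suc n"] by (simp add: nn_integral_0_iff_AE)
  qed
  have "(\<integral>\<^sup>+\<omega>. sojourn (lift (\<lambda>x a. ennreal (c x a))) n \<omega> \<partial>?P) = (\<integral>\<^sup>+\<omega>. 0 \<partial>?P)" for n
  proof (rule nn_integral_cong_AE)
    show "AE \<omega> in ?P. sojourn (lift (\<lambda>x a. ennreal (c x a))) n \<omega> = 0"
      using D(3) null[of n] by eventually_elim (rule zero)
  qed
  then have "exp_cost S q \<gamma> pol c = 0" unfolding exp_cost_eq[OF \<gamma> c_measurable] by simp
  with DM show thesis by (intro that[of pol]) (simp_all add: \<gamma>_def)
qed

text \<open>A single \<open>V k x\<close> bounds the cost of all policies at once, so strict
  positivity survives the infimum. Conversely, the zero-cost policy is deterministic Markov and thus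
  competes in the infimum.\<close>

lemma zeta_eq:
  "{x\<in>S. (\<Sqinter>pol\<in>{pol. is_DM S A pol}. exp_cost S q (return (restrict_space borel S) x) pol c) > 0} = {x\<in>S. 0 < Vinf x}"
proof (intro Collect_cong conj_cong refl)
  fix x assume x: "x \<in> S"
  let ?\<gamma> = "return (restrict_space borel S) x"
  have \<gamma>: "prob_space ?\<gamma>" "sets ?\<gamma> = sets (restrict_space borel S)"
    using x by (simp_all add: prob_space_return space_restrict_space)
  show "(\<Sqinter>pol\<in>{pol. is_DM S A pol}. exp_cost S q ?\<gamma> pol c) > 0 \<longleftrightarrow> 0 < Vinf x"
  proof
    assume pos: "(\<Sqinter>pol\<in>{pol. is_DM S A pol}. exp_cost S q ?\<gamma> pol c) > 0"
    show "0 < Vinf x"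
    proof (rule ccontr)
      assume "\<not> 0 < Vinf x"
      then have "Vinf x = 0" using Vinf_props(2)[OF x] by simp
      from zero_policy[OF x this] obtain pol where "is_DM S A pol" "exp_cost S q ?\<gamma> pol c = 0" by metis
      then have "(\<Sqinter>pol\<in>{pol. is_DM S A pol}. exp_cost S q ?\<gamma> pol c) \<le> 0" by (intro INF_lower2[of pol]) auto
      with pos show False by simp
    qed
  next
    assume "0 < Vinf x"
    then obtain k where k: "0 < V k x" unfolding Vinf_def using less_cSUP_iff[OF _ V_bdd[OF x], of 0] by auto
    have "ennreal (V k x) \<le> exp_cost S q ?\<gamma> pol c" if "is_DM S A pol" for pol
    proof -
      interpret ctmdp_cost_policy S A q c pol by unfold_locales (use that in \<open>simp add: is_DM_def\<close>)
      have "(\<integral>\<^sup>+y. opt (V k) (Some y) \<partial>?\<gamma>) = opt (V k) (Some x)"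
        using x measurable_restrict_space1[OF measurable_compose[OF measurable_Some opt_measurable[OF V_unit[of k]]], of S]
        by (subst nn_integral_return) (simp_all add: space_restrict_space)
      then show ?thesis using cost_ge_V[OF \<gamma>, of k] x by simp
    qed
    then have "ennreal (V k x) \<le> (\<Sqinter>pol\<in>{pol. is_DM S A pol}. exp_cost S q ?\<gamma> pol c)" by (intro INF_greatest) auto
    moreover have "0 < ennreal (V k x)" using k by simp
    ultimately show "(\<Sqinter>pol\<in>{pol. is_DM S A pol}. exp_cost S q ?\<gamma> pol c) > 0" by (rule less_le_trans[rotated])
  qed
qed

end

theorem theorem5p1:
  fixes S :: "'s::polish_space set" and A :: "'a::polish_space set"
    and q :: "'s \<Rightarrow> 'a \<Rightarrow> 's set \<Rightarrow> real" and \<gamma> :: "'s measure"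
    and c :: "nat \<Rightarrow> 's \<Rightarrow> 'a \<Rightarrow> real" and N :: nat and d :: "nat \<Rightarrow> real"
    and pol :: "nat \<Rightarrow> 's traj \<Rightarrow> real \<Rightarrow> 'a measure"
  assumes "ctmdp_model S A q"
    and "prob_space \<gamma>" and "sets \<gamma> = sets (restrict_space borel S)"
    and "costs_ok S A c N d"
    and "condition1 S A q c N"
    and "feasible_finite S A q \<gamma> c N d pol"
  shows "\<exists>Z :: nat \<Rightarrow> 's set. (\<forall>k. Z k \<in> sets borel \<and> Z k \<subseteq> zeta S A q c N) \<and>
           (\<Union>k. Z k) = zeta S A q c N \<and>
           (\<forall>k. occ S q \<gamma> pol (Z k) A < \<top>)"
proof -
  let ?c = "\<lambda>x a. \<Sum>i\<le>N. c i x a"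
  have cm: "\<And>i. i \<le> N \<Longrightarrow> (\<lambda>(x, a). c i x a) \<in> borel_measurable (restrict_space borel (S \<times> A))"
    and cn: "\<And>i x a. i \<le> N \<Longrightarrow> x \<in> S \<Longrightarrow> a \<in> A \<Longrightarrow> 0 \<le> c i x a"
    using assms(4) by (auto simp: costs_ok_def)
  have "lsc_on (S \<times> A) (\<lambda>p. \<Sum>i\<le>N. (case p of (x, a) \<Rightarrow> c i x a))"
    using assms(5) by (intro lsc_on_sum) (auto simp: condition1_def lsc_on_def)
  then have lsc: "lsc_on (S \<times> A) (\<lambda>(x, a). ?c x a)" by (simp add: case_prod_beta')
  \<comment> \<open>\<open>zeta\<close> is defined by the sum of all costs, so the single cost
    function of the locale is this sum.\<close>
  interpret ctmdp_cost_policy S A q ?c pol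
    by unfold_locales (use assms cn lsc in \<open>auto simp: condition1_def feasible_finite_def intro!: sum_nonneg\<close>)
  have fin: "exp_cost S q \<gamma> pol (c i) < \<top>" if "i \<le> N" for i
  proof (cases i)
    case 0 then show ?thesis using assms(6) by (simp add: feasible_finite_def)
  next
    case (Suc j)
    then have "exp_cost S q \<gamma> pol (c i) \<le> ennreal (d i)" using assms(6) that by (simp add: feasible_finite_def)
    then show ?thesis by (rule le_less_trans) simp
  qed
  \<comment> \<open>The objective is finite and each constraint cost is bounded by a real constant;
    nonnegativity makes the expected sum the sum of the expectations.\<close>
  then have total: "exp_cost S q \<gamma> pol ?c < \<top>"
    by (simp add: exp_cost_sum[OF assms(2,3) cm cn] ennreal_sum_less_top)
  have zeta: "zeta S A q c N = {x\<in>S. 0 < Vinf x}"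
    unfolding zeta_def by (rule zeta_eq)
  define Z where "Z m = {x\<in>S. 1 / real (Suc m) < Vinf x}" for m
  have "(\<Union>m. Z m) = {x\<in>S. 0 < Vinf x}"
  proof safe
    fix x m assume "x \<in> Z m"
    then show "x \<in> S" "0 < Vinf x" by (auto simp: Z_def intro: less_trans[of 0 "1 / real (Suc m)"])
  next
    fix x assume "x \<in> S" "0 < Vinf x"
    then obtain m where "1 / real (Suc m) < Vinf x" using nat_approx_posE by metis
    with \<open>x \<in> S\<close> show "x \<in> (\<Union>m. Z m)" by (auto simp: Z_def)
  qed
  moreover have "Z m \<in> sets borel" for m unfolding Z_def by (rule lsc_on_borel_sets[OF Vinf_props(1) S_borel])
  moreover have "occ S q \<gamma> pol (Z m) A < \<top>" for m unfolding Z_def by (rule occ_finite[OF assms(2,3) total])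
  ultimately show ?thesis unfolding zeta by (intro exI[of _ Z]) auto
qed

end
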